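(* Let $d=2$ and let $4\le r_{\min}\le r_{\max}$ be constants and $r=r(n)\in[r_{\min},r_{\max}]$. There exist positive constants $C$ and $c$ such that, with high probability as $n\to\infty$, for all $A\subset L_1(G)$ that induce a connected subgraph and satisfy $\frac12\ge\pi(A)\ge\frac{C(\log n)^2}{n}$, the number of edges between $A$ and $L_1(G)\setminus A$ is at least $c\sqrt{\deg(A)}$.
   Context: $\Lambda_n^{(2)}$ is the torus $\left[-\frac{\sqrt n}{2},\frac{\sqrt n}{2}\right]^2$; $G$ is the random geometric graph whose vertices form a Poisson point process of intensity $1$ on $\Lambda_n^{(2)}$, with edges between vertices at Euclidean distance at most $r(n)$. For such radii $G$ has, with high probability, a unique component of size of order $n$, the giant component $L_1(G)$. $\deg(A)=\sum_{x\in A}\deg(x)$ and $\pi(A)=\deg(A)/\deg(L_1(G))$ is the stationary measure of the simple random walk on $L_1(G)$. "With high probability" means with probability tending to $1$ as $n\to\infty$. *)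

theory Defs
  imports "HOL-Probability.Probability"
begin

definition side :: "nat \<Rightarrow> real" where
  "side n = sqrt (real n)"

definition torus_box :: "nat \<Rightarrow> (real \<times> real) set" where
  "torus_box n = {- side n / 2 .. side n / 2} \<times> {- side n / 2 .. side n / 2}"

definition per_dist :: "real \<Rightarrow> real \<Rightarrow> real" where
  "per_dist L t = \<bar>t - L * of_int (round (t / L))\<bar>"

definition torus_dist :: "nat \<Rightarrow> real \<times> real \<Rightarrow> real \<times> real \<Rightarrow> real" where
  "torus_dist n p q =
     sqrt ((per_dist (side n) (fst p - fst q))\<^sup>2 + (per_dist (side n) (snd p - snd q))\<^sup>2)"

text \<open>Poisson point process of intensity 1 on Lambda_n, realised in the standard way:
  a Poisson(n) number N of points, and an i.i.d. sequence X of uniform points in Lambda_n,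
  independent of N; the point set is X 0, ..., X (N-1).  An outcome is the pair (N, X).\<close>
definition ppp :: "nat \<Rightarrow> (nat \<times> (nat \<Rightarrow> real \<times> real)) measure" where
  "ppp n = measure_pmf (poisson_pmf (real n)) \<Otimes>\<^sub>M
           (\<Pi>\<^sub>M i\<in>(UNIV :: nat set). uniform_measure lborel (torus_box n))"

definition verts :: "nat \<times> (nat \<Rightarrow> real \<times> real) \<Rightarrow> nat set" where
  "verts \<omega> = {..< fst \<omega>}"

definition adj :: "nat \<Rightarrow> real \<Rightarrow> nat \<times> (nat \<Rightarrow> real \<times> real) \<Rightarrow> nat \<Rightarrow> nat \<Rightarrow> bool" where
  "adj n r \<omega> i j \<longleftrightarrow> i \<in> verts \<omega> \<and> j \<in> verts \<omega> \<and> i \<noteq> j \<and>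
      torus_dist n (snd \<omega> i) (snd \<omega> j) \<le> r"

definition components :: "nat \<Rightarrow> real \<Rightarrow> nat \<times> (nat \<Rightarrow> real \<times> real) \<Rightarrow> nat set set" where
  "components n r \<omega> = (\<lambda>i. {j. (adj n r \<omega>)\<^sup>*\<^sup>* i j}) ` verts \<omega>"

text \<open>Largest components (a component of maximum size; w.h.p. the giant is the unique one).\<close>
definition largest_component :: "nat \<Rightarrow> real \<Rightarrow> nat \<times> (nat \<Rightarrow> real \<times> real) \<Rightarrow> nat set \<Rightarrow> bool" where
  "largest_component n r \<omega> K \<longleftrightarrow> K \<in> components n r \<omega> \<and>
      (\<forall>K' \<in> components n r \<omega>. card K' \<le> card K)"

definition induces_connected :: "nat \<Rightarrow> real \<Rightarrow> nat \<times> (nat \<Rightarrow> real \<times> real) \<Rightarrow> nat set \<Rightarrow> bool" where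
  "induces_connected n r \<omega> A \<longleftrightarrow> A \<noteq> {} \<and>
      (\<forall>i\<in>A. \<forall>j\<in>A. (\<lambda>x y. adj n r \<omega> x y \<and> x \<in> A \<and> y \<in> A)\<^sup>*\<^sup>* i j)"

definition vdeg :: "nat \<Rightarrow> real \<Rightarrow> nat \<times> (nat \<Rightarrow> real \<times> real) \<Rightarrow> nat \<Rightarrow> nat" where
  "vdeg n r \<omega> i = card {j. adj n r \<omega> i j}"

definition sdeg :: "nat \<Rightarrow> real \<Rightarrow> nat \<times> (nat \<Rightarrow> real \<times> real) \<Rightarrow> nat set \<Rightarrow> nat" where
  "sdeg n r \<omega> A = (\<Sum>i\<in>A. vdeg n r \<omega> i)"

definition stat :: "nat \<Rightarrow> real \<Rightarrow> nat \<times> (nat \<Rightarrow> real \<times> real) \<Rightarrow> nat set \<Rightarrow> nat set \<Rightarrow> real" where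
  "stat n r \<omega> L A = real (sdeg n r \<omega> A) / real (sdeg n r \<omega> L)"

definition edges_between :: "nat \<Rightarrow> real \<Rightarrow> nat \<times> (nat \<Rightarrow> real \<times> real) \<Rightarrow> nat set \<Rightarrow> nat set \<Rightarrow> nat" where
  "edges_between n r \<omega> A B = card {(i, j). i \<in> A \<and> j \<in> B \<and> adj n r \<omega> i j}"

end

theory Submission
  imports Defs "HOL-Real_Asymp.Real_Asymp"
begin

text \<open>
  Cut the torus into cells of side \<open>s\<close> between \<open>r / 3\<close> and \<open>0.35 * r\<close>, so that points in cells sharing a
  corner are adjacent, and group the cells into square blocks of side \<open>ell\<close> of order \<open>log n\<close>.
  Since \<open>4 * exp (- s\<^sup>2) < 1\<close>, a Peierls estimate shows that with high probability every path of
  \<open>ell\<close> cells contains more than \<open>kap = ell / 100\<close> occupied ones. Grow a block \<open>B\<close> by the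
  first-passage percolation in which only occupied cells cost time: the ball of radius \<open>kap\<close>
  stays inside the three by three blocks around \<open>B\<close>, and the outer boundaries of the balls of
  radius \<open>k < kap\<close> are disjoint circuits of occupied cells around \<open>B\<close>, each of them connected
  in the graph.

  A connected set that meets \<open>B\<close> and leaves the surrounding three by three blocks touches every
  circuit. So if \<open>A\<close> meets \<open>B\<close> but misses a neighbouring block, or if also a large component of
  \<open>L - A\<close> meets \<open>B\<close>, then each of the \<open>kap\<close> circuits carries a boundary edge of \<open>A\<close>. The
  isoperimetric inequality on the torus of blocks provides of order \<open>sqrt (card blocks)\<close> such
  blocks, and a block has total degree of order \<open>ell\<^sup>2\<close>, which gives the bound. The lower bound
  on \<open>\<pi>(A)\<close> ensures that \<open>A\<close> is not contained in three by three blocks.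
\<close>

section \<open>Circuits of open cells in the square grid\<close>

text \<open>The powers of \<open>log n\<close> have to cancel. A block holds degree of order
  \<open>ell\<^sup>2\<close>, so it contributes a factor \<open>ell\<close> to the square root of
  the degree, and this is the order of the number \<open>kap\<close> of circuits around it; one
  circuit per block would lose a logarithm.

  The assumption that radii are at least 4 enters as \<open>s \<ge> 4 / 3\<close>, where 4 choices
  per step are outweighed by the probability \<open>exp (- 16 / 9)\<close> of an empty cell. The
  ratio 100 between \<open>ell\<close> and \<open>kap\<close> leaves room for choosing the few
  occupied positions of a path.

  Three obstacles shape the proof. Edges may jump over a circuit:
  \<open>r / s \<ge> 2 * sqrt 2\<close> makes one end of such an edge equal or adjacent to a circuit
  vertex. Degrees are unbounded: second moments of cell counts over windows take the place of a
  degree bound. The torus is not simply connected: circuits are built in the periodic lift to the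
  plane, inside squares smaller than the period.\<close>

definition nb4 :: "int \<times> int \<Rightarrow> int \<times> int \<Rightarrow> bool" where
  "nb4 p q \<longleftrightarrow> \<bar>fst p - fst q\<bar> + \<bar>snd p - snd q\<bar> = 1"

definition nb8 :: "int \<times> int \<Rightarrow> int \<times> int \<Rightarrow> bool" where
  "nb8 p q \<longleftrightarrow> \<bar>fst p - fst q\<bar> \<le> 1 \<and> \<bar>snd p - snd q\<bar> \<le> 1"

text \<open>The empty path is allowed even at a point outside \<open>S\<close>, so membership of the
  end has to be transported from the start, as in \<open>conn_by_mem\<close>.\<close>

definition conn_by :: "('a \<Rightarrow> 'a \<Rightarrow> bool) \<Rightarrow> 'a set \<Rightarrow> 'a \<Rightarrow> 'a \<Rightarrow> bool" where
  "conn_by R S = (\<lambda>x y. R x y \<and> x \<in> S \<and> y \<in> S)\<^sup>*\<^sup>*"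

lemma nb4_sym: "nb4 p q \<Longrightarrow> nb4 q p"
  by (auto simp: nb4_def)

lemma conn_by_refl [simp]: "conn_by R S x x"
  by (simp add: conn_by_def)

lemma conn_by_trans [trans]: "conn_by R S x y \<Longrightarrow> conn_by R S y z \<Longrightarrow> conn_by R S x z"
  by (simp add: conn_by_def)

lemma conn_by_sym:
  assumes "\<And>x y. R x y \<Longrightarrow> R y x" "conn_by R S x y"
  shows "conn_by R S y x"
  using assms(2) unfolding conn_by_def
proof (induction rule: rtranclp_induct)
  case (step y z)
  then have "(\<lambda>x y. R x y \<and> x \<in> S \<and> y \<in> S) z y" using assms(1) by blast
  then show ?case using step.IH by (rule converse_rtranclp_into_rtranclp)
qed simp

lemma conn_by_step: "conn_by R S x y \<Longrightarrow> R y z \<Longrightarrow> y \<in> S \<Longrightarrow> z \<in> S \<Longrightarrow> conn_by R S x z"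
  unfolding conn_by_def by (rule rtranclp.rtrancl_into_rtrancl) auto

lemma conn_by_mono: "conn_by R S x y \<Longrightarrow> S \<subseteq> T \<Longrightarrow> conn_by R T x y"
  unfolding conn_by_def by (erule rtranclp_mono[THEN predicate2D, rotated]) auto

lemma conn_by_const:
  assumes "conn_by R S x y" "\<And>u v. R u v \<Longrightarrow> u \<in> S \<Longrightarrow> v \<in> S \<Longrightarrow> f u = f v"
  shows "f x = f y"
  using assms(1) unfolding conn_by_def
  by (induction rule: rtranclp_induct) (auto dest: assms(2))

lemma conn_by_mem: "conn_by R S x y \<Longrightarrow> x \<in> S \<Longrightarrow> y \<in> S"
  unfolding conn_by_def by (induction rule: rtranclp_induct) auto

section \<open>Outer boundaries in the square lattice, by cochains modulo two\<close>

text \<open>Increments modulo two are summed up from 0 outwards, by one recursion in each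
  direction.\<close>

lemma xor_primitive_int:
  fixes f :: "int \<Rightarrow> bool"
  shows "\<exists>g. g 0 = a \<and> (\<forall>i. g (i + 1) = (g i \<noteq> f i))"
proof -
  define up where "up = rec_nat a (\<lambda>k b. b \<noteq> f (int k))"
  define dn where "dn = rec_nat a (\<lambda>k b. b \<noteq> f (- int k - 1))"
  define g where "g = (\<lambda>i. if i \<ge> 0 then up (nat i) else dn (nat (- i)))"
  have "g (i + 1) = (g i \<noteq> f i)" for i
  proof (cases "i \<ge> 0")
    case True
    then have "nat (i + 1) = Suc (nat i)" by simp
    then show ?thesis using True by (simp add: g_def up_def)
  next
    case False
    then have e: "nat (- i) = Suc (nat (- i - 1))" by simp
    have "dn (nat (- i)) = (dn (nat (- i - 1)) \<noteq> f i)"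
      unfolding e using False by (simp add: dn_def)
    moreover have "dn 0 = up 0" by (simp add: up_def dn_def)
    ultimately show ?thesis using False
      by (cases "i = -1") (auto simp: g_def)
  qed
  then show ?thesis by (intro exI[of _ g]) (simp add: g_def up_def)
qed

text \<open>Planarity enters here, as the Poincare lemma modulo two. Integrate along the axis and
  then along every column; the face condition carries the horizontal increments from one row to the
  next.\<close>

lemma xor_primitive_grid:
  fixes h v :: "int \<Rightarrow> int \<Rightarrow> bool"
  assumes face: "\<And>i j. (h i j \<noteq> v (i + 1) j) = (v i j \<noteq> h i (j + 1))"
  shows "\<exists>\<psi>. \<forall>i j. \<psi> (i + 1) j = (\<psi> i j \<noteq> h i j) \<and> \<psi> i (j + 1) = (\<psi> i j \<noteq> v i j)"
proof -
  obtain g where g: "\<And>i. g (i + 1) = (g i \<noteq> h i 0)"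
    using xor_primitive_int[of True "\<lambda>i. h i 0"] by auto
  have "\<exists>c. c 0 = g i \<and> (\<forall>j. c (j + 1) = (c j \<noteq> v i j))" for i
    by (rule xor_primitive_int)
  then obtain \<psi> where \<psi>: "\<And>i. \<psi> i 0 = g i" "\<And>i j. \<psi> i (j + 1) = (\<psi> i j \<noteq> v i j)"
    by metis
  have "\<psi> (i + 1) j = (\<psi> i j \<noteq> h i j)" for i j
  proof (induction j rule: int_induct[where k = 0])
    case base
    then show ?case by (simp add: \<psi>(1) g)
  next
    case (step1 j)
    then show ?case using face[of i j] \<psi>(2)[of i j] \<psi>(2)[of "i+1" j] by auto
  next
    case (step2 j)
    then show ?case using face[of i "j-1"] \<psi>(2)[of i "j-1"] \<psi>(2)[of "i+1" "j-1"] by auto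
  qed
  then show ?thesis using \<psi>(2) by blast
qed

lemma nb4_cases:
  assumes "nb4 p q"
  obtains "q = (fst p + 1, snd p)" | "p = (fst q + 1, snd q)"
    | "q = (fst p, snd p + 1)" | "p = (fst q, snd q + 1)"
proof -
  consider "fst p = fst q" "\<bar>snd p - snd q\<bar> = 1" | "snd p = snd q" "\<bar>fst p - fst q\<bar> = 1"
    using assms unfolding nb4_def by linarith
  then show ?thesis
  proof cases
    case 1
    then have "snd q = snd p + 1 \<or> snd p = snd q + 1" by linarith
    then show ?thesis using 1 that(3,4) by (auto simp: prod_eq_iff)
  next
    case 2
    then have "fst q = fst p + 1 \<or> fst p = fst q + 1" by linarith
    then show ?thesis using 2 that(1,2) by (auto simp: prod_eq_iff)
  qed
qed

text \<open>If the boundary split into two parts with no diagonal contact, the indicator of the edges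
  ending in one part would have even sum around every unit square, hence be the coboundary
  of some \<open>\<psi>\<close>. But \<open>\<psi>\<close> is constant on \<open>F\<close> and on \<open>C\<close>, so one edge between them cannot
  change \<open>\<psi>\<close> while another one does not.\<close>

lemma outer_boundary_nb8_connected:
  fixes F C :: "(int \<times> int) set"
  defines "\<Gamma> \<equiv> {y \<in> C. \<exists>x\<in>F. nb4 x y}"
  assumes disj: "F \<inter> C = {}"
    and F: "\<And>x y. x \<in> F \<Longrightarrow> y \<in> F \<Longrightarrow> conn_by nb4 F x y"
    and C: "\<And>x y. x \<in> C \<Longrightarrow> y \<in> C \<Longrightarrow> conn_by nb4 C x y"
    and sep: "\<And>x y. x \<in> C \<Longrightarrow> nb4 x y \<Longrightarrow> y \<notin> C \<Longrightarrow> y \<in> F"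
    and y0: "y0 \<in> \<Gamma>" and y1: "y1 \<in> \<Gamma>"
  shows "conn_by nb8 \<Gamma> y0 y1"
proof (rule ccontr)
  assume n: "\<not> conn_by nb8 \<Gamma> y0 y1"
  define \<Gamma>1 where "\<Gamma>1 = {y \<in> \<Gamma>. conn_by nb8 \<Gamma> y0 y}"
  have closed: "y \<in> \<Gamma>1 \<longleftrightarrow> y' \<in> \<Gamma>1" if "y \<in> \<Gamma>" "y' \<in> \<Gamma>" "nb8 y y'" for y y'
  proof -
    have "nb8 y' y" using that(3) by (auto simp: nb8_def)
    then show ?thesis using that unfolding \<Gamma>1_def by (blast intro: conn_by_step)
  qed
  have bd: "x \<in> \<Gamma>" if "x \<in> C" "y \<notin> C" "nb4 x y" for x y
    using sep[OF that(1,3,2)] that nb4_sym unfolding \<Gamma>_def by blast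
  have sub: "x \<in> \<Gamma>1 \<Longrightarrow> x \<in> C" "x \<in> \<Gamma>1 \<Longrightarrow> x \<in> \<Gamma>" for x by (auto simp: \<Gamma>1_def \<Gamma>_def)
  define \<phi> where "\<phi> p q \<longleftrightarrow> (p \<in> C) \<noteq> (q \<in> C) \<and> (p \<in> \<Gamma>1 \<or> q \<in> \<Gamma>1)" for p q
  have \<phi>_sym: "\<phi> p q = \<phi> q p" for p q by (auto simp: \<phi>_def)
  define h where "h i j = \<phi> (i,j) (i+1,j)" for i j
  define v where "v i j = \<phi> (i,j) (i,j+1)" for i j
  have "(h i j \<noteq> v (i + 1) j) = (v i j \<noteq> h i (j + 1))" for i j
  proof -
    let ?a = "(i,j)" and ?b = "(i+1,j)" and ?c = "(i,j+1)" and ?d = "(i+1,j+1)"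
    have nb: "nb4 ?a ?b" "nb4 ?b ?a" "nb4 ?a ?c" "nb4 ?c ?a" "nb4 ?b ?d" "nb4 ?d ?b" "nb4 ?c ?d" "nb4 ?d ?c"
      by (auto simp: nb4_def)
    note bds = bd[OF _ _ nb(1)] bd[OF _ _ nb(2)] bd[OF _ _ nb(3)] bd[OF _ _ nb(4)]
      bd[OF _ _ nb(5)] bd[OF _ _ nb(6)] bd[OF _ _ nb(7)] bd[OF _ _ nb(8)]
    \<comment> \<open>Any two corners of a unit square are \<open>nb8\<close> neighbours, so the
      boundary cells among them lie all in \<open>\<Gamma>1\<close> or all outside. Around the
      square \<open>\<phi>\<close> is therefore either the coboundary of the indicator of
      \<open>C\<close> or zero.\<close>
    have cl: "?a \<in> \<Gamma> \<Longrightarrow> ?b \<in> \<Gamma> \<Longrightarrow> (?a \<in> \<Gamma>1) = (?b \<in> \<Gamma>1)"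
       "?a \<in> \<Gamma> \<Longrightarrow> ?c \<in> \<Gamma> \<Longrightarrow> (?a \<in> \<Gamma>1) = (?c \<in> \<Gamma>1)"
       "?a \<in> \<Gamma> \<Longrightarrow> ?d \<in> \<Gamma> \<Longrightarrow> (?a \<in> \<Gamma>1) = (?d \<in> \<Gamma>1)"
       "?b \<in> \<Gamma> \<Longrightarrow> ?c \<in> \<Gamma> \<Longrightarrow> (?b \<in> \<Gamma>1) = (?c \<in> \<Gamma>1)"
       "?b \<in> \<Gamma> \<Longrightarrow> ?d \<in> \<Gamma> \<Longrightarrow> (?b \<in> \<Gamma>1) = (?d \<in> \<Gamma>1)"
       "?c \<in> \<Gamma> \<Longrightarrow> ?d \<in> \<Gamma> \<Longrightarrow> (?c \<in> \<Gamma>1) = (?d \<in> \<Gamma>1)"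
      by (rule closed; simp add: nb8_def)+
    show ?thesis unfolding h_def v_def \<phi>_def
      using bds cl sub[of ?a] sub[of ?b] sub[of ?c] sub[of ?d] by argo
  qed
  from xor_primitive_grid[of h v, OF this] obtain \<psi>
    where \<psi>: "\<And>i j. \<psi> (i + 1) j = (\<psi> i j \<noteq> h i j)" "\<And>i j. \<psi> i (j + 1) = (\<psi> i j \<noteq> v i j)"
    by blast
  define f where "f p = \<psi> (fst p) (snd p)" for p
  have f: "f q = (f p \<noteq> \<phi> p q)" if "nb4 p q" for p q
    using that
  proof (cases rule: nb4_cases)
    case 1
    then show ?thesis using \<psi>(1)[of "fst p" "snd p"] by (simp add: f_def h_def)
  next
    case 2
    then show ?thesis using \<psi>(1)[of "fst q" "snd q"] \<phi>_sym[of p q] by (auto simp: f_def h_def)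
  next
    case 3
    then show ?thesis using \<psi>(2)[of "fst p" "snd p"] by (simp add: f_def v_def)
  next
    case 4
    then show ?thesis using \<psi>(2)[of "fst q" "snd q"] \<phi>_sym[of p q] by (auto simp: f_def v_def)
  qed
  obtain x0 where x0: "x0 \<in> F" "nb4 x0 y0" using y0 by (auto simp: \<Gamma>_def)
  obtain x1 where x1: "x1 \<in> F" "nb4 x1 y1" using y1 by (auto simp: \<Gamma>_def)
  have "f x0 = f x1"
    by (rule conn_by_const[OF F[OF x0(1) x1(1)]]) (use f disj \<phi>_def in blast)
  moreover have "f y0 = f y1"
  proof (rule conn_by_const[OF C])
    show "y0 \<in> C" "y1 \<in> C" using y0 y1 by (auto simp: \<Gamma>_def)
  qed (use f \<phi>_def in blast)
  moreover have "\<phi> x0 y0" "\<not> \<phi> x1 y1"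
    using x0 x1 y0 y1 n disj by (auto simp: \<phi>_def \<Gamma>1_def \<Gamma>_def)
  ultimately show False using f[OF x0(2)] f[OF x1(2)] by blast
qed

section \<open>First-passage percolation with costs on open cells\<close>

text \<open>Balls for the passage time in which entering an open cell costs 1, a closed one nothing,
  and the start in \<open>B\<close> is free. Rule \<open>opened\<close> admits closed cells as well,
  so the ball of radius \<open>Suc k\<close> contains every neighbour of the ball of radius
  \<open>k\<close>.\<close>

inductive reach :: "(int \<times> int \<Rightarrow> bool) \<Rightarrow> (int \<times> int) set \<Rightarrow> nat \<Rightarrow> int \<times> int \<Rightarrow> bool"
  for op B where
  base: "x \<in> B \<Longrightarrow> reach op B k x"
| closed: "reach op B k x \<Longrightarrow> nb4 x y \<Longrightarrow> \<not> op y \<Longrightarrow> reach op B k y"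
| opened: "reach op B k x \<Longrightarrow> nb4 x y \<Longrightarrow> reach op B (Suc k) y"

lemma reach_Suc: "reach op B k x \<Longrightarrow> reach op B (Suc k) x"
  by (induction rule: reach.induct) (auto intro: reach.intros)

lemma reach_mono: "reach op B k x \<Longrightarrow> k \<le> k' \<Longrightarrow> reach op B k' x"
  by (rotate_tac 1, induction k' rule: dec_induct) (auto intro: reach_Suc)

lemma reach_conn_base:
  assumes "reach op B k x"
  shows "\<exists>b\<in>B. conn_by nb4 {y. reach op B k y} b x"
  using assms
proof (induction rule: reach.induct)
  case (base x k)
  then show ?case by (auto intro!: bexI[of _ x])
next
  case (closed k x y)
  then obtain b where "b \<in> B" "conn_by nb4 {y. reach op B k y} b x" by blast
  moreover have "reach op B k y" using closed by (blast intro: reach.closed)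
  ultimately show ?case using closed by (blast intro: conn_by_step)
next
  case (opened k x y)
  then obtain b where b: "b \<in> B" "conn_by nb4 {y. reach op B k y} b x" by blast
  have "conn_by nb4 {y. reach op B (Suc k) y} b x"
    by (rule conn_by_mono[OF b(2)]) (auto intro: reach_Suc)
  moreover have "reach op B (Suc k) y" using opened by (blast intro: reach.opened)
  ultimately show ?case using opened reach_Suc b(1) by (blast intro: conn_by_step)
qed

text \<open>The count runs over \<open>tl p\<close> because the start is free. Paths are kept
  distinct, since the probabilistic input concerns self-avoiding paths: when a step returns to the
  path, the path is cut at that cell.\<close>

lemma reach_imp_path:
  assumes "reach op B k x"
  shows "\<exists>p. p \<noteq> [] \<and> distinct p \<and> hd p \<in> B \<and> last p = x \<and> successively nb4 p \<and>
    card {y \<in> set (tl p). op y} \<le> k"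
  using assms
proof (induction rule: reach.induct)
  case (base x k)
  then show ?case by (intro exI[of _ "[x]"]) simp
next
  have ext: "\<exists>q. q \<noteq> [] \<and> distinct q \<and> hd q \<in> B \<and> last q = y \<and> successively nb4 q \<and>
      card {z \<in> set (tl q). op z} \<le> k + (if op y then 1 else 0)"
    if p: "p \<noteq> []" "distinct p" "hd p \<in> B" "last p = x" "successively nb4 p"
      "card {z \<in> set (tl p). op z} \<le> k" and y: "nb4 x y" for p x y k
  proof (cases "y \<in> set p")
    case True
    then obtain p1 p2 where pp: "p = p1 @ y # p2" by (meson split_list)
    let ?q = "p1 @ [y]"
    have "set (tl ?q) \<subseteq> set (tl p)" unfolding pp by (cases p1) auto
    then have "card {z \<in> set (tl ?q). op z} \<le> card {z \<in> set (tl p). op z}"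
      by (intro card_mono) auto
    moreover have "successively nb4 ?q" using p(5) unfolding pp
      by (auto simp: successively_append_iff successively_Cons)
    moreover have "hd ?q \<in> B" using p(3) unfolding pp by (cases p1) auto
    ultimately show ?thesis using p pp by (intro exI[of _ ?q]) auto
  next
    case False
    let ?q = "p @ [y]"
    have "{z \<in> set (tl ?q). op z} \<subseteq> {z \<in> set (tl p). op z} \<union> (if op y then {y} else {})"
      using p(1) by auto
    then have "card {z \<in> set (tl ?q). op z} \<le> card ({z \<in> set (tl p). op z} \<union> (if op y then {y} else {}))"
      by (intro card_mono) auto
    also have "\<dots> \<le> card {z \<in> set (tl p). op z} + card (if op y then {y} else {})"
      by (rule card_Un_le)
    also have "\<dots> \<le> k + (if op y then 1 else 0)" using p(6) by auto
    finally show ?thesis using p False y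
      by (intro exI[of _ ?q]) (auto simp: successively_append_iff)
  qed
  {
    case (closed k x y)
    then show ?case using ext[of _ x k y] by fastforce
  next
    case (opened k x y)
    then obtain p where p: "p \<noteq> []" "distinct p" "hd p \<in> B" "last p = x" "successively nb4 p"
      "card {z \<in> set (tl p). op z} \<le> k" by blast
    have "k + (if op y then 1 else 0) \<le> Suc k" by simp
    then show ?case using ext[OF p opened(2)] le_trans by blast
  }
qed

lemma successively_nthD: "successively P xs \<Longrightarrow> Suc i < length xs \<Longrightarrow> P (xs ! i) (xs ! Suc i)"
  by (induction P xs arbitrary: i rule: successively.induct) (auto simp: nth_Cons split: nat.splits)

lemma path_displacement_aux:
  assumes "successively nb4 p" "i + d < length p"
  shows "\<bar>fst (p ! i) - fst (p ! (i + d))\<bar> \<le> int d \<and> \<bar>snd (p ! i) - snd (p ! (i + d))\<bar> \<le> int d"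
  using assms(2)
proof (induction d)
  case (Suc d)
  have "nb4 (p ! (i + d)) (p ! Suc (i + d))"
    using successively_nthD[OF assms(1)] Suc.prems by simp
  then have "\<bar>fst (p ! (i + d)) - fst (p ! (i + Suc d))\<bar> \<le> 1" "\<bar>snd (p ! (i + d)) - snd (p ! (i + Suc d))\<bar> \<le> 1"
    unfolding nb4_def by auto
  then show ?case using Suc by linarith
qed simp

lemma path_displacement:
  assumes "successively nb4 p" "i < length p" "j < length p"
  shows "\<bar>fst (p ! i) - fst (p ! j)\<bar> \<le> \<bar>int i - int j\<bar> \<and> \<bar>snd (p ! i) - snd (p ! j)\<bar> \<le> \<bar>int i - int j\<bar>"
proof (cases "i \<le> j")
  case True
  then show ?thesis using path_displacement_aux[OF assms(1), of i "j - i"] assms(3) by simp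
next
  case False
  then show ?thesis using path_displacement_aux[OF assms(1), of j "i - j"] assms(2)
    by (simp add: abs_minus_commute)
qed

lemma conn_by_row_aux:
  assumes "i1 \<le> i2" "\<And>i. i1 \<le> i \<Longrightarrow> i \<le> i2 \<Longrightarrow> (i, j) \<in> S"
  shows "conn_by nb4 S (i1, j) (i2, j)"
  using assms
proof (induction i2 rule: int_ge_induct)
  case (step i)
  then have "conn_by nb4 S (i1, j) (i, j)" by auto
  then show ?case by (rule conn_by_step) (use step in \<open>auto simp: nb4_def\<close>)
qed simp

lemma conn_by_row:
  assumes "\<And>i. min i1 i2 \<le> i \<Longrightarrow> i \<le> max i1 i2 \<Longrightarrow> (i, j) \<in> S"
  shows "conn_by nb4 S (i1, j) (i2, j)"
proof (cases "i1 \<le> i2")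
  case True
  then show ?thesis using assms by (intro conn_by_row_aux) auto
next
  case False
  then have "conn_by nb4 S (i2, j) (i1, j)" using assms by (intro conn_by_row_aux) auto
  from conn_by_sym[OF nb4_sym this] show ?thesis .
qed

lemma conn_by_swap:
  assumes "conn_by nb4 (prod.swap ` S) x y"
  shows "conn_by nb4 S (prod.swap x) (prod.swap y)"
  using assms unfolding conn_by_def
proof (induction rule: rtranclp_induct)
  case (step y z)
  then have "nb4 (prod.swap y) (prod.swap z) \<and> prod.swap y \<in> S \<and> prod.swap z \<in> S"
    by (auto simp: nb4_def)
  with step.IH show ?case by (rule rtranclp.rtrancl_into_rtrancl)
qed simp

lemma conn_by_column:
  assumes "\<And>j. min j1 j2 \<le> j \<Longrightarrow> j \<le> max j1 j2 \<Longrightarrow> (i, j) \<in> S"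
  shows "conn_by nb4 S (i, j1) (i, j2)"
proof -
  have "(j, i) \<in> prod.swap ` S" if "min j1 j2 \<le> j" "j \<le> max j1 j2" for j
    using imageI[OF assms[OF that], of prod.swap] by simp
  then have "conn_by nb4 (prod.swap ` S) (j1, i) (j2, i)" by (rule conn_by_row)
  from conn_by_swap[OF this] show ?thesis by simp
qed

lemma int_div_interval:
  fixes x l :: int
  assumes "0 < l"
  shows "c \<le> x div l \<longleftrightarrow> l * c \<le> x" "x div l < c \<longleftrightarrow> x < l * c"
proof -
  show *: "c \<le> x div l \<longleftrightarrow> l * c \<le> x"
  proof
    assume "c \<le> x div l"
    then have "l * c \<le> l * (x div l)" using assms by simp
    also have "\<dots> = x - x mod l" by (rule minus_mod_eq_mult_div[symmetric])
    also have "\<dots> \<le> x" using assms by simp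
    finally show "l * c \<le> x" .
  next
    assume "l * c \<le> x"
    then have "(l * c) div l \<le> x div l" using assms by (rule zdiv_mono1)
    then show "c \<le> x div l" using assms by simp
  qed
  then show "x div l < c \<longleftrightarrow> x < l * c" by linarith
qed

lemma div_eq_iff_bounds:
  fixes x l b :: int
  assumes "0 < l"
  shows "x div l = b \<longleftrightarrow> l * b \<le> x \<and> x < l * (b + 1)"
  using int_div_interval(1)[OF assms, of b x] int_div_interval(2)[OF assms, of x "b + 1"] by linarith

section \<open>Balls around blocks and the circuits that bound them\<close>

definition block :: "int \<Rightarrow> int \<times> int \<Rightarrow> (int \<times> int) set" where
  "block l b = {g. fst g div l = fst b \<and> snd g div l = snd b}"

definition bigblock :: "int \<Rightarrow> int \<times> int \<Rightarrow> (int \<times> int) set" where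
  "bigblock l b = {g. \<bar>fst g div l - fst b\<bar> \<le> 1 \<and> \<bar>snd g div l - snd b\<bar> \<le> 1}"

lemma block_iff:
  assumes "0 < l"
  shows "g \<in> block l b \<longleftrightarrow>
    l * fst b \<le> fst g \<and> fst g < l * fst b + l \<and> l * snd b \<le> snd g \<and> snd g < l * snd b + l"
  unfolding block_def div_eq_iff_bounds[OF assms] by (simp add: distrib_left)

lemma bigblock_iff:
  assumes "0 < l"
  shows "g \<in> bigblock l b \<longleftrightarrow>
    l * fst b - l \<le> fst g \<and> fst g < l * fst b + 2 * l \<and> l * snd b - l \<le> snd g \<and> snd g < l * snd b + 2 * l"
proof -
  have "\<bar>x div l - c\<bar> \<le> 1 \<longleftrightarrow> l * c - l \<le> x \<and> x < l * c + 2 * l" for x c :: int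
  proof -
    have "\<bar>x div l - c\<bar> \<le> 1 \<longleftrightarrow> c - 1 \<le> x div l \<and> x div l < c + 2" by linarith
    also have "\<dots> \<longleftrightarrow> l * (c - 1) \<le> x \<and> x < l * (c + 2)"
      by (simp only: int_div_interval[OF assms])
    also have "l * (c - 1) = l * c - l" by (simp add: right_diff_distrib)
    also have "l * (c + 2) = l * c + 2 * l" by (simp add: distrib_left)
    finally show ?thesis .
  qed
  then show ?thesis unfolding bigblock_def mem_Collect_eq by blast
qed

lemma block_conn:
  assumes "0 < l" "x \<in> block l b" "y \<in> block l b"
  shows "conn_by nb4 (block l b) x y"
proof -
  have "conn_by nb4 (block l b) (fst x, snd x) (fst y, snd x)"
    by (rule conn_by_row) (use assms in \<open>auto simp: block_iff\<close>)
  moreover have "conn_by nb4 (block l b) (fst y, snd x) (fst y, snd y)"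
    by (rule conn_by_column) (use assms in \<open>auto simp: block_iff\<close>)
  ultimately show ?thesis by (metis conn_by_trans prod.collapse)
qed

text \<open>For a cell outside the square, its row or its column misses the square. Follow that
  line, then a line just outside the square, to a fixed corner cell.\<close>

lemma outside_bigblock_conn:
  assumes l: "0 < l" and "x \<notin> bigblock l b" "y \<notin> bigblock l b"
  shows "conn_by nb4 (- bigblock l b) x y"
proof -
  let ?O = "- bigblock l b" and ?a = "l * fst b - l - 1" and ?c = "l * snd b - l - 1"
  have anchor: "conn_by nb4 ?O x (?a, ?c)" if x: "x \<notin> bigblock l b" for x
  proof -
    have down: "conn_by nb4 ?O (i, ?c) (?a, ?c)" for i
      by (rule conn_by_row) (auto simp: bigblock_iff[OF l])
    have left: "conn_by nb4 ?O (?a, j) (?a, ?c)" for j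
      by (rule conn_by_column) (auto simp: bigblock_iff[OF l])
    show ?thesis
    proof (cases "l * fst b - l \<le> fst x \<and> fst x < l * fst b + 2 * l")
      case True
      then have "conn_by nb4 ?O (fst x, snd x) (?a, snd x)"
        by (intro conn_by_row) (use x in \<open>auto simp: bigblock_iff[OF l]\<close>)
      then show ?thesis using left conn_by_trans by (metis prod.collapse)
    next
      case False
      then have "conn_by nb4 ?O (fst x, snd x) (fst x, ?c)"
        by (intro conn_by_column) (use x in \<open>auto simp: bigblock_iff[OF l]\<close>)
      then show ?thesis using down conn_by_trans by (metis prod.collapse)
    qed
  qed
  from conn_by_trans[OF this[OF assms(2)] conn_by_sym[OF nb4_sym this[OF assms(3)]]] show ?thesis .
qed

definition ballset :: "(int \<times> int \<Rightarrow> bool) \<Rightarrow> int \<Rightarrow> int \<times> int \<Rightarrow> nat \<Rightarrow> (int \<times> int) set" where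
  "ballset op l b k = {x. reach op (block l b) k x}"

text \<open>For \<open>k\<close> at most \<open>kap\<close> this is the unbounded component of the
  complement of the ball. Leaving out the holes of the ball is what makes the boundary a single
  circuit.\<close>

definition exterior :: "(int \<times> int \<Rightarrow> bool) \<Rightarrow> int \<Rightarrow> int \<times> int \<Rightarrow> nat \<Rightarrow> (int \<times> int) set" where
  "exterior op l b k = {x. \<exists>z. z \<notin> bigblock l b \<and> conn_by nb4 (- ballset op l b k) z x}"

definition circuit :: "(int \<times> int \<Rightarrow> bool) \<Rightarrow> int \<Rightarrow> int \<times> int \<Rightarrow> nat \<Rightarrow> (int \<times> int) set" where
  "circuit op l b k = {y \<in> exterior op l b k. \<exists>x\<in>ballset op l b k. nb4 x y}"

locale open_paths =
  fixes op :: "int \<times> int \<Rightarrow> bool" and l :: int and kap :: nat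
  assumes l_pos: "0 < l"
    and many_open: "\<And>p. distinct p \<Longrightarrow> successively nb4 p \<Longrightarrow> length p = nat l \<Longrightarrow>
      kap < card {y \<in> set p. op y}"
begin

text \<open>A path from the block to a cell outside the big block makes at least \<open>l\<close>
  steps. The first \<open>l\<close> cells after its start contain more than \<open>kap\<close> open
  ones, which exceeds what the path may pay.\<close>

lemma ballset_bigblock:
  assumes "k \<le> kap"
  shows "ballset op l b k \<subseteq> bigblock l b"
proof (rule subsetI, rule ccontr)
  fix x assume "x \<in> ballset op l b k" and x: "x \<notin> bigblock l b"
  then have "reach op (block l b) kap x" using assms reach_mono by (auto simp: ballset_def)
  then obtain p where p: "p \<noteq> []" "distinct p" "hd p \<in> block l b" "last p = x" "successively nb4 p"
      "card {z \<in> set (tl p). op z} \<le> kap"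
    using reach_imp_path by meson
  have "l \<le> int (length p) - 1"
  proof (rule ccontr)
    assume a: "\<not> ?thesis"
    have len: "length p - 1 < length p" "0 < length p" using p(1) by auto
    have len_l: "\<bar>int (length p - 1) - int 0\<bar> < l" using a len(2) by linarith
    have lst: "p ! (length p - 1) = x" by (rule trans[OF last_conv_nth[OF p(1), symmetric] p(4)])
    have hd: "p ! 0 = hd p" using hd_conv_nth[OF p(1)] by (rule sym)
    have "\<bar>fst x - fst (hd p)\<bar> < l"
      using path_displacement[OF p(5) len] len_l unfolding lst hd by (blast intro: order_le_less_trans)
    moreover have "\<bar>snd x - snd (hd p)\<bar> < l"
      using path_displacement[OF p(5) len] len_l unfolding lst hd by (blast intro: order_le_less_trans)
    ultimately have "x \<in> bigblock l b"
      using p(3) l_pos unfolding block_iff[OF l_pos] bigblock_iff[OF l_pos] by auto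
    then show False using x by simp
  qed
  moreover define q where "q = take (nat l) (tl p)"
  ultimately have "length q = nat l" using l_pos by simp
  moreover have "distinct q" using p(2) by (simp add: q_def distinct_tl)
  moreover have "successively nb4 (tl p)" using p(1,5) by (cases p) (auto simp: successively_Cons)
  then have "successively nb4 q" unfolding q_def
    by (metis append_take_drop_id successively_append_iff)
  ultimately have "kap < card {y \<in> set q. op y}" using many_open by blast
  also have "\<dots> \<le> card {z \<in> set (tl p). op z}"
    by (intro card_mono) (auto simp: q_def dest: in_set_takeD)
  finally show False using p(6) by simp
qed

lemma block_sub_ballset: "block l b \<subseteq> ballset op l b k"
  by (auto simp: ballset_def intro: reach.base)

lemma exterior_ballset_disjoint:
  assumes "k \<le> kap"
  shows "ballset op l b k \<inter> exterior op l b k = {}"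
proof -
  have "x \<notin> ballset op l b k" if x: "x \<in> exterior op l b k" for x
  proof -
    obtain z where z: "z \<notin> bigblock l b" "conn_by nb4 (- ballset op l b k) z x"
      using x unfolding exterior_def by blast
    have "z \<in> - ballset op l b k" using z(1) ballset_bigblock[OF assms, of b] by blast
    from conn_by_mem[OF z(2) this] show ?thesis by simp
  qed
  then show ?thesis by blast
qed

lemma outside_exterior: "x \<notin> bigblock l b \<Longrightarrow> x \<in> exterior op l b k"
  unfolding exterior_def mem_Collect_eq by (rule exI[of _ x]) simp

lemma exterior_step:
  assumes "x \<in> exterior op l b k" "nb4 x y" "y \<notin> exterior op l b k" "k \<le> kap"
  shows "y \<in> ballset op l b k"
proof (rule ccontr)
  assume y: "y \<notin> ballset op l b k"
  have "x \<notin> ballset op l b k" using exterior_ballset_disjoint assms by blast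
  moreover obtain z where "z \<notin> bigblock l b" "conn_by nb4 (- ballset op l b k) z x"
    using assms(1) unfolding exterior_def by blast
  ultimately have "y \<in> exterior op l b k"
    using conn_by_step[of nb4 "- ballset op l b k" z x y] assms(2) y unfolding exterior_def by blast
  then show False using assms by simp
qed

text \<open>Every exterior cell is joined, within the exterior, to a cell outside the big block, and
  these cells are connected among themselves.\<close>

lemma exterior_conn:
  assumes "k \<le> kap" "x \<in> exterior op l b k" "y \<in> exterior op l b k"
  shows "conn_by nb4 (exterior op l b k) x y"
proof -
  let ?E = "exterior op l b k" and ?F = "ballset op l b k"
  have up: "conn_by nb4 ?E z x" if "z \<notin> bigblock l b" "conn_by nb4 (- ?F) z x" for x z
    using that(2) unfolding conn_by_def
  proof (induction rule: rtranclp_induct)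
    case (step u v)
    have "u \<in> ?E" using that(1) step.hyps unfolding exterior_def conn_by_def by blast
    moreover have "v \<in> ?E"
      using that(1) rtranclp.rtrancl_into_rtrancl[OF step.hyps] unfolding exterior_def conn_by_def by blast
    ultimately have "nb4 u v \<and> u \<in> ?E \<and> v \<in> ?E" using step.hyps by blast
    with step.IH show ?case by (rule rtranclp.rtrancl_into_rtrancl)
  qed simp
  obtain z where z: "z \<notin> bigblock l b" "conn_by nb4 (- ?F) z x" using assms by (auto simp: exterior_def)
  obtain w where w: "w \<notin> bigblock l b" "conn_by nb4 (- ?F) w y" using assms by (auto simp: exterior_def)
  have "conn_by nb4 ?E z w"
    by (rule conn_by_mono[OF outside_bigblock_conn[OF l_pos z(1) w(1)]]) (auto intro: outside_exterior)
  from conn_by_trans[OF conn_by_sym[OF nb4_sym up[OF z]] conn_by_trans[OF this up[OF w]]] show ?thesis .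
qed

lemma ballset_conn:
  assumes "x \<in> ballset op l b k" "y \<in> ballset op l b k"
  shows "conn_by nb4 (ballset op l b k) x y"
proof -
  let ?F = "ballset op l b k"
  obtain u where u: "u \<in> block l b" "conn_by nb4 ?F u x"
    using reach_conn_base[of op "block l b" k x] assms unfolding ballset_def mem_Collect_eq by blast
  obtain v where v: "v \<in> block l b" "conn_by nb4 ?F v y"
    using reach_conn_base[of op "block l b" k y] assms unfolding ballset_def mem_Collect_eq by blast
  have "conn_by nb4 ?F u v"
    using block_conn[OF l_pos u(1) v(1)] block_sub_ballset by (rule conn_by_mono)
  from conn_by_trans[OF conn_by_sym[OF nb4_sym u(2)] conn_by_trans[OF this v(2)]] show ?thesis .
qed

lemma circuit_conn:
  assumes "k \<le> kap" "x \<in> circuit op l b k" "y \<in> circuit op l b k"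
  shows "conn_by nb8 (circuit op l b k) x y"
  unfolding circuit_def
proof (rule outer_boundary_nb8_connected)
  show "ballset op l b k \<inter> exterior op l b k = {}" by (rule exterior_ballset_disjoint[OF assms(1)])
  show "x \<in> {y \<in> exterior op l b k. \<exists>x\<in>ballset op l b k. nb4 x y}"
    "y \<in> {y \<in> exterior op l b k. \<exists>x\<in>ballset op l b k. nb4 x y}"
    using assms(2,3) by (simp_all only: circuit_def)
qed (fact ballset_conn exterior_conn[OF assms(1)] exterior_step[OF _ _ _ assms(1)])+

text \<open>A closed neighbour of the ball would be absorbed at no cost.\<close>

lemma circuit_open:
  assumes "k \<le> kap" "y \<in> circuit op l b k"
  shows "op y"
proof (rule ccontr)
  assume "\<not> op y"
  then have "y \<in> ballset op l b k" using assms reach.closed unfolding circuit_def ballset_def by blast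
  then show False using assms exterior_ballset_disjoint[of k b] by (auto simp: circuit_def)
qed

lemma circuit_sub_ballset: "circuit op l b k \<subseteq> ballset op l b (Suc k)"
  by (auto simp: circuit_def ballset_def intro: reach.opened)

lemma circuit_bigblock: "k < kap \<Longrightarrow> circuit op l b k \<subseteq> bigblock l b"
  using circuit_sub_ballset[of b k] ballset_bigblock[of "Suc k" b] by auto

text \<open>The circuit at radius \<open>k\<close> lies in the ball of radius \<open>Suc k\<close>,
  hence in all later balls, whereas every later circuit avoids its own ball.\<close>

lemma circuit_disjoint:
  assumes "k \<le> kap" "k' \<le> kap" "y \<in> circuit op l b k" "y \<in> circuit op l b k'"
  shows "k = k'"
proof -
  have "False" if "k < k'" "k' \<le> kap" "y \<in> circuit op l b k" "y \<in> circuit op l b k'" for k k'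
  proof -
    have "y \<in> ballset op l b k'"
      using circuit_sub_ballset[of b k] that reach_mono[of op "block l b" "Suc k" y k'] by (auto simp: ballset_def)
    then show False using that exterior_ballset_disjoint[of k' b] by (auto simp: circuit_def)
  qed
  then show ?thesis using assms by (metis linorder_neqE_nat)
qed

lemma circuit_step:
  assumes "k \<le> kap" "u \<notin> exterior op l b k" "v \<in> exterior op l b k" "nb4 u v"
  shows "v \<in> circuit op l b k"
  using exterior_step[OF assms(3) nb4_sym[OF assms(4)] assms(2,1)] assms(3,4)
  unfolding circuit_def by blast

text \<open>Of the two steps through the intermediate cell \<open>(fst v, snd u)\<close>, one enters
  the exterior. Each coordinate of the circuit cell comes from \<open>u\<close> or \<open>v\<close>,
  so a point of this cell can be composed from the coordinates of a point in \<open>u\<close> and a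
  point in \<open>v\<close>.\<close>

lemma circuit_diagonal_step:
  assumes "k \<le> kap" "u \<notin> exterior op l b k" "v \<in> exterior op l b k" "nb8 u v"
  shows "\<exists>g\<in>circuit op l b k. fst g \<in> {fst u, fst v} \<and> snd g \<in> {snd u, snd v}"
proof (cases "nb4 u v")
  case True
  then show ?thesis using circuit_step assms by blast
next
  case False
  let ?e = "(fst v, snd u)"
  have "u \<noteq> v" using assms by auto
  then have "nb4 u ?e" "nb4 ?e v" using False assms(4) by (auto simp: nb4_def nb8_def prod_eq_iff)
  then have "?e \<in> circuit op l b k \<or> v \<in> circuit op l b k"
    using circuit_step[OF assms(1,2)] circuit_step[OF assms(1) _ assms(3)] by blast
  then show ?thesis by (metis fst_conv insertCI snd_conv)
qed

text \<open>The first exterior cell of the walk is entered from a cell that is not exterior.\<close>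

lemma circuit_hit_line:
  fixes g :: "nat \<Rightarrow> int \<times> int"
  assumes "k \<le> kap" "\<And>t. nb4 (g t) (g (Suc t))" "g 0 \<in> block l b" "g T \<notin> bigblock l b"
  shows "\<exists>t. t \<le> T \<and> 0 < t \<and> g t \<in> circuit op l b k"
proof -
  define t where "t = (LEAST t. g t \<in> exterior op l b k)"
  have T: "g T \<in> exterior op l b k" using assms outside_exterior by blast
  then have t: "g t \<in> exterior op l b k" unfolding t_def by (rule LeastI)
  have tT: "t \<le> T" unfolding t_def using T by (rule Least_le)
  have "g 0 \<notin> exterior op l b k"
    using assms block_sub_ballset exterior_ballset_disjoint by blast
  then obtain t' where t': "t = Suc t'" using t by (cases t) auto
  then have "g t' \<notin> exterior op l b k" unfolding t_def using not_less_Least by (metis lessI)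
  then have "g t \<in> circuit op l b k" using circuit_step assms t t' by blast
  then show ?thesis using tT t' by auto
qed

end

section \<open>Isoperimetry from circuits around blocks\<close>

lemma cyclic_closed_full:
  fixes M :: int
  assumes "0 < M" "T \<subseteq> {0..<M}" "x \<in> T" "\<And>x. x \<in> T \<Longrightarrow> (x + 1) mod M \<in> T"
  shows "T = {0..<M}"
proof -
  have *: "(x + int k) mod M \<in> T" for k
  proof (induction k)
    case 0
    then show ?case using assms(2,3) by (auto simp: mod_pos_pos_trivial)
  next
    case (Suc k)
    then have "((x + int k) mod M + 1) mod M \<in> T" using assms(4) by blast
    then show ?case by (simp add: mod_simps ac_simps)
  qed
  have "y \<in> T" if y: "y \<in> {0..<M}" for y
  proof -
    have "0 \<le> y - x + M" using y assms(2,3) by auto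
    then have "(x + (y - x + M)) mod M \<in> T" using *[of "nat (y - x + M)"] by simp
    then show ?thesis using y by simp
  qed
  then show ?thesis using assms(2) by blast
qed

abbreviation grid :: "int \<Rightarrow> (int \<times> int) set" where
  "grid M \<equiv> {0..<M} \<times> {0..<M}"

text \<open>Testing the forward neighbours suffices: on a cycle, a nonempty set closed under the
  successor is everything.\<close>

definition inner_bd :: "int \<Rightarrow> (int \<times> int) set \<Rightarrow> (int \<times> int) set" where
  "inner_bd M S = {b \<in> S. ((fst b + 1) mod M, snd b) \<notin> S \<or> (fst b, (snd b + 1) mod M) \<notin> S}"

text \<open>A row or column that meets \<open>S\<close> without meeting the boundary is full. If
  some row is full, every column meets \<open>S\<close>, so the complement lies in the columns of
  boundary cells; it has at least \<open>\<delta> * M * M\<close> cells, hence there are at least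
  \<open>\<delta> * M\<close> such columns. A full column is symmetric. If no line is full,
  \<open>S\<close> lies in the product of the columns and rows of boundary cells, which has at most
  \<open>card (inner_bd M S)\<close> squared elements.\<close>

lemma torus_isoperimetry:
  fixes M :: int
  assumes M: "0 < M" and S: "S \<subseteq> {0..<M} \<times> {0..<M}" and \<delta>: "0 \<le> \<delta>" "\<delta> \<le> 1"
    and cS: "real (card S) \<le> (1 - \<delta>) * (real_of_int M)\<^sup>2"
  shows "\<delta> * sqrt (real (card S)) \<le> real (card (inner_bd M S))"
proof -
  let ?I = "{0..<M}" and ?B = "inner_bd M S"
  define \<beta> where "\<beta> = card ?B"
  have finS: "finite S" using S by (rule finite_subset) auto
  then have finB: "finite ?B" by (rule finite_subset[rotated]) (auto simp: inner_bd_def)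
  have row: "{i. (i, j) \<in> S} = ?I" if "(i, j) \<in> S" "j \<notin> snd ` ?B" for i j
  proof (rule cyclic_closed_full[OF M])
    show "(x + 1) mod M \<in> {i. (i, j) \<in> S}" if "x \<in> {i. (i, j) \<in> S}" for x
      using that \<open>j \<notin> snd ` ?B\<close> unfolding inner_bd_def by force
  qed (use S that in auto)
  have col: "{j. (i, j) \<in> S} = ?I" if "(i, j) \<in> S" "i \<notin> fst ` ?B" for i j
  proof (rule cyclic_closed_full[OF M])
    show "(x + 1) mod M \<in> {j. (i, j) \<in> S}" if "x \<in> {j. (i, j) \<in> S}" for x
      using that \<open>i \<notin> fst ` ?B\<close> unfolding inner_bd_def by force
  qed (use S that in auto)
  have cI: "card (?I \<times> ?I) = (nat M)\<^sup>2" by (simp add: card_cartesian_product power2_eq_square)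
  have "card S \<le> card (?I \<times> ?I)" using S by (intro card_mono) auto
  then have "real (card S) \<le> (real_of_int M)\<^sup>2" 
    using M of_nat_mono[of "card S" "(nat M)\<^sup>2", where 'a = real] unfolding cI by simp
  then have sq: "sqrt (real (card S)) \<le> real_of_int M" using M by (simp add: real_le_lsqrt)
  have full: "\<delta> * sqrt (real (card S)) \<le> real \<beta>"
    if N: "card N \<le> \<beta>" "finite N" "?I \<times> ?I - S \<subseteq> N \<times> ?I \<or> ?I \<times> ?I - S \<subseteq> ?I \<times> N" for N
  proof -
    have "card (?I \<times> ?I - S) \<le> card N * nat M"
      using N(3)
    proof
      assume "?I \<times> ?I - S \<subseteq> N \<times> ?I"
      then have "card (?I \<times> ?I - S) \<le> card (N \<times> ?I)" using N(2) by (intro card_mono) auto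
      then show ?thesis by (simp add: card_cartesian_product)
    next
      assume "?I \<times> ?I - S \<subseteq> ?I \<times> N"
      then have "card (?I \<times> ?I - S) \<le> card (?I \<times> N)" using N(2) by (intro card_mono) auto
      then show ?thesis by (simp add: card_cartesian_product mult.commute)
    qed
    also have "\<dots> \<le> \<beta> * nat M" using N(1) by simp
    finally have "(nat M)\<^sup>2 - card S \<le> \<beta> * nat M"
      using card_Diff_subset[OF finS S] cI by simp
    then have "(nat M)\<^sup>2 \<le> \<beta> * nat M + card S" by linarith
    then have "real ((nat M)\<^sup>2) \<le> real (\<beta> * nat M + card S)" by (rule of_nat_mono)
    then have "(real_of_int M)\<^sup>2 \<le> real \<beta> * real_of_int M + real (card S)" using M by simp
    then have "\<delta> * real_of_int M * real_of_int M \<le> real \<beta> * real_of_int M"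
      using cS by (simp add: power2_eq_square algebra_simps)
    then have "\<delta> * real_of_int M \<le> real \<beta>" using M by simp
    moreover have "\<delta> * sqrt (real (card S)) \<le> \<delta> * real_of_int M" using sq \<delta> by (intro mult_left_mono)
    ultimately show ?thesis by linarith
  qed
  have ci: "card (fst ` ?B) \<le> \<beta>" "card (snd ` ?B) \<le> \<beta>"
    using finB by (auto simp: \<beta>_def card_image_le)
  consider (r) j where "?I \<subseteq> {i. (i, j) \<in> S}" | (c) i where "?I \<subseteq> {j. (i, j) \<in> S}"
    | (n) "\<forall>j. \<not> ?I \<subseteq> {i. (i, j) \<in> S}" "\<forall>i. \<not> ?I \<subseteq> {j. (i, j) \<in> S}" by blast
  then have "\<delta> * sqrt (real (card S)) \<le> real \<beta>"
  proof cases
    case r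
    have "?I \<times> ?I - S \<subseteq> fst ` ?B \<times> ?I" using col r by blast
    then show ?thesis using full[OF ci(1)] finB by blast
  next
    case c
    have "?I \<times> ?I - S \<subseteq> ?I \<times> snd ` ?B" using row c by blast
    then show ?thesis using full[OF ci(2)] finB by blast
  next
    case n
    have "S \<subseteq> fst ` ?B \<times> snd ` ?B" using row col n by (metis SigmaI dual_order.refl prod.collapse subsetI)
    then have "card S \<le> card (fst ` ?B \<times> snd ` ?B)" using finB by (intro card_mono) auto
    also have "\<dots> \<le> \<beta> * \<beta>" unfolding card_cartesian_product by (rule mult_le_mono[OF ci])
    finally have "real (card S) \<le> real (\<beta> * \<beta>)" by (rule of_nat_mono)
    then have "sqrt (real (card S)) \<le> real \<beta>" by (intro real_le_lsqrt) (auto simp: power2_eq_square)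
    moreover have "\<delta> * sqrt (real (card S)) \<le> 1 * sqrt (real (card S))" using \<delta> by (intro mult_right_mono) auto
    ultimately show ?thesis by linarith
  qed
  then show ?thesis by (simp add: \<beta>_def)
qed

section \<open>Finite graphs with disjoint circuits around blocks\<close>

lemma conn_by_rtranclp: "conn_by R S x y \<Longrightarrow> R\<^sup>*\<^sup>* x y"
  unfolding conn_by_def by (erule rtranclp_mono[THEN predicate2D, rotated]) auto

definition near :: "int \<Rightarrow> int \<times> int \<Rightarrow> int \<times> int \<Rightarrow> bool" where
  "near M b c \<longleftrightarrow> (\<exists>d1\<in>{-1,0,1}. \<exists>d2\<in>{-1,0,1}. c = ((fst b + d1) mod M, (snd b + d2) mod M))"

text \<open>Interface between the geometry and the counting, which becomes a statement on finite
  graphs. \<open>M4\<close> keeps blocks at distance two from being neighbours on the torus, and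
  \<open>ell_M\<close> lets terms of order \<open>ell * M\<close> be absorbed into
  \<open>M\<^sup>2\<close>.\<close>

locale circuit_graph =
  fixes V :: "'v set" and E :: "'v \<Rightarrow> 'v \<Rightarrow> bool" and M :: int and blk :: "'v \<Rightarrow> int \<times> int"
    and G :: "int \<times> int \<Rightarrow> nat \<Rightarrow> 'v set" and kap ell :: nat and K :: real
  assumes finV: "finite V" and E_sym: "\<And>x y. E x y \<Longrightarrow> E y x"
    and E_V: "\<And>x y. E x y \<Longrightarrow> x \<in> V \<and> y \<in> V"
    and M4: "4 \<le> M" and kap_pos: "0 < kap" and ell_kap: "ell = 100 * kap" and ell_M: "int ell \<le> M"
    and K1: "1 \<le> K"
    and blk_range: "\<And>v. v \<in> V \<Longrightarrow> blk v \<in> grid M"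
    and circ_V: "\<And>b k. b \<in> grid M \<Longrightarrow> k < kap \<Longrightarrow> G b k \<subseteq> V"
    and circ_disj: "\<And>b k k' v. b \<in> grid M \<Longrightarrow> k < kap \<Longrightarrow> k' < kap \<Longrightarrow>
      v \<in> G b k \<Longrightarrow> v \<in> G b k' \<Longrightarrow> k = k'"
    and circ_near: "\<And>b k v. b \<in> grid M \<Longrightarrow> k < kap \<Longrightarrow> v \<in> G b k \<Longrightarrow> near M b (blk v)"
    and circ_conn: "\<And>b k v w. b \<in> grid M \<Longrightarrow> k < kap \<Longrightarrow> v \<in> G b k \<Longrightarrow> w \<in> G b k \<Longrightarrow>
      conn_by E (G b k) v w"
    and circ_hit: "\<And>b k d. b \<in> grid M \<Longrightarrow> k < kap \<Longrightarrow> d \<in> {-1, 1} \<Longrightarrow>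
      (\<exists>v\<in>G b k. blk v = ((fst b + d) mod M, snd b)) \<and> (\<exists>v\<in>G b k. blk v = (fst b, (snd b + d) mod M))"
    and circ_card: "\<And>b k. b \<in> grid M \<Longrightarrow> k < kap \<Longrightarrow> ell \<le> card (G b k)"
    and touch: "\<And>b k U u w. b \<in> grid M \<Longrightarrow> k < kap \<Longrightarrow> U \<subseteq> V \<Longrightarrow> u \<in> U \<Longrightarrow> w \<in> U \<Longrightarrow>
      conn_by E U u w \<Longrightarrow> blk u = b \<Longrightarrow> \<not> near M b (blk w) \<Longrightarrow>
      \<exists>x\<in>U. \<exists>v\<in>G b k. x = v \<or> E x v"
    and deg_block: "\<And>b. b \<in> grid M \<Longrightarrow>
      (\<Sum>v | v \<in> V \<and> blk v = b. real (card {w. E v w})) \<le> K * (real ell)\<^sup>2"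
begin

abbreviation Blocks :: "(int \<times> int) set" where "Blocks \<equiv> grid M"

definition dg :: "'v \<Rightarrow> real" where "dg v = real (card {w. E v w})"

definition bd :: "'v set \<Rightarrow> 'v set \<Rightarrow> ('v \<times> 'v) set" where
  "bd A L = {(i, j). i \<in> A \<and> j \<in> L - A \<and> E i j}"

lemma finE: "finite {w. E v w}"
  using finV by (rule finite_subset[rotated]) (use E_V in blast)

lemma rtr_sym: "E\<^sup>*\<^sup>* v w \<Longrightarrow> E\<^sup>*\<^sup>* w v"
proof (induction rule: rtranclp_induct)
  case (step y z)
  then show ?case using E_sym converse_rtranclp_into_rtranclp[of E z y v] by blast
qed simp

lemma finite_bd: "finite (bd A L)"
  by (rule finite_subset[OF _ finite_cartesian_product[OF finV finV]]) (auto simp: bd_def dest: E_V)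

lemma card_Blocks: "real (card Blocks) = (real_of_int M)\<^sup>2"
  using M4 by (simp add: card_cartesian_product power2_eq_square)

lemma near_count: "finite {b \<in> Blocks. near M b c}" "card {b \<in> Blocks. near M b c} \<le> 9"
proof -
  let ?D = "{-1,0,1::int}" and ?f = "\<lambda>d. ((fst c - fst d) mod M, (snd c - snd d) mod M)"
  have sub: "{b \<in> Blocks. near M b c} \<subseteq> ?f ` (?D \<times> ?D)"
  proof
    fix b assume "b \<in> {b \<in> Blocks. near M b c}"
    then obtain d1 d2 where d: "d1 \<in> ?D" "d2 \<in> ?D" "c = ((fst b + d1) mod M, (snd b + d2) mod M)"
      and b: "b \<in> Blocks" unfolding near_def by blast
    have "((x + d) mod M - d) mod M = x" if "x \<in> {0..<M}" for x d
      using that by (simp add: mod_diff_left_eq)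
    then have "b = ?f (d1, d2)" using b d(3) by (auto simp: prod_eq_iff)
    then show "b \<in> ?f ` (?D \<times> ?D)" using d by blast
  qed
  have "card (?f ` (?D \<times> ?D)) \<le> card (?D \<times> ?D)" by (rule card_image_le) simp
  also have "\<dots> = 9" by (simp add: card_cartesian_product)
  finally show "card {b \<in> Blocks. near M b c} \<le> 9" using card_mono[OF _ sub] by fastforce
  show "finite {b \<in> Blocks. near M b c}" by (rule finite_subset[of _ Blocks]) auto
qed

text \<open>Otherwise membership in \<open>A\<close> is constant along every edge at the circuit. As
  the circuit is connected, membership would then spread from the contact with \<open>u\<close> to
  the contact with \<open>w\<close>.\<close>

lemma circuit_bd_edge:
  assumes b: "b \<in> Blocks" "k < kap" and A: "A \<subseteq> L"
    and u: "u \<in> A" "v \<in> G b k" "u = v \<or> E u v"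
    and w: "w \<notin> A" "v' \<in> G b k" "w = v' \<or> E w v'"
    and L: "\<And>i j. i \<in> L \<Longrightarrow> E i j \<Longrightarrow> j \<in> L"
  shows "\<exists>e\<in>bd A L. fst e \<in> G b k \<or> snd e \<in> G b k"
proof (rule ccontr)
  assume no: "\<not> ?thesis"
  have edge: "j \<in> A" if "i \<in> A" "E i j" "i \<in> G b k \<or> j \<in> G b k" for i j
  proof (rule ccontr)
    assume "j \<notin> A"
    then have "(i, j) \<in> bd A L" using that A L unfolding bd_def by blast
    then show False using no that by force
  qed
  have "v \<in> A" using u edge by blast
  moreover have "(v \<in> A) = (v' \<in> A)"
    by (rule conn_by_const[OF circ_conn[OF b u(2) w(2)]]) (use edge E_sym in blast)
  ultimately have "v' \<in> A" by simp
  then show False using w edge E_sym by blast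
qed

text \<open>Charge each pair of a block in \<open>D\<close> and a radius to a boundary edge with an
  end on that circuit. The edge, the chosen end and the block determine the radius, because circuits
  around one block are disjoint. Two ends, and at most nine blocks near an end, give 18.\<close>

lemma bad_blocks_count:
  assumes bad: "\<And>b k. b \<in> D \<Longrightarrow> k < kap \<Longrightarrow> \<exists>e\<in>bd A L. fst e \<in> G b k \<or> snd e \<in> G b k"
    and D: "D \<subseteq> Blocks"
  shows "card D * kap \<le> 18 * card (bd A L)"
proof -
  define pt where "pt es = (if snd es then fst (fst es) else snd (fst es))" for es :: "('v \<times> 'v) \<times> bool"
  let ?Z = "SIGMA es : bd A L \<times> (UNIV :: bool set). {b \<in> Blocks. near M b (blk (pt es))}"
  have "\<exists>es \<in> bd A L \<times> UNIV. pt es \<in> G b k" if bk: "b \<in> D" "k < kap" for b k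
  proof -
    obtain e where "e \<in> bd A L" "fst e \<in> G b k \<or> snd e \<in> G b k" using bad[OF bk] by blast
    then show ?thesis
      by (intro bexI[of _ "(e, fst e \<in> G b k)"]) (auto simp: pt_def)
  qed
  then obtain f where f: "\<And>b k. b \<in> D \<Longrightarrow> k < kap \<Longrightarrow> f b k \<in> bd A L \<times> UNIV \<and> pt (f b k) \<in> G b k"
    by metis
  define g where "g p = (f (fst p) (snd p), fst p)" for p
  have "inj_on g (D \<times> {..<kap})"
  proof (rule inj_onI)
    fix p q assume pq: "p \<in> D \<times> {..<kap}" "q \<in> D \<times> {..<kap}" "g p = g q"
    then have e: "fst p = fst q" "f (fst p) (snd p) = f (fst p) (snd q)" by (auto simp: g_def)
    have "pt (f (fst p) (snd p)) \<in> G (fst p) (snd p)" using f pq by auto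
    moreover have "pt (f (fst p) (snd p)) \<in> G (fst p) (snd q)" using f pq e by auto
    ultimately have "snd p = snd q" using circ_disj[of "fst p" "snd p" "snd q"] pq D by auto
    then show "p = q" using e by (simp add: prod_eq_iff)
  qed
  moreover have "g ` (D \<times> {..<kap}) \<subseteq> ?Z"
  proof
    fix z assume "z \<in> g ` (D \<times> {..<kap})"
    then obtain b k where z: "b \<in> D" "k < kap" "z = (f b k, b)" by (auto simp: g_def)
    then show "z \<in> ?Z" using f[OF z(1,2)] circ_near[of b k] D by auto
  qed
  moreover have "finite ?Z" using finite_bd near_count(1) by (intro finite_SigmaI) auto
  ultimately have "card (D \<times> {..<kap}) \<le> card ?Z" by (rule card_inj_on_le)
  also have "\<dots> = (\<Sum>es \<in> bd A L \<times> UNIV. card {b \<in> Blocks. near M b (blk (pt es))})"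
    using finite_bd near_count(1) by (intro card_SigmaI) auto
  also have "\<dots> \<le> (\<Sum>es \<in> bd A L \<times> (UNIV :: bool set). 9)" by (rule sum_mono) (rule near_count)
  also have "\<dots> = 18 * card (bd A L)" by (simp add: card_cartesian_product)
  finally show ?thesis by (simp add: card_cartesian_product)
qed

text \<open>Opposite neighbours of a block are two apart, and none of 1, 2, 3 is divisible by
  \<open>M\<close>, which is at least 4.\<close>

lemma not_near_opposite:
  "\<not> near M ((x + 1) mod M, y) ((x + -1) mod M, z)" "\<not> near M (z, (x + 1) mod M) (z', (x + -1) mod M)"
proof -
  have "(x + -1) mod M \<noteq> ((x + 1) mod M + d) mod M" if "d \<in> {-1,0,1}" for d
  proof
    assume "(x + -1) mod M = ((x + 1) mod M + d) mod M"
    also have "\<dots> = (x + 1 + d) mod M" by (simp add: mod_add_left_eq)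
    finally have "M dvd (x + -1) - (x + 1 + d)" by (rule mod_eq_dvd_iff[THEN iffD1])
    moreover have "(x + -1) - (x + 1 + d) = - (2 + d)" by simp
    ultimately have "M dvd 2 + d" by (metis dvd_minus_iff)
    then have "M \<le> 2 + d" using that by (intro zdvd_imp_le) auto
    then show False using M4 that by auto
  qed
  then show "\<not> near M ((x + 1) mod M, y) ((x + -1) mod M, z)" "\<not> near M (z, (x + 1) mod M) (z', (x + -1) mod M)"
    unfolding near_def by auto
qed

text \<open>The circuit around \<open>b\<close> visits \<open>c\<close> and also the neighbour of
  \<open>b\<close> opposite to \<open>c\<close>, which is not near \<open>c\<close>. Being
  connected, it has to touch every circuit around \<open>c\<close>.\<close>

lemma circuits_connected:
  assumes b: "b \<in> Blocks" and c: "c = ((fst b + 1) mod M, snd b) \<or> c = (fst b, (snd b + 1) mod M)"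
    and k: "k < kap" "k' < kap" and v: "v \<in> G b k" and w: "w \<in> G c k'"
  shows "E\<^sup>*\<^sup>* v w"
proof -
  have cB: "c \<in> Blocks" using b c M4 by auto
  have "\<exists>u\<in>G b k. \<exists>u'\<in>G b k. blk u = c \<and> \<not> near M c (blk u')"
    using c
  proof
    assume c: "c = ((fst b + 1) mod M, snd b)"
    obtain u where u: "u \<in> G b k" "blk u = c" using circ_hit[OF b k(1), of 1] c by blast
    obtain u' where u': "u' \<in> G b k" "blk u' = ((fst b + -1) mod M, snd b)"
      using circ_hit[OF b k(1), of "-1"] by blast
    have "\<not> near M c (blk u')" unfolding c u'(2) by (rule not_near_opposite(1))
    then show ?thesis using u u' by blast
  next
    assume c: "c = (fst b, (snd b + 1) mod M)"
    obtain u where u: "u \<in> G b k" "blk u = c" using circ_hit[OF b k(1), of 1] c by blast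
    obtain u' where u': "u' \<in> G b k" "blk u' = (fst b, (snd b + -1) mod M)"
      using circ_hit[OF b k(1), of "-1"] by blast
    have "\<not> near M c (blk u')" unfolding c u'(2) by (rule not_near_opposite(2))
    then show ?thesis using u u' by blast
  qed
  then obtain u u' where u: "u \<in> G b k" "u' \<in> G b k" "blk u = c" "\<not> near M c (blk u')" by blast
  from touch[OF cB k(2) circ_V[OF b k(1)] u(1,2) circ_conn[OF b k(1) u(1,2)] u(3,4)]
  obtain x v' where x: "x \<in> G b k" "v' \<in> G c k'" "x = v' \<or> E x v'" by blast
  have "E\<^sup>*\<^sup>* v x" using conn_by_rtranclp[OF circ_conn[OF b k(1) v x(1)]] .
  also have "E\<^sup>*\<^sup>* x v'" using x(3) by blast
  also have "E\<^sup>*\<^sup>* v' w" using conn_by_rtranclp[OF circ_conn[OF cB k(2) x(2) w]] .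
  finally show ?thesis .
qed

lemma circ_ex: "b \<in> Blocks \<Longrightarrow> k < kap \<Longrightarrow> \<exists>v. v \<in> G b k"
  using circ_hit[of b k 1] by blast

lemma all_circuits_connected:
  assumes v0: "v0 \<in> G (0, 0) 0" and b: "(i, j) \<in> Blocks" and k: "k < kap" and v: "v \<in> G (i, j) k"
  shows "E\<^sup>*\<^sup>* v0 v"
proof -
  have B: "(int i, int j) \<in> Blocks \<longleftrightarrow> int i < M \<and> int j < M" for i j :: nat by auto
  have same: "E\<^sup>*\<^sup>* v0 v" if h: "\<forall>v\<in>G b 0. E\<^sup>*\<^sup>* v0 v" "b \<in> Blocks" "k < kap" "v \<in> G b k" for b k v
  proof -
    \<comment> \<open>the circuits around one block are nested; each of them meets those of the next block\<close>
    let ?c = "((fst b + 1) mod M, snd b)"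
    have c: "?c \<in> Blocks" using h M4 by auto
    obtain w where w: "w \<in> G ?c 0" using circ_ex[OF c kap_pos] by blast
    obtain u where u: "u \<in> G b 0" using circ_ex[OF h(2) kap_pos] by blast
    have "E\<^sup>*\<^sup>* v0 u" using h u by blast
    also have "E\<^sup>*\<^sup>* u w" by (rule circuits_connected[OF h(2) _ kap_pos kap_pos u w]) simp
    also have "E\<^sup>*\<^sup>* w v"
    proof -
      have "E\<^sup>*\<^sup>* v w" by (rule circuits_connected[OF h(2) _ h(3) kap_pos h(4) w]) simp
      then show ?thesis using rtr_sym by blast
    qed
    finally show ?thesis .
  qed
  have step: "\<forall>v\<in>G c 0. E\<^sup>*\<^sup>* v0 v"
    if h: "\<forall>v\<in>G b 0. E\<^sup>*\<^sup>* v0 v" "b \<in> Blocks" "c = ((fst b + 1) mod M, snd b) \<or> c = (fst b, (snd b + 1) mod M)" for b c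
  proof
    fix v assume v: "v \<in> G c 0"
    obtain u where u: "u \<in> G b 0" using circ_ex[OF h(2) kap_pos] by blast
    have "E\<^sup>*\<^sup>* v0 u" using h u by blast
    also have "E\<^sup>*\<^sup>* u v" by (rule circuits_connected[OF h(2,3) kap_pos kap_pos u v])
    finally show "E\<^sup>*\<^sup>* v0 v" .
  qed
  have row: "\<forall>v\<in>G (int i, 0) 0. E\<^sup>*\<^sup>* v0 v" if "int i < M" for i
    using that
  proof (induction i)
    case 0
    have "(0, 0) \<in> Blocks" using M4 by auto
    then show ?case using conn_by_rtranclp[OF circ_conn[OF _ kap_pos v0]] by simp
  next
    case (Suc i)
    show ?case by (rule step[of "(int i, 0)"]) (use Suc M4 in auto)
  qed
  have all: "\<forall>v\<in>G (int i, int j) 0. E\<^sup>*\<^sup>* v0 v" if "int i < M" "int j < M" for i j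
    using that(2)
  proof (induction j)
    case 0
    then show ?case using row[OF that(1)] by simp
  next
    case (Suc j)
    show ?case by (rule step[of "(int i, int j)"]) (use Suc that in auto)
  qed
  have "\<forall>v\<in>G (i, j) 0. E\<^sup>*\<^sup>* v0 v" using all[of "nat i" "nat j"] b by auto
  then show ?thesis using same[OF _ b k v] by blast
qed

lemma component_V: "v0 \<in> V \<Longrightarrow> {v. E\<^sup>*\<^sup>* v0 v} \<subseteq> V"
proof
  fix v assume "v0 \<in> V" "v \<in> {v. E\<^sup>*\<^sup>* v0 v}"
  then have "E\<^sup>*\<^sup>* v0 v" by simp
  then show "v \<in> V" by (cases rule: rtranclp.cases) (use \<open>v0 \<in> V\<close> E_V in auto)
qed

text \<open>All circuits lie in one component. There are \<open>M\<^sup>2 * kap\<close> pairs of a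
  block and a radius, each with at least \<open>ell\<close> vertices, and a vertex occurs for at
  most nine blocks, once per block. The factor 900 is 9 times the ratio of \<open>ell\<close> to
  \<open>kap\<close>.\<close>

lemma giant_card:
  "\<exists>v0\<in>V. (real_of_int M)\<^sup>2 * (real ell)\<^sup>2 \<le> 900 * real (card {v. E\<^sup>*\<^sup>* v0 v})"
proof -
  have B0: "(0, 0) \<in> Blocks" using M4 by auto
  obtain v0 where v0: "v0 \<in> G (0, 0) 0" using circ_ex[OF B0 kap_pos] by blast
  let ?L = "{v. E\<^sup>*\<^sup>* v0 v}"
  have v0V: "v0 \<in> V" using v0 circ_V[OF B0 kap_pos] by blast
  have finL: "finite ?L" using component_V[OF v0V] finV finite_subset by blast
  let ?Y = "SIGMA p : Blocks \<times> {..<kap}. G (fst p) (snd p)"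
  let ?Z = "SIGMA v : ?L. {b \<in> Blocks. near M b (blk v)}"
  define g where "g y = (snd y, fst (fst y))" for y :: "((int \<times> int) \<times> nat) \<times> 'v"
  have "inj_on g ?Y"
  proof (rule inj_onI)
    fix p q assume pq: "p \<in> ?Y" "q \<in> ?Y" "g p = g q"
    then have e: "snd p = snd q" "fst (fst p) = fst (fst q)" by (auto simp: g_def)
    have "snd (fst p) = snd (fst q)"
      using circ_disj[of "fst (fst p)" "snd (fst p)" "snd (fst q)" "snd p"] pq(1,2) e by auto
    then show "p = q" using e by (simp add: prod_eq_iff)
  qed
  moreover have "g ` ?Y \<subseteq> ?Z"
  proof
    fix z assume "z \<in> g ` ?Y"
    then obtain b k v where z: "b \<in> Blocks" "k < kap" "v \<in> G b k" "z = (v, b)" by (auto simp: g_def)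
    have "E\<^sup>*\<^sup>* v0 v" using all_circuits_connected[OF v0, of "fst b" "snd b"] z by simp
    then show "z \<in> ?Z" using z circ_near[OF z(1,2,3)] by simp
  qed
  moreover have "finite ?Z" using finL near_count(1) by (intro finite_SigmaI) auto
  ultimately have "card ?Y \<le> card ?Z" by (rule card_inj_on_le)
  moreover have "card ?Z = (\<Sum>v\<in>?L. card {b \<in> Blocks. near M b (blk v)})"
    using finL near_count(1) by (intro card_SigmaI) auto
  moreover have "\<dots> \<le> (\<Sum>v\<in>?L. 9)" by (rule sum_mono) (rule near_count)
  moreover have "card ?Y = (\<Sum>p\<in>Blocks \<times> {..<kap}. card (G (fst p) (snd p)))"
    using finite_subset[OF circ_V finV] by (intro card_SigmaI) auto
  moreover have "(\<Sum>p\<in>Blocks \<times> {..<kap}. ell) \<le> (\<Sum>p\<in>Blocks \<times> {..<kap}. card (G (fst p) (snd p)))"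
    by (rule sum_mono) (use circ_card in auto)
  ultimately have "card Blocks * kap * ell \<le> 9 * card ?L" by (simp add: card_cartesian_product)
  then have "real (card Blocks * kap * ell) \<le> real (9 * card ?L)" by (rule of_nat_mono)
  then have "(real_of_int M)\<^sup>2 * real kap * real ell \<le> 9 * real (card ?L)"
    using card_Blocks by simp
  then have "(real_of_int M)\<^sup>2 * (real ell)\<^sup>2 \<le> 900 * real (card ?L)"
    using ell_kap by (simp add: power2_eq_square)
  then show ?thesis using v0V by blast
qed


lemma near_count': "card {c. near M b c} \<le> 9" "finite {c. near M b c}"
proof -
  let ?D = "{-1,0,1::int}" and ?f = "\<lambda>d. ((fst b + fst d) mod M, (snd b + snd d) mod M)"
  have sub: "{c. near M b c} \<subseteq> ?f ` (?D \<times> ?D)"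
  proof
    fix c assume "c \<in> {c. near M b c}"
    then obtain d1 d2 where d: "d1 \<in> ?D" "d2 \<in> ?D" "c = ((fst b + d1) mod M, (snd b + d2) mod M)"
      unfolding near_def by blast
    then have "c = ?f (d1, d2)" by simp
    then show "c \<in> ?f ` (?D \<times> ?D)" using d by blast
  qed
  have fin: "finite (?f ` (?D \<times> ?D))" by simp
  have "card (?f ` (?D \<times> ?D)) \<le> card (?D \<times> ?D)" by (rule card_image_le) simp
  also have "\<dots> = 9" by (simp add: card_cartesian_product)
  finally show "card {c. near M b c} \<le> 9" using card_mono[OF fin sub] by linarith
  show "finite {c. near M b c}" using fin sub by (rule finite_subset[rotated])
qed

lemma dg_nonneg: "0 \<le> dg v" by (simp add: dg_def)

lemma sum_dg_blocks:
  assumes "W \<subseteq> V"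
  shows "(\<Sum>v\<in>W. dg v) \<le> K * (real ell)\<^sup>2 * real (card (blk ` W))"
proof -
  have fW: "finite W" using assms finV finite_subset by blast
  have "(\<Sum>v\<in>W. dg v) = (\<Sum>b\<in>blk ` W. \<Sum>v | v \<in> W \<and> blk v = b. dg v)"
    by (rule sum.image_gen[OF fW])
  also have "\<dots> \<le> (\<Sum>b\<in>blk ` W. K * (real ell)\<^sup>2)"
  proof (rule sum_mono)
    fix b assume "b \<in> blk ` W"
    then have b: "b \<in> Blocks" using blk_range assms by blast
    have "(\<Sum>v | v \<in> W \<and> blk v = b. dg v) \<le> (\<Sum>v | v \<in> V \<and> blk v = b. dg v)"
      by (rule sum_mono2) (use finV assms dg_nonneg in auto)
    then show "(\<Sum>v | v \<in> W \<and> blk v = b. dg v) \<le> K * (real ell)\<^sup>2"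
      using deg_block[OF b] unfolding dg_def by linarith
  qed
  finally show ?thesis by (simp add: mult.commute)
qed

lemma rtranclp_exit:
  assumes "E\<^sup>*\<^sup>* w a" "w \<in> W" "a \<notin> W"
  shows "\<exists>x y. conn_by E W w x \<and> x \<in> W \<and> E x y \<and> y \<notin> W"
proof -
  have "(conn_by E W w a \<and> a \<in> W) \<or> (\<exists>x y. conn_by E W w x \<and> x \<in> W \<and> E x y \<and> y \<notin> W)"
    using assms(1)
  proof (induction rule: rtranclp_induct)
    case base
    then show ?case using assms(2) by simp
  next
    case (step y z)
    then show ?case using conn_by_step[of E W w y z] by blast
  qed
  then show ?thesis using assms(3) by blast
qed

text \<open>A connected graph with more than one vertex has no isolated vertex, so the degree sum is
  at least the number of vertices, and that is at least the size of the component from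
  \<open>giant_card\<close>.\<close>

lemma largest_component_degree:
  assumes v0: "v0 \<in> V" and L: "L = {v. E\<^sup>*\<^sup>* v0 v}"
    and largest: "\<And>v. v \<in> V \<Longrightarrow> card {w. E\<^sup>*\<^sup>* v w} \<le> card L"
  shows "(real_of_int M)\<^sup>2 * (real ell)\<^sup>2 \<le> 900 * (\<Sum>v\<in>L. dg v)"
proof -
  obtain v1 where v1: "v1 \<in> V" "(real_of_int M)\<^sup>2 * (real ell)\<^sup>2 \<le> 900 * real (card {v. E\<^sup>*\<^sup>* v1 v})"
    using giant_card by blast
  then have cL: "(real_of_int M)\<^sup>2 * (real ell)\<^sup>2 \<le> 900 * real (card L)"
    using largest[OF v1(1)] by linarith
  have "(4::real)\<^sup>2 * (100)\<^sup>2 \<le> (real_of_int M)\<^sup>2 * (real ell)\<^sup>2"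
    using M4 kap_pos ell_kap by (intro mult_mono power_mono) auto
  then have two: "1 < card L" using cL by simp
  have finL: "finite L" using component_V[OF v0] finV finite_subset unfolding L by blast
  have "1 \<le> dg v" if "v \<in> L" for v
  proof -
    obtain w where w: "w \<in> L" "w \<noteq> v" using two that by (metis card_1_singleton_iff card_le_Suc0_iff_eq finL leD One_nat_def)
    have "E\<^sup>*\<^sup>* v w" using that w rtr_sym unfolding L by (meson mem_Collect_eq rtranclp_trans)
    then obtain z where "E v z" using w(2) by (metis converse_rtranclpE)
    then have "{w. E v w} \<noteq> {}" by blast
    then have "0 < card {w. E v w}" using finE card_gt_0_iff by blast
    then show ?thesis by (simp add: dg_def)
  qed
  then have "(\<Sum>v\<in>L. 1) \<le> (\<Sum>v\<in>L. dg v)" by (intro sum_mono)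
  then show ?thesis using cL by simp
qed

text \<open>The dichotomy is whether \<open>A\<close> meets almost all blocks. If not, the torus
  inequality applies to the blocks met by \<open>A\<close>. If so, degrees decide: half of the total
  degree lies outside \<open>A\<close>, and a block holds only \<open>K * ell\<^sup>2\<close>, so
  \<open>L - A\<close> has to share many blocks with \<open>A\<close>. The constant 20000000 exceeds
  1800 * 7200, whose factors come from \<open>count\<close> and from
  \<open>\<delta>\<close>.\<close>

theorem isoperimetry:
  assumes v0: "v0 \<in> V" and L: "L = {v. E\<^sup>*\<^sup>* v0 v}"
    and largest: "\<And>v. v \<in> V \<Longrightarrow> card {w. E\<^sup>*\<^sup>* v w} \<le> card L"
    and A: "A \<subseteq> L" and A_conn: "\<And>x y. x \<in> A \<Longrightarrow> y \<in> A \<Longrightarrow> conn_by E A x y"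
    and half: "(\<Sum>v\<in>A. dg v) \<le> (\<Sum>v\<in>L. dg v) / 2"
    and large: "9 * K * (real ell)\<^sup>2 < (\<Sum>v\<in>A. dg v)"
  shows "sqrt (\<Sum>v\<in>A. dg v) / (20000000 * K\<^sup>2) \<le> real (card (bd A L))"
proof (rule ccontr)
  assume contra: "\<not> ?thesis"
  define sA where "sA = (\<Sum>v\<in>A. dg v)"
  define t where "t = real (card (bd A L))"
  define m where "m = real_of_int M"
  define l where "l = real ell"
  define BB where "BB = blk ` A"
  define x where "x = real (card BB)"
  have t: "t < sqrt sA / (20000000 * K\<^sup>2)" using contra unfolding sA_def t_def by simp
  have l_pos: "l > 0" using kap_pos ell_kap by (simp add: l_def)
  have m_pos: "m \<ge> 4" "l \<le> m" using M4 ell_M by (auto simp: m_def l_def)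
  have LV: "L \<subseteq> V" using component_V[OF v0] L by simp
  have AV: "A \<subseteq> V" using A LV by blast
  have Lcl: "j \<in> L" if "i \<in> L" "E i j" for i j using that unfolding L by auto
  have BBB: "BB \<subseteq> Blocks" using AV blk_range unfolding BB_def by blast
  have finBB: "finite BB" using BBB by (rule finite_subset) simp
  \<comment> \<open>Nine blocks hold degree at most \<open>9 * K * l\<^sup>2\<close>, which
    \<open>large\<close> excludes.\<close>
  have escape: "\<exists>w\<in>A. \<not> near M b (blk w)" for b
  proof (rule ccontr)
    assume "\<not> ?thesis"
    then have sub: "blk ` A \<subseteq> {c. near M b c}" by blast
    have "card (blk ` A) \<le> 9" using card_mono[OF near_count'(2) sub] near_count'(1)[of b] by linarith
    then have "K * l\<^sup>2 * real (card (blk ` A)) \<le> K * l\<^sup>2 * 9" using K1 by (intro mult_left_mono) auto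
    then show False using sum_dg_blocks[OF AV] large unfolding l_def by linarith
  qed
  have touchA: "\<exists>x\<in>A. \<exists>v\<in>G b k. x = v \<or> E x v" if bk: "b \<in> BB" "k < kap" for b k
  proof -
    obtain u where u: "u \<in> A" "blk u = b" using bk unfolding BB_def by blast
    obtain w where w: "w \<in> A" "\<not> near M b (blk w)" using escape by blast
    show ?thesis using touch[OF _ bk(2) AV u(1) w(1) A_conn[OF u(1) w(1)] u(2) w(2)] bk BBB by blast
  qed
  have sA_BB: "sA \<le> K * l\<^sup>2 * x" using sum_dg_blocks[OF AV] unfolding sA_def l_def x_def BB_def .
  have x_m: "x \<le> m\<^sup>2"
  proof -
    have "card BB \<le> card Blocks" using BBB by (intro card_mono) auto
    then have "real (card BB) \<le> real (card Blocks)" by (rule of_nat_mono)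
    then show ?thesis unfolding card_Blocks x_def m_def .
  qed
  have sqrtK: "sqrt K \<le> K" using K1 by (simp add: real_le_lsqrt power2_eq_square)
  have sqrt_sA: "sqrt sA \<le> K * l * sqrt x"
  proof -
    have "sqrt sA \<le> sqrt (K * l\<^sup>2 * x)" using sA_BB by simp
    also have "\<dots> = sqrt K * l * sqrt x" using l_pos by (simp add: real_sqrt_mult)
    also have "\<dots> \<le> K * l * sqrt x" using sqrtK l_pos by (intro mult_right_mono) (auto simp: x_def)
    finally show ?thesis .
  qed
  \<comment> \<open>Half of the degree of \<open>L\<close> is at least
    \<open>m\<^sup>2 * l\<^sup>2 / 1800\<close>. Removing the small components of
    \<open>L - A\<close> leaves half of that, which fills at least
    \<open>m\<^sup>2 / (3600 * K)\<close> blocks. This is twice the share of blocks that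
    \<open>A\<close> misses in the second case.\<close>
  define \<delta> where "\<delta> = 1 / (7200 * K)"
  have \<delta>: "0 \<le> \<delta>" "\<delta> \<le> 1" using K1 by (auto simp: \<delta>_def field_simps)
  have count: "real (card D) * l \<le> 1800 * t"
    if D: "D \<subseteq> Blocks" "\<And>b k. b \<in> D \<Longrightarrow> k < kap \<Longrightarrow> \<exists>e\<in>bd A L. fst e \<in> G b k \<or> snd e \<in> G b k" for D
  proof -
    have "real (card D * kap) \<le> real (18 * card (bd A L))"
      using bad_blocks_count[OF D(2) D(1)] by (rule of_nat_mono)
    then show ?thesis unfolding l_def t_def ell_kap by (simp add: mult_ac)
  qed
  show False
  proof (cases "x \<le> (1 - \<delta>) * m\<^sup>2")
    case True
    have "\<delta> * sqrt x \<le> real (card (inner_bd M BB))"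
      unfolding x_def by (rule torus_isoperimetry[OF _ BBB \<delta>]) (use M4 True in \<open>auto simp: x_def m_def\<close>)
    moreover have "real (card (inner_bd M BB)) * l \<le> 1800 * t"
    proof (rule count)
      show "inner_bd M BB \<subseteq> Blocks" using BBB unfolding inner_bd_def by blast
      fix b k assume b: "b \<in> inner_bd M BB" and k: "k < kap"
      then have bBB: "b \<in> BB" unfolding inner_bd_def by blast
      then have bB: "b \<in> Blocks" using BBB by blast
      obtain v where v: "v \<in> G b k" "blk v \<notin> BB"
        using circ_hit[OF bB k, of 1] b unfolding inner_bd_def by auto
      have vA: "v \<notin> A" using v(2) unfolding BB_def by blast
      obtain y v' where yv: "y \<in> A" "v' \<in> G b k" "y = v' \<or> E y v'" using touchA[OF bBB k] by blast
      show "\<exists>e\<in>bd A L. fst e \<in> G b k \<or> snd e \<in> G b k"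
        by (rule circuit_bd_edge[OF bB k A yv vA v(1) disjI1[OF refl]]) (erule (1) Lcl)
    qed
    ultimately have "\<delta> * sqrt x * l \<le> 1800 * t" using l_pos by (meson mult_right_mono less_imp_le order_trans)
    then have "sqrt x * l \<le> 1800 * t * (7200 * K)" using K1 by (simp add: \<delta>_def field_simps)
    then have "K * (sqrt x * l) \<le> K * (1800 * t * (7200 * K))" using K1 by (intro mult_left_mono) auto
    then have "sqrt sA \<le> 12960000 * t * K\<^sup>2" using sqrt_sA by (simp add: power2_eq_square mult_ac)
    moreover have "t * (20000000 * K\<^sup>2) < sqrt sA" using t K1 by (simp add: pos_less_divide_eq)
    moreover have "0 \<le> t * K\<^sup>2" unfolding t_def by simp
    ultimately show False by (simp add: mult_ac)
  next
    case False
    define W where "W = L - A"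
    have WV: "W \<subseteq> V" using LV W_def by blast
    have finW: "finite W" using WV finV finite_subset by blast
    \<comment> \<open>The components of \<open>W\<close> through these vertices stay near the block
      of the vertex and may avoid its circuits. As \<open>L\<close> is connected, each is joined to
      \<open>A\<close> by an edge with an end near that block, so such vertices occupy at most nine
      blocks per boundary edge.\<close>
    define Ws where "Ws = {w \<in> W. \<forall>y. conn_by E W w y \<longrightarrow> near M (blk w) (blk y)}"
    define Wl where "Wl = W - Ws"
    obtain a0 where a0: "a0 \<in> A" using escape by blast
    have "blk ` Ws \<subseteq> (\<Union>e\<in>bd A L. {b \<in> Blocks. near M b (blk (snd e))})"
    proof
      fix b assume "b \<in> blk ` Ws"
      then obtain w where w: "w \<in> Ws" "b = blk w" by blast
      then have wW: "w \<in> W" by (simp add: Ws_def)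
      have "E\<^sup>*\<^sup>* w v0" "E\<^sup>*\<^sup>* v0 a0" using wW a0 A rtr_sym unfolding W_def L by auto
      then have "E\<^sup>*\<^sup>* w a0" by simp
      then obtain y z where yz: "conn_by E W w y" "y \<in> W" "E y z" "z \<notin> W"
        using rtranclp_exit[OF _ wW] a0 unfolding W_def by blast
      have "z \<in> A" using yz Lcl unfolding W_def by blast
      then have "(z, y) \<in> bd A L" using yz E_sym unfolding bd_def W_def by blast
      moreover have "near M b (blk y)" using w yz(1) unfolding Ws_def by blast
      moreover have "b \<in> Blocks" using w wW WV blk_range by blast
      ultimately show "b \<in> (\<Union>e\<in>bd A L. {b \<in> Blocks. near M b (blk (snd e))})" by force
    qed
    then have "card (blk ` Ws) \<le> card (\<Union>e\<in>bd A L. {b \<in> Blocks. near M b (blk (snd e))})"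
      using finite_bd near_count(1) by (intro card_mono) auto
    also have "\<dots> \<le> (\<Sum>e\<in>bd A L. card {b \<in> Blocks. near M b (blk (snd e))})"
      by (rule card_UN_le[OF finite_bd])
    also have "\<dots> \<le> (\<Sum>e\<in>bd A L. 9)" by (rule sum_mono) (rule near_count)
    finally have "real (card (blk ` Ws)) \<le> 9 * t" unfolding t_def by simp
    then have "K * l\<^sup>2 * real (card (blk ` Ws)) \<le> K * l\<^sup>2 * (9 * t)" using K1 by (intro mult_left_mono) auto
    moreover have "(\<Sum>v\<in>Ws. dg v) \<le> K * l\<^sup>2 * real (card (blk ` Ws))"
      unfolding l_def by (rule sum_dg_blocks) (use WV Ws_def in blast)
    ultimately have Ws: "(\<Sum>v\<in>Ws. dg v) \<le> 9 * (K * t) * l\<^sup>2" by (simp add: mult_ac)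
    have sqrt_x: "sqrt x \<le> m" using x_m m_pos by (simp add: real_le_lsqrt)
    \<comment> \<open>The assumed smallness of \<open>t\<close> already makes the degree of
      \<open>Ws\<close> negligible, because \<open>sqrt x\<close> is at most \<open>m\<close> and
      \<open>l\<close> is at most \<open>m\<close>.\<close>
    have "K * (t * (20000000 * K)) = t * (20000000 * K\<^sup>2)" by (simp add: power2_eq_square)
    also have "\<dots> < sqrt sA" using t K1 by (simp add: pos_less_divide_eq)
    also have "\<dots> \<le> K * l * sqrt x" by (rule sqrt_sA)
    also have "\<dots> \<le> K * l * m" using sqrt_x K1 l_pos by (intro mult_left_mono) auto
    finally have "K * (t * (20000000 * K)) < K * (l * m)" by simp
    then have tlm: "20000000 * (K * t) < l * m" using K1 by (simp add: mult_ac)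
    moreover have "l * m \<le> m * m" using m_pos by (intro mult_right_mono) auto
    moreover have "0 \<le> m * m" by simp
    ultimately have "9 * (K * t) \<le> m\<^sup>2 / 3600" unfolding power2_eq_square by linarith
    then have "9 * (K * t) * l\<^sup>2 \<le> m\<^sup>2 / 3600 * l\<^sup>2" by (intro mult_right_mono) auto
    with Ws have Ws2: "(\<Sum>v\<in>Ws. dg v) \<le> m\<^sup>2 * l\<^sup>2 / 3600" by simp
    have "(\<Sum>v\<in>L. dg v) = (\<Sum>v\<in>A. dg v) + (\<Sum>v\<in>W. dg v)"
      unfolding W_def using sum.subset_diff[OF A] LV finV finite_subset by (metis add.commute)
    moreover have "(\<Sum>v\<in>W. dg v) = (\<Sum>v\<in>Wl. dg v) + (\<Sum>v\<in>Ws. dg v)"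
      unfolding Wl_def by (rule sum.subset_diff) (use finW in \<open>auto simp: Ws_def\<close>)
    moreover have "m\<^sup>2 * l\<^sup>2 \<le> 900 * (\<Sum>v\<in>L. dg v)"
      unfolding m_def l_def using largest_component_degree[OF v0 L largest] .
    ultimately have "m\<^sup>2 * l\<^sup>2 / 3600 \<le> (\<Sum>v\<in>Wl. dg v)" using half Ws2 by linarith
    also have "\<dots> \<le> K * l\<^sup>2 * real (card (blk ` Wl))"
      unfolding l_def by (rule sum_dg_blocks) (use WV Wl_def in blast)
    finally have "l\<^sup>2 * (m\<^sup>2 / 3600) \<le> l\<^sup>2 * (K * real (card (blk ` Wl)))" by (simp add: mult_ac)
    then have "m\<^sup>2 / 3600 \<le> K * real (card (blk ` Wl))" using l_pos by simp
    then have cWl: "2 * \<delta> * m\<^sup>2 \<le> real (card (blk ` Wl))" using K1 by (simp add: \<delta>_def field_simps)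
    define D where "D = BB \<inter> blk ` Wl"
    have WlB: "blk ` Wl \<subseteq> Blocks" using blk_range WV unfolding Wl_def by blast
    have finWl: "finite (blk ` Wl)" using finW by (simp add: Wl_def)
    have "card (BB \<union> blk ` Wl) \<le> card Blocks" using BBB WlB by (intro card_mono) auto
    then have "real (card (BB \<union> blk ` Wl)) \<le> m\<^sup>2" using card_Blocks m_def by (metis of_nat_mono)
    moreover have "real (card BB) + real (card (blk ` Wl)) = real (card (BB \<union> blk ` Wl)) + real (card D)"
      unfolding D_def using card_Un_Int[OF finBB finWl] by (metis of_nat_add)
    moreover have "(1 - \<delta>) * m\<^sup>2 = m\<^sup>2 - \<delta> * m\<^sup>2" by (simp add: algebra_simps)
    ultimately have cD: "\<delta> * m\<^sup>2 \<le> real (card D)" using cWl False unfolding x_def by linarith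
    have "real (card D) * l \<le> 1800 * t"
    proof (rule count)
      show "D \<subseteq> Blocks" using BBB D_def by blast
      fix b k assume b: "b \<in> D" and k: "k < kap"
      have bB: "b \<in> Blocks" using b BBB D_def by blast
      obtain w where w: "w \<in> Wl" "b = blk w" using b D_def by blast
      then obtain y where y: "conn_by E W w y" "\<not> near M b (blk y)" unfolding Wl_def Ws_def by blast
      have wW: "w \<in> W" using w Wl_def by blast
      have yW: "y \<in> W" using conn_by_mem[OF y(1) wW] .
      obtain z v where zv: "z \<in> W" "v \<in> G b k" "z = v \<or> E z v"
        using touch[OF bB k WV wW yW y(1) w(2)[symmetric] y(2)] by blast
      have zA: "z \<notin> A" using zv W_def by blast
      obtain u v' where uv: "u \<in> A" "v' \<in> G b k" "u = v' \<or> E u v'" using touchA[of b k] b k D_def by blast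
      show "\<exists>e\<in>bd A L. fst e \<in> G b k \<or> snd e \<in> G b k"
        by (rule circuit_bd_edge[OF bB k A uv zA zv(2,3)]) (erule (1) Lcl)
    qed
    moreover have "\<delta> * m\<^sup>2 * l \<le> real (card D) * l" using cD l_pos by (intro mult_right_mono) auto
    ultimately have "\<delta> * m\<^sup>2 * l \<le> 1800 * t" by linarith
    then have "m\<^sup>2 * l \<le> 12960000 * (K * t)" using K1 by (simp add: \<delta>_def field_simps)
    moreover have "l * m \<le> m\<^sup>2 * l" using m_pos l_pos by (simp add: power2_eq_square)
    moreover have "0 \<le> K * t" using K1 by (simp add: t_def)
    ultimately show False using tlm by linarith
  qed
qed

end

section \<open>Points on the torus\<close>

definition cell :: "real \<times> real \<Rightarrow> int \<times> int" where
  "cell p = (\<lfloor>fst p\<rfloor>, \<lfloor>snd p\<rfloor>)"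

text \<open>Lifts to the universal cover. The occupied cells become a periodic set in the plane,
  where the planar theory of circuits applies.\<close>

definition is_lift :: "int \<Rightarrow> real \<times> real \<Rightarrow> real \<times> real \<Rightarrow> bool" where
  "is_lift m x p \<longleftrightarrow> (\<exists>z1 z2. p = (fst x + of_int (m * z1), snd x + of_int (m * z2)))"

definition in_cell :: "int \<Rightarrow> real \<times> real \<Rightarrow> int \<times> int \<Rightarrow> bool" where
  "in_cell m x g \<longleftrightarrow> (\<exists>p. is_lift m x p \<and> cell p = g)"

definition occupied :: "nat \<Rightarrow> (nat \<Rightarrow> real \<times> real) \<Rightarrow> int \<Rightarrow> int \<times> int \<Rightarrow> bool" where
  "occupied N P m g \<longleftrightarrow> (\<exists>i<N. in_cell m (P i) g)"

definition cell_count :: "nat \<Rightarrow> (nat \<Rightarrow> real \<times> real) \<Rightarrow> int \<Rightarrow> int \<times> int \<Rightarrow> nat" where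
  "cell_count N P m g = card {i. i < N \<and> in_cell m (P i) g}"

text \<open>Unlike a \<open>block\<close>, a window has arbitrary position: summing over neighbours
  of the points of a block shifts it by up to three cells.\<close>

definition window :: "int \<Rightarrow> int \<times> int \<Rightarrow> (int \<times> int) set" where
  "window l w = {fst w..<fst w + l} \<times> {snd w..<snd w + l}"

lemma in_cell_iff:
  "in_cell m x g \<longleftrightarrow> (\<exists>z1 z2. g = (\<lfloor>fst x\<rfloor> + m * z1, \<lfloor>snd x\<rfloor> + m * z2))"
proof -
  have "cell (fst x + of_int (m * z1), snd x + of_int (m * z2)) = (\<lfloor>fst x\<rfloor> + m * z1, \<lfloor>snd x\<rfloor> + m * z2)" for z1 z2
    unfolding cell_def by (simp only: fst_conv snd_conv floor_add_int)
  then show ?thesis unfolding in_cell_def is_lift_def by metis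
qed

lemma in_cell_diff:
  assumes "in_cell m x g" "in_cell m x h"
  shows "m dvd fst g - fst h" "m dvd snd g - snd h"
proof -
  obtain a b where g: "g = (\<lfloor>fst x\<rfloor> + m * a, \<lfloor>snd x\<rfloor> + m * b)" using assms(1) in_cell_iff by blast
  obtain c d where h: "h = (\<lfloor>fst x\<rfloor> + m * c, \<lfloor>snd x\<rfloor> + m * d)" using assms(2) in_cell_iff by blast
  have "fst g - fst h = m * (a - c)" "snd g - snd h = m * (b - d)"
    unfolding g h by (simp_all add: right_diff_distrib)
  then show "m dvd fst g - fst h" "m dvd snd g - snd h" by simp_all
qed

lemma dvd_diff_small:
  fixes m x y :: int
  assumes "m dvd x - y" "\<bar>x - y\<bar> < m"
  shows "x = y"
  using assms zdvd_imp_le[of m "\<bar>x - y\<bar>"] by fastforce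

lemma norm_pair_mono:
  fixes x y :: "real \<times> real"
  assumes "\<bar>fst x\<bar> \<le> \<bar>fst y\<bar>" "\<bar>snd x\<bar> \<le> \<bar>snd y\<bar>"
  shows "norm x \<le> norm y"
  unfolding norm_prod_def real_norm_def
  by (intro real_sqrt_le_mono add_mono power_mono assms) auto

lemma abs_coord_le_norm:
  fixes x :: "real \<times> real"
  shows "\<bar>fst x\<bar> \<le> norm x" "\<bar>snd x\<bar> \<le> norm x"
  using norm_fst_le[of "fst x" "snd x"] norm_snd_le[of "snd x" "fst x"] by simp_all

lemma norm_pair_le:
  fixes x :: "real \<times> real"
  assumes "\<bar>fst x\<bar> \<le> a" "\<bar>snd x\<bar> \<le> a"
  shows "norm x \<le> sqrt 2 * a"
proof -
  have "norm x \<le> norm (a, a)" by (rule norm_pair_mono) (use assms in auto)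
  also have "\<dots> = sqrt 2 * a" using assms by (simp add: norm_Pair real_sqrt_mult)
  finally show ?thesis .
qed

lemma bigblock_near:
  assumes "g \<in> bigblock l b" "c = (fst g div l mod M, snd g div l mod M)"
  shows "near M b c"
proof -
  define d1 where "d1 = fst g div l - fst b"
  define d2 where "d2 = snd g div l - snd b"
  have "\<bar>d1\<bar> \<le> 1" "\<bar>d2\<bar> \<le> 1" using assms(1) unfolding bigblock_def d1_def d2_def by auto
  then have "d1 \<in> {-1,0,1}" "d2 \<in> {-1,0,1}" by auto
  moreover have "c = ((fst b + d1) mod M, (snd b + d2) mod M)"
    using assms(2) unfolding d1_def d2_def by simp
  ultimately show ?thesis unfolding near_def by blast
qed

section \<open>Circuits in the graph of a point set on the torus\<close>

text \<open>Lengths are scaled so that cells have side 1 and \<open>R\<close> is the longest edge.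
  The lower bound on \<open>R\<close> is the diagonal of a two by two square of cells; the upper one
  limits an edge to three cells in each direction. The random input consists of
  \<open>many_occupied\<close> and \<open>window_bound\<close>, the latter standing in for a bound
  on single degrees.\<close>

locale torus_points =
  fixes N :: nat and P :: "nat \<Rightarrow> real \<times> real" and R :: real and kap ell :: nat and M :: int and K0 :: real
  assumes R_ge: "2 * sqrt 2 \<le> R" and R_le: "R \<le> 3"
    and kap_pos: "0 < kap" and ell_kap: "ell = 100 * kap" and ell_M: "int ell \<le> M" and K0: "1 \<le> K0"
    and many_occupied: "\<And>p. distinct p \<Longrightarrow> successively nb4 p \<Longrightarrow> length p = ell \<Longrightarrow>
      kap < card {g \<in> set p. occupied N P (int ell * M) g}"
    and window_bound: "\<And>w. (\<Sum>g\<in>window (int ell) w. (real (cell_count N P (int ell * M) g))\<^sup>2) \<le> K0 * (real ell)\<^sup>2"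
begin

abbreviation m :: int where "m \<equiv> int ell * M"
abbreviation l :: int where "l \<equiv> int ell"
abbreviation op :: "int \<times> int \<Rightarrow> bool" where "op \<equiv> occupied N P m"

definition E :: "nat \<Rightarrow> nat \<Rightarrow> bool" where
  "E i j \<longleftrightarrow> i < N \<and> j < N \<and> i \<noteq> j \<and> (\<exists>p q. is_lift m (P i) p \<and> is_lift m (P j) q \<and> norm (p - q) \<le> R)"

definition blk :: "nat \<Rightarrow> int \<times> int" where
  "blk i = (\<lfloor>fst (P i)\<rfloor> div l mod M, \<lfloor>snd (P i)\<rfloor> div l mod M)"

definition G :: "int \<times> int \<Rightarrow> nat \<Rightarrow> nat set" where
  "G b k = {v. v < N \<and> (\<exists>g\<in>circuit op l b k. in_cell m (P v) g)}"

lemma l_pos: "0 < l" using kap_pos ell_kap by simp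

lemma M_ge: "4 \<le> M" using kap_pos ell_kap ell_M by simp

lemma m_ge: "3 * l < m"
proof -
  have "l * 4 \<le> l * M" using M_ge l_pos by (intro mult_left_mono) auto
  then show ?thesis using l_pos by linarith
qed

sublocale open_paths op l kap
  by unfold_locales (use l_pos many_occupied in auto)

lemma E_lift:
  assumes "E i j" "is_lift m (P i) p"
  shows "\<exists>q. is_lift m (P j) q \<and> norm (p - q) \<le> R"
proof -
  obtain p0 q0 where h: "is_lift m (P i) p0" "is_lift m (P j) q0" "norm (p0 - q0) \<le> R"
    using assms(1) E_def by blast
  obtain a b where p0: "p0 = (fst (P i) + of_int (m * a), snd (P i) + of_int (m * b))"
    using h(1) is_lift_def by blast
  obtain c d where p: "p = (fst (P i) + of_int (m * c), snd (P i) + of_int (m * d))"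
    using assms(2) is_lift_def by blast
  obtain e f where q0: "q0 = (fst (P j) + of_int (m * e), snd (P j) + of_int (m * f))"
    using h(2) is_lift_def by blast
  let ?q = "(fst (P j) + of_int (m * (e + c - a)), snd (P j) + of_int (m * (f + d - b)))"
  have "p - ?q = p0 - q0" unfolding p p0 q0 by (simp add: algebra_simps)
  moreover have "is_lift m (P j) ?q" unfolding is_lift_def by blast
  ultimately show ?thesis using h(3) by metis
qed

lemma E_sym: "E i j \<Longrightarrow> E j i"
  unfolding E_def by (metis norm_minus_commute)

lemma in_cell_blk:
  assumes "in_cell m (P i) g"
  shows "blk i = (fst g div l mod M, snd g div l mod M)"
proof -
  obtain a b where g: "g = (\<lfloor>fst (P i)\<rfloor> + m * a, \<lfloor>snd (P i)\<rfloor> + m * b)"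
    using assms in_cell_iff by blast
  have "(x + m * z) div l mod M = x div l mod M" for x z
  proof -
    have "(x + m * z) div l = (x + l * (M * z)) div l" by (simp add: mult.assoc)
    also have "\<dots> = M * z + x div l" using l_pos by simp
    finally show ?thesis by simp
  qed
  then show ?thesis unfolding g blk_def by simp
qed

lemma nb8_adjacent:
  assumes "in_cell m (P v) g" "in_cell m (P w) h" "nb8 g h" "v < N" "w < N" "v \<noteq> w"
  shows "E v w"
proof -
  obtain p q where p: "is_lift m (P v) p" "cell p = g" and q: "is_lift m (P w) q" "cell q = h"
    using assms in_cell_def by blast
  have fl: "\<bar>x - y\<bar> \<le> 2" if "\<bar>\<lfloor>x\<rfloor> - \<lfloor>y\<rfloor>\<bar> \<le> 1" for x y :: real
    using that by linarith
  have "\<bar>fst (p - q)\<bar> \<le> 2" "\<bar>snd (p - q)\<bar> \<le> 2"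
    using assms(3) p(2) q(2) unfolding nb8_def cell_def by (auto intro!: fl)
  then have "norm (p - q) \<le> sqrt 2 * 2" by (rule norm_pair_le)
  then have "norm (p - q) \<le> R" using R_ge by linarith
  then show ?thesis unfolding E_def using assms p q by blast
qed

lemma circuit_vertex:
  assumes "k \<le> kap" "g \<in> circuit op l b k"
  shows "\<exists>v\<in>G b k. in_cell m (P v) g"
  using circuit_open[OF assms] assms(2) unfolding G_def occupied_def by blast

text \<open>An edge may jump over the circuit. The segment between its ends enters the exterior at a
  circuit cell or diagonally past one, at a place within half the edge length of one of the ends. A
  cell diagonal plus half an edge is at most \<open>R\<close> as soon as
  \<open>R \<ge> 2 * sqrt 2\<close>, so that end is a vertex of the circuit cell or adjacent to
  one.\<close>

lemma edge_meets_circuit: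
  assumes k: "k \<le> kap" and p: "is_lift m (P i) p" and q: "is_lift m (P j) q" and ij: "i < N" "j < N"
    and pq: "norm (p - q) \<le> R" and cp: "cell p \<notin> exterior op l b k" and cq: "cell q \<in> exterior op l b k"
  shows "\<exists>v\<in>G b k. \<exists>x\<in>{i, j}. x = v \<or> E x v"
proof -
  \<comment> \<open>With 20 pieces a step moves each coordinate by at most 3/20, less than a cell,
    so consecutive cells coincide or share a side or corner. As 20 is even, the midpoint is a
    sample, and two consecutive samples lie on the same half of the edge.\<close>
  define pt where "pt t = (fst p + real t / 20 * (fst q - fst p), snd p + real t / 20 * (snd q - snd p))" for t :: nat
  have "pt 20 = q" "pt 0 = p" by (simp_all add: pt_def)
  define t where "t = (LEAST t. cell (pt t) \<in> exterior op l b k)"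
  have ex20: "cell (pt 20) \<in> exterior op l b k" using cq \<open>pt 20 = q\<close> by simp
  then have t: "cell (pt t) \<in> exterior op l b k" unfolding t_def by (rule LeastI)
  have t20: "t \<le> 20" unfolding t_def using ex20 by (rule Least_le)
  have "t \<noteq> 0" using t cp \<open>pt 0 = p\<close> by metis
  then obtain t' where t': "t = Suc t'" using not0_implies_Suc by blast
  then have ct': "cell (pt t') \<notin> exterior op l b k" unfolding t_def using not_less_Least by (metis lessI)
  have bnd: "\<bar>fst q - fst p\<bar> \<le> 3" "\<bar>snd q - snd p\<bar> \<le> 3"
  proof -
    have "\<bar>fst (p - q)\<bar> \<le> norm (p - q)" "\<bar>snd (p - q)\<bar> \<le> norm (p - q)"
      by (rule abs_coord_le_norm)+
    then show "\<bar>fst q - fst p\<bar> \<le> 3" "\<bar>snd q - snd p\<bar> \<le> 3" using pq R_le by auto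
  qed
  have fl: "\<bar>\<lfloor>x + real t' / 20 * d\<rfloor> - \<lfloor>x + real t / 20 * d\<rfloor>\<bar> \<le> 1" if "\<bar>d\<bar> \<le> 3" for x d
  proof -
    have e: "x + real t / 20 * d = (x + real t' / 20 * d) + d / 20" unfolding t' by (simp add: field_simps)
    show ?thesis unfolding e using that by linarith
  qed
  have "nb8 (cell (pt t')) (cell (pt t))"
    unfolding nb8_def cell_def pt_def using fl bnd by simp
  from circuit_diagonal_step[OF k ct' t this] obtain g where g: "g \<in> circuit op l b k"
    "fst g \<in> {fst (cell (pt t')), fst (cell (pt t))}" "snd g \<in> {snd (cell (pt t')), snd (cell (pt t))}" by blast
  obtain v where v: "v \<in> G b k" "in_cell m (P v) g" using circuit_vertex[OF k g(1)] by blast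
  obtain y where y: "is_lift m (P v) y" "cell y = g" using v(2) in_cell_def by blast
  obtain s1 where s1: "s1 \<in> {t', t}" "fst g = fst (cell (pt s1))" using g(2) by blast
  obtain s2 where s2: "s2 \<in> {t', t}" "snd g = snd (cell (pt s2))" using g(3) by blast
  define w where "w = (fst (pt s1), snd (pt s2))"
  have fl1: "\<bar>a - c\<bar> \<le> 1" if "\<lfloor>a\<rfloor> = \<lfloor>c\<rfloor>" for a c :: real using that by linarith
  have "\<lfloor>fst y\<rfloor> = \<lfloor>fst w\<rfloor>" "\<lfloor>snd y\<rfloor> = \<lfloor>snd w\<rfloor>"
    using s1(2) s2(2) unfolding w_def y(2)[symmetric] cell_def by simp_all
  then have yw: "norm (y - w) \<le> sqrt 2 * 1" by (intro norm_pair_le) (auto intro: fl1)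
  have vN: "v < N" using v(1) G_def by blast
  \<comment> \<open>\<open>w\<close> lies in the circuit cell and within half an edge length of one end of the edge\<close>
  have near_end: "\<exists>x z. x \<in> {i, j} \<and> is_lift m (P x) z \<and> norm (w - z) \<le> R / 2"
  proof (cases "t \<le> 10")
    case True
    have "\<bar>real s / 20 * d\<bar> \<le> \<bar>d / 2\<bar>" if "s \<in> {t', t}" for s d
    proof -
      have "real s / 20 \<le> 1 / 2" using that True t' by auto
      then have "real s / 20 * \<bar>d\<bar> \<le> 1 / 2 * \<bar>d\<bar>" by (intro mult_right_mono) auto
      then show ?thesis by (simp add: abs_mult)
    qed
    then have "norm (w - p) \<le> norm ((1 / 2) *\<^sub>R (q - p))"
      using s1(1) s2(1) unfolding w_def pt_def by (intro norm_pair_mono) simp_all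
    also have "\<dots> = norm (p - q) / 2" by (simp add: norm_minus_commute)
    finally have "norm (w - p) \<le> R / 2" using pq by linarith
    then show ?thesis using p by blast
  next
    case False
    have "\<bar>x + real s / 20 * (z - x) - z\<bar> \<le> \<bar>(x - z) / 2\<bar>" if "s \<in> {t', t}" for s and x z :: real
    proof -
      have "x + real s / 20 * (z - x) - z = (1 - real s / 20) * (x - z)" by (simp add: field_simps)
      moreover have "\<bar>1 - real s / 20\<bar> \<le> 1 / 2" using that False t' t20 by auto
      then have "\<bar>1 - real s / 20\<bar> * \<bar>x - z\<bar> \<le> 1 / 2 * \<bar>x - z\<bar>" by (intro mult_right_mono) auto
      ultimately show ?thesis by (simp add: abs_mult)
    qed
    then have "norm (w - q) \<le> norm ((1 / 2) *\<^sub>R (p - q))"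
      using s1(1) s2(1) unfolding w_def pt_def by (intro norm_pair_mono) simp_all
    also have "\<dots> = norm (p - q) / 2" by simp
    finally have "norm (w - q) \<le> R / 2" using pq by linarith
    then show ?thesis using q by blast
  qed
  then obtain x z where x: "x \<in> {i, j}" "is_lift m (P x) z" "norm (w - z) \<le> R / 2" by blast
  have "norm (y - z) \<le> norm (y - w) + norm (w - z)" using norm_triangle_ineq[of "y - w" "w - z"] by simp
  also have "\<dots> \<le> sqrt 2 + R / 2" using yw x(3) by simp
  also have "\<dots> \<le> R" using R_ge by simp
  finally have "norm (z - y) \<le> R" by (simp add: norm_minus_commute)
  then have "x = v \<or> E x v" unfolding E_def using x ij vN y(1) by blast
  then show ?thesis using v(1) x(1) by blast
qed

lemma block_lift:
  assumes "blk u = b"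
  shows "\<exists>p. is_lift m (P u) p \<and> cell p \<in> block l b"
proof -
  define c1 where "c1 = \<lfloor>fst (P u)\<rfloor> div l div M"
  define c2 where "c2 = \<lfloor>snd (P u)\<rfloor> div l div M"
  let ?p = "(fst (P u) + of_int (m * - c1), snd (P u) + of_int (m * - c2))"
  have lift: "is_lift m (P u) ?p" unfolding is_lift_def by blast
  have d: "(x + m * - (x div l div M)) div l = x div l mod M" for x
  proof -
    have "(x + m * - (x div l div M)) div l = (x + l * (M * - (x div l div M))) div l" by (simp add: mult.assoc)
    also have "\<dots> = M * - (x div l div M) + x div l" using l_pos by (intro div_mult_self2) simp
    also have "\<dots> = x div l mod M" by (simp add: minus_mult_div_eq_mod)
    finally show ?thesis .
  qed
  have "cell ?p = (\<lfloor>fst (P u)\<rfloor> + m * - c1, \<lfloor>snd (P u)\<rfloor> + m * - c2)"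
    unfolding cell_def by (simp only: fst_conv snd_conv floor_add_int)
  then have "cell ?p \<in> block l b"
    unfolding block_def using d[of "\<lfloor>fst (P u)\<rfloor>"] d[of "\<lfloor>snd (P u)\<rfloor>"] assms
    unfolding blk_def c1_def c2_def by auto
  then show ?thesis using lift by blast
qed

text \<open>Lift the path from \<open>u\<close> to the plane, starting in the block. Without a
  contact no edge of it leads into the exterior, so the lift ends inside the big block.\<close>

lemma touch_circuit:
  assumes b: "b \<in> grid M" and k: "k < kap" and U: "U \<subseteq> {..<N}" "u \<in> U" "w \<in> U"
    and c: "conn_by E U u w" and bu: "blk u = b" and bw: "\<not> near M b (blk w)"
  shows "\<exists>x\<in>U. \<exists>v\<in>G b k. x = v \<or> E x v"
proof (rule ccontr)
  assume no: "\<not> ?thesis"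
  have "\<exists>p. is_lift m (P w) p \<and> cell p \<notin> exterior op l b k"
    using c unfolding conn_by_def
  proof (induction rule: rtranclp_induct)
    case base
    obtain p where p: "is_lift m (P u) p" "cell p \<in> block l b" using block_lift[OF bu] by blast
    then have "cell p \<notin> exterior op l b k"
      using block_sub_ballset exterior_ballset_disjoint[OF less_imp_le[OF k]] by blast
    then show ?case using p by blast
  next
    case (step y z)
    then obtain p where p: "is_lift m (P y) p" "cell p \<notin> exterior op l b k" by blast
    obtain q where q: "is_lift m (P z) q" "norm (p - q) \<le> R" using E_lift[OF _ p(1)] step.hyps by blast
    have yz: "y \<in> U" "z \<in> U" "y < N" "z < N" using step.hyps U by auto
    have "cell q \<notin> exterior op l b k"
    proof
      assume "cell q \<in> exterior op l b k"
      from edge_meets_circuit[OF less_imp_le[OF k] p(1) q(1) yz(3,4) q(2) p(2) this] yz no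
      show False by blast
    qed
    then show ?case using q by blast
  qed
  then obtain p where p: "is_lift m (P w) p" "cell p \<notin> exterior op l b k" by blast
  then have "cell p \<in> bigblock l b" using outside_exterior by blast
  moreover have "blk w = (fst (cell p) div l mod M, snd (cell p) div l mod M)"
    using in_cell_blk p(1) in_cell_def by blast
  ultimately have "near M b (blk w)" by (rule bigblock_near)
  then show False using bw by simp
qed

text \<open>A big block has side \<open>3 * l\<close>, less than the period \<open>m\<close>, so it
  embeds into the torus. This carries the disjointness of circuits over from the plane.\<close>

lemma bigblock_cell_unique:
  assumes "in_cell m (P v) g" "in_cell m (P v) h" "g \<in> bigblock l b" "h \<in> bigblock l b"
  shows "g = h"
proof -
  have "\<bar>fst g - fst h\<bar> < m" "\<bar>snd g - snd h\<bar> < m"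
    using assms(3,4) m_ge unfolding bigblock_iff[OF l_pos] by linarith+
  then have "fst g = fst h" "snd g = snd h"
    using in_cell_diff[OF assms(1,2)] by (blast intro: dvd_diff_small)+
  then show ?thesis by (simp add: prod_eq_iff)
qed

lemma G_disjoint:
  assumes "k < kap" "k' < kap" "v \<in> G b k" "v \<in> G b k'"
  shows "k = k'"
proof -
  obtain g where g: "g \<in> circuit op l b k" "in_cell m (P v) g" using assms(3) G_def by blast
  obtain h where h: "h \<in> circuit op l b k'" "in_cell m (P v) h" using assms(4) G_def by blast
  have "g = h"
    by (rule bigblock_cell_unique[OF g(2) h(2)]) (use circuit_bigblock assms g h in blast)+
  then show ?thesis using circuit_disjoint[of k k' g b] assms g h by simp
qed

lemma G_near:
  assumes "k < kap" "v \<in> G b k"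
  shows "near M b (blk v)"
proof -
  obtain g where g: "g \<in> circuit op l b k" "in_cell m (P v) g" using assms(2) G_def by blast
  have "g \<in> bigblock l b" using circuit_bigblock[OF assms(1)] g(1) by blast
  then show ?thesis using in_cell_blk[OF g(2)] by (rule bigblock_near)
qed

lemma G_conn:
  assumes k: "k < kap" and v: "v \<in> G b k" and w: "w \<in> G b k"
  shows "conn_by E (G b k) v w"
proof -
  obtain g where g: "g \<in> circuit op l b k" "in_cell m (P v) g" using v G_def by blast
  obtain h where h: "h \<in> circuit op l b k" "in_cell m (P w) h" using w G_def by blast
  have one: "conn_by E (G b k) x y"
    if "x \<in> G b k" "y \<in> G b k" "in_cell m (P x) c" "in_cell m (P y) d" "nb8 c d" for x y c d
  proof (cases "x = y")
    case False
    then have "E x y" using nb8_adjacent[of x c y d] that G_def by blast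
    then show ?thesis using conn_by_step[of E "G b k" x x y] that by simp
  qed simp
  have "\<forall>y. y \<in> G b k \<longrightarrow> in_cell m (P y) h \<longrightarrow> conn_by E (G b k) v y"
    using circuit_conn[OF less_imp_le[OF k] g(1) h(1)] unfolding conn_by_def[of nb8]
  proof (induction rule: rtranclp_induct)
    case base
    then show ?case using one[OF v _ g(2)] by (simp add: nb8_def)
  next
    case (step c d)
    obtain u where u: "u \<in> G b k" "in_cell m (P u) c"
      using circuit_vertex[OF less_imp_le[OF k]] step.hyps by blast
    then have "conn_by E (G b k) v u" using step.IH by blast
    then show ?case using one[OF u(1) _ u(2)] step.hyps conn_by_trans[of E "G b k" v u] by blast
  qed
  then show ?thesis using w h by blast
qed

text \<open>Walk along row \<open>j\<close> from the last cell of the block in direction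
  \<open>d\<close>: every later cell is beyond the block, and after \<open>ell + 1\<close> steps the
  walk has left the big block.\<close>

lemma row_hit:
  assumes k: "k < kap" and j: "l * snd b \<le> j" "j < l * snd b + l" and d: "d \<in> {-1, 1}"
  shows "\<exists>g\<in>circuit op l b k. snd g = j \<and> fst g div l = fst b + d"
proof -
  define a where "a = (if d = 1 then l * fst b + l - 1 else l * fst b)"
  define f where "f t = (a + d * int t, j)" for t :: nat
  have "\<exists>t. t \<le> ell + 1 \<and> 0 < t \<and> f t \<in> circuit op l b k"
  proof (rule circuit_hit_line)
    show "nb4 (f t) (f (Suc t))" for t using d unfolding f_def nb4_def by (auto simp: algebra_simps)
    show "f 0 \<in> block l b" using j l_pos unfolding block_iff[OF l_pos] f_def a_def by simp
    show "f (ell + 1) \<notin> bigblock l b" using d unfolding bigblock_iff[OF l_pos] f_def a_def by auto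
  qed (use k in simp)
  then obtain t where t: "0 < t" "f t \<in> circuit op l b k" by blast
  have "f t \<in> bigblock l b" using t(2) circuit_bigblock[OF k] by blast
  then have "fst (f t) div l = fst b + d"
    using d t(1) unfolding bigblock_iff[OF l_pos] div_eq_iff_bounds[OF l_pos] f_def a_def
    by (auto simp: algebra_simps)
  then show ?thesis using t(2) by (intro bexI[of _ "f t"]) (auto simp: f_def)
qed

lemma column_hit:
  assumes k: "k < kap" and j: "l * fst b \<le> j" "j < l * fst b + l" and d: "d \<in> {-1, 1}"
  shows "\<exists>g\<in>circuit op l b k. fst g = j \<and> snd g div l = snd b + d"
proof -
  define a where "a = (if d = 1 then l * snd b + l - 1 else l * snd b)"
  define f where "f t = (j, a + d * int t)" for t :: nat
  have "\<exists>t. t \<le> ell + 1 \<and> 0 < t \<and> f t \<in> circuit op l b k"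
  proof (rule circuit_hit_line)
    show "nb4 (f t) (f (Suc t))" for t using d unfolding f_def nb4_def by (auto simp: algebra_simps)
    show "f 0 \<in> block l b" using j l_pos unfolding block_iff[OF l_pos] f_def a_def by simp
    show "f (ell + 1) \<notin> bigblock l b" using d unfolding bigblock_iff[OF l_pos] f_def a_def by auto
  qed (use k in simp)
  then obtain t where t: "0 < t" "f t \<in> circuit op l b k" by blast
  have "f t \<in> bigblock l b" using t(2) circuit_bigblock[OF k] by blast
  then have "snd (f t) div l = snd b + d"
    using d t(1) unfolding bigblock_iff[OF l_pos] div_eq_iff_bounds[OF l_pos] f_def a_def
    by (auto simp: algebra_simps)
  then show ?thesis using t(2) by (intro bexI[of _ "f t"]) (auto simp: f_def)
qed

lemma G_hit:
  assumes b: "b \<in> grid M" and k: "k < kap" and d: "d \<in> {-1, 1}"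
  shows "(\<exists>v\<in>G b k. blk v = ((fst b + d) mod M, snd b)) \<and> (\<exists>v\<in>G b k. blk v = (fst b, (snd b + d) mod M))"
proof
  have bM: "fst b mod M = fst b" "snd b mod M = snd b" using b by auto
  have dv: "l * c div l = c" for c using l_pos by simp
  obtain g where g: "g \<in> circuit op l b k" "snd g = l * snd b" "fst g div l = fst b + d"
    using row_hit[OF k _ _ d, of b "l * snd b"] l_pos by auto
  obtain v where "v \<in> G b k" "in_cell m (P v) g" using circuit_vertex[OF less_imp_le[OF k] g(1)] by blast
  then show "\<exists>v\<in>G b k. blk v = ((fst b + d) mod M, snd b)"
    using in_cell_blk g bM dv by (intro bexI[of _ v]) auto
  obtain g where g: "g \<in> circuit op l b k" "fst g = l * fst b" "snd g div l = snd b + d"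
    using column_hit[OF k _ _ d, of b "l * fst b"] l_pos by auto
  obtain v where "v \<in> G b k" "in_cell m (P v) g" using circuit_vertex[OF less_imp_le[OF k] g(1)] by blast
  then show "\<exists>v\<in>G b k. blk v = (fst b, (snd b + d) mod M)"
    using in_cell_blk g bM dv by (intro bexI[of _ v]) auto
qed

text \<open>Each of the \<open>ell\<close> rows through the block crosses the circuit in an occupied
  cell. The vertices found are distinct because the rows differ by less than the period.\<close>

lemma G_card:
  assumes k: "k < kap"
  shows "ell \<le> card (G b k)"
proof -
  let ?J = "{l * snd b..<l * snd b + l}"
  have "\<exists>v\<in>G b k. \<exists>g. in_cell m (P v) g \<and> snd g = j" if "j \<in> ?J" for j
    using row_hit[OF k, of b j 1] circuit_vertex[OF less_imp_le[OF k], of _ b] that by fastforce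
  then obtain f where f: "\<And>j. j \<in> ?J \<Longrightarrow> f j \<in> G b k \<and> (\<exists>g. in_cell m (P (f j)) g \<and> snd g = j)"
    by metis
  have "inj_on f ?J"
  proof (rule inj_onI)
    fix i j assume ij: "i \<in> ?J" "j \<in> ?J" "f i = f j"
    obtain g where g: "in_cell m (P (f i)) g" "snd g = i" using f[OF ij(1)] by blast
    obtain h where h: "in_cell m (P (f i)) h" "snd h = j" using f[OF ij(2)] ij(3) by auto
    have "m dvd i - j" using in_cell_diff(2)[OF g(1) h(1)] g(2) h(2) by simp
    moreover have "\<bar>i - j\<bar> < l" using ij(1,2) by auto
    then have "\<bar>i - j\<bar> < m" using m_ge l_pos by linarith
    ultimately show "i = j" by (rule dvd_diff_small)
  qed
  moreover have "f ` ?J \<subseteq> G b k" using f by blast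
  moreover have "finite (G b k)" unfolding G_def by simp
  ultimately have "card ?J \<le> card (G b k)" by (rule card_inj_on_le)
  then show ?thesis by simp
qed

lemma E_in_cell:
  assumes "E v w" "in_cell m (P v) g"
  shows "\<exists>d\<in>{-3..3} \<times> {-3..3}. in_cell m (P w) (fst g + fst d, snd g + snd d)"
proof -
  obtain p where p: "is_lift m (P v) p" "cell p = g" using assms in_cell_def by blast
  obtain q where q: "is_lift m (P w) q" "norm (p - q) \<le> R" using E_lift[OF assms(1) p(1)] by blast
  have "\<bar>fst (p - q)\<bar> \<le> norm (p - q)" "\<bar>snd (p - q)\<bar> \<le> norm (p - q)"
    by (rule abs_coord_le_norm)+
  then have pq: "\<bar>fst p - fst q\<bar> \<le> 3" "\<bar>snd p - snd q\<bar> \<le> 3" using q(2) R_le by auto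
  have fl: "\<lfloor>y\<rfloor> - \<lfloor>x\<rfloor> \<in> {-3..3}" if "\<bar>x - y\<bar> \<le> 3" for x y :: real
  proof -
    have "\<lfloor>y\<rfloor> - \<lfloor>x\<rfloor> < 4" "\<lfloor>x\<rfloor> - \<lfloor>y\<rfloor> < 4" using that by linarith+
    then show ?thesis by auto
  qed
  let ?d = "(\<lfloor>fst q\<rfloor> - \<lfloor>fst p\<rfloor>, \<lfloor>snd q\<rfloor> - \<lfloor>snd p\<rfloor>)"
  have "?d \<in> {-3..3} \<times> {-3..3}" using fl[OF pq(1)] fl[OF pq(2)] by blast
  moreover have "in_cell m (P w) (fst g + fst ?d, snd g + snd ?d)"
    unfolding in_cell_def using q(1) p(2) by (intro exI[of _ q]) (auto simp: cell_def)
  ultimately show ?thesis by blast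
qed

lemma block_eq_window: "block l b = window l (l * fst b, l * snd b)"
proof (rule set_eqI)
  fix g
  show "g \<in> block l b \<longleftrightarrow> g \<in> window l (l * fst b, l * snd b)"
    using block_iff[OF l_pos, of g b] unfolding window_def by (cases g) auto
qed

text \<open>A degree is at most the number of points in 49 cells, so the sum is bounded by products
  of the counts of two cells at a fixed offset. The inequality of arithmetic and geometric means
  reduces these to sums of squares over the block and over its shift, which is again a
  window.\<close>

lemma block_degree:
  "(\<Sum>v | v \<in> {..<N} \<and> blk v = b. real (card {w. E v w})) \<le> 49 * K0 * (real ell)\<^sup>2"
proof -
  let ?W = "block l b" and ?U = "{-3..3::int} \<times> {-3..3::int}"
  let ?sh = "\<lambda>d g. (fst g + fst d, snd g + snd d) :: int \<times> int"
  define c where "c g = real (cell_count N P m g)" for g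
  define dv where "dv v = real (card {w. E v w})" for v
  have finW: "finite ?W" unfolding block_eq_window window_def by simp
  have deg: "dv v \<le> (\<Sum>d\<in>?U. c (?sh d g))" if g: "in_cell m (P v) g" for v g
  proof -
    have "{w. E v w} \<subseteq> (\<Union>d\<in>?U. {w. w < N \<and> in_cell m (P w) (?sh d g)})"
      using E_in_cell[OF _ g] unfolding E_def by blast
    then have "card {w. E v w} \<le> card (\<Union>d\<in>?U. {w. w < N \<and> in_cell m (P w) (?sh d g)})"
      by (intro card_mono) auto
    also have "\<dots> \<le> (\<Sum>d\<in>?U. cell_count N P m (?sh d g))"
      unfolding cell_count_def by (rule card_UN_le) simp
    finally have "real (card {w. E v w}) \<le> real (\<Sum>d\<in>?U. cell_count N P m (?sh d g))" by (rule of_nat_mono)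
    then show ?thesis unfolding dv_def c_def by simp
  qed
  have ex: "\<exists>g\<in>?W. in_cell m (P v) g" if "blk v = b" for v
    using block_lift[OF that] unfolding in_cell_def by blast
  have "(\<Sum>v | v \<in> {..<N} \<and> blk v = b. dv v)
      \<le> (\<Sum>v | v \<in> {..<N} \<and> blk v = b. \<Sum>g\<in>?W. if in_cell m (P v) g then dv v else 0)"
  proof (rule sum_mono)
    fix v assume "v \<in> {v. v \<in> {..<N} \<and> blk v = b}"
    then obtain g where g: "g \<in> ?W" "in_cell m (P v) g" using ex by blast
    have "(if in_cell m (P v) g then dv v else 0) \<le> (\<Sum>g\<in>?W. if in_cell m (P v) g then dv v else 0)"
      by (rule member_le_sum) (use g finW in \<open>auto simp: dv_def\<close>)
    then show "dv v \<le> (\<Sum>g\<in>?W. if in_cell m (P v) g then dv v else 0)" using g by simp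
  qed
  also have "\<dots> \<le> (\<Sum>v\<in>{..<N}. \<Sum>g\<in>?W. if in_cell m (P v) g then dv v else 0)"
    by (rule sum_mono2) (auto simp: dv_def intro!: sum_nonneg)
  also have "\<dots> = (\<Sum>g\<in>?W. \<Sum>v\<in>{..<N}. if in_cell m (P v) g then dv v else 0)" by (rule sum.swap)
  also have "\<dots> \<le> (\<Sum>g\<in>?W. \<Sum>d\<in>?U. ((c g)\<^sup>2 + (c (?sh d g))\<^sup>2) / 2)"
  proof (rule sum_mono)
    fix g
    have "(\<Sum>v\<in>{..<N}. if in_cell m (P v) g then dv v else 0) = (\<Sum>v | v < N \<and> in_cell m (P v) g. dv v)"
      by (simp add: sum.If_cases lessThan_def Collect_conj_eq)
    also have "\<dots> \<le> (\<Sum>v | v < N \<and> in_cell m (P v) g. \<Sum>d\<in>?U. c (?sh d g))"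
      by (rule sum_mono) (use deg in blast)
    also have "\<dots> = c g * (\<Sum>d\<in>?U. c (?sh d g))" by (simp add: c_def cell_count_def)
    also have "\<dots> = (\<Sum>d\<in>?U. c g * c (?sh d g))" by (rule sum_distrib_left)
    also have "\<dots> \<le> (\<Sum>d\<in>?U. ((c g)\<^sup>2 + (c (?sh d g))\<^sup>2) / 2)"
    proof (rule sum_mono)
      fix d
      show "c g * c (?sh d g) \<le> ((c g)\<^sup>2 + (c (?sh d g))\<^sup>2) / 2"
        using sum_squares_bound[of "c g" "c (?sh d g)"] by simp
    qed
    finally show "(\<Sum>v\<in>{..<N}. if in_cell m (P v) g then dv v else 0) \<le> (\<Sum>d\<in>?U. ((c g)\<^sup>2 + (c (?sh d g))\<^sup>2) / 2)" .
  qed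
  also have "\<dots> = (\<Sum>d\<in>?U. \<Sum>g\<in>?W. ((c g)\<^sup>2 + (c (?sh d g))\<^sup>2) / 2)" by (rule sum.swap)
  also have "\<dots> \<le> (\<Sum>d\<in>?U. K0 * (real ell)\<^sup>2)"
  proof (rule sum_mono)
    fix d assume "d \<in> ?U"
    let ?w = "(l * fst b, l * snd b)"
    have "(\<Sum>g\<in>?W. (c g)\<^sup>2) \<le> K0 * (real ell)\<^sup>2"
      unfolding block_eq_window c_def by (rule window_bound)
    moreover have "(\<Sum>g\<in>?W. (c (?sh d g))\<^sup>2) = (\<Sum>g\<in>window l (?sh d ?w). (c g)\<^sup>2)"
    proof (rule sum.reindex_bij_witness[where j = "?sh d" and i = "\<lambda>g. (fst g - fst d, snd g - snd d)"])
    qed (auto simp: block_eq_window window_def)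
    moreover have "(\<Sum>g\<in>window l (?sh d ?w). (c g)\<^sup>2) \<le> K0 * (real ell)\<^sup>2"
      unfolding c_def by (rule window_bound)
    ultimately have "(\<Sum>g\<in>?W. (c g)\<^sup>2) + (\<Sum>g\<in>?W. (c (?sh d g))\<^sup>2) \<le> 2 * (K0 * (real ell)\<^sup>2)" by linarith
    then show "(\<Sum>g\<in>?W. ((c g)\<^sup>2 + (c (?sh d g))\<^sup>2) / 2) \<le> K0 * (real ell)\<^sup>2"
      by (simp add: sum.distrib sum_divide_distrib[symmetric])
  qed
  also have "\<dots> = 49 * K0 * (real ell)\<^sup>2" by (simp add: card_cartesian_product)
  finally show ?thesis unfolding dv_def .
qed

sublocale circuit_graph "{..<N}" E M blk G kap ell "49 * K0"
proof
  show "finite {..<N}" by simp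
  show "x \<in> {..<N} \<and> y \<in> {..<N}" if "E x y" for x y using that by (simp add: E_def)
  show "1 \<le> 49 * K0" using K0 by simp
  show "blk v \<in> grid M" for v using M_ge by (simp add: blk_def)
  show "G b k \<subseteq> {..<N}" for b k unfolding G_def by auto
  show "\<exists>x\<in>U. \<exists>v\<in>G b k. x = v \<or> E x v"
    if "b \<in> grid M" "k < kap" "U \<subseteq> {..<N}" "u \<in> U" "w \<in> U" "conn_by E U u w"
      "blk u = b" "\<not> near M b (blk w)" for b k U u w
    using that by (rule touch_circuit)
qed (fact E_sym M_ge kap_pos ell_kap ell_M | rule block_degree | rule G_disjoint G_near G_conn G_hit G_card, assumption+)+

end

section \<open>From the torus metric to scaled lifts\<close>

definition scaled_pos :: "nat \<Rightarrow> real \<Rightarrow> real \<times> real \<Rightarrow> real \<times> real" where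
  "scaled_pos n s x = ((fst x + side n / 2) / s, (snd x + side n / 2) / s)"

lemma per_dist_le:
  assumes "0 < L"
  shows "per_dist L t \<le> \<bar>t + L * of_int z\<bar>"
proof -
  have "per_dist L t = L * \<bar>t / L - of_int (round (t / L))\<bar>"
    unfolding per_dist_def using assms by (simp add: abs_mult_pos' right_diff_distrib)
  also have "\<dots> \<le> L * \<bar>t / L - of_int (- z)\<bar>"
    using round_diff_minimal[of "t / L" "- z"] assms by (intro mult_left_mono) auto
  also have "\<dots> = \<bar>t + L * of_int z\<bar>"
    using assms by (simp add: abs_mult_pos' distrib_left)
  finally show ?thesis .
qed

text \<open>\<open>per_dist\<close> subtracts the nearest multiple of the side, so the torus
  distance is the least distance between lifts; division by \<open>s\<close> turns the side into the
  integer period \<open>m\<close>.\<close>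

lemma torus_dist_le_iff:
  assumes s: "0 < s" and m: "0 < m" and sd: "side n = s * of_int m"
  shows "torus_dist n x y \<le> \<rho> \<longleftrightarrow>
    (\<exists>p q. is_lift m (scaled_pos n s x) p \<and> is_lift m (scaled_pos n s y) q \<and> norm (p - q) \<le> \<rho> / s)"
proof
  have L: "0 < side n" using s m sd by simp
  assume d: "torus_dist n x y \<le> \<rho>"
  define z1 where "z1 = round ((fst x - fst y) / side n)"
  define z2 where "z2 = round ((snd x - snd y) / side n)"
  let ?p = "scaled_pos n s x" and ?Y = "scaled_pos n s y"
  let ?q = "(fst ?Y + of_int (m * z1), snd ?Y + of_int (m * z2))"
  have "is_lift m ?p ?p" unfolding is_lift_def by (intro exI[of _ 0]) simp
  moreover have "is_lift m ?Y ?q" unfolding is_lift_def by blast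
  moreover have "norm (?p - ?q) \<le> \<rho> / s"
  proof -
    have "fst (?p - ?q) = (fst x - fst y - side n * of_int z1) / s"
      "snd (?p - ?q) = (snd x - snd y - side n * of_int z2) / s"
      using s unfolding scaled_pos_def sd by (simp_all add: field_simps)
    then have "norm (?p - ?q) = sqrt (((fst x - fst y - side n * of_int z1) / s)\<^sup>2 + ((snd x - snd y - side n * of_int z2) / s)\<^sup>2)"
      unfolding norm_prod_def by (simp only: real_norm_def power2_abs)
    also have "\<dots> = sqrt (((fst x - fst y - side n * of_int z1)\<^sup>2 + (snd x - snd y - side n * of_int z2)\<^sup>2) / s\<^sup>2)"
      by (simp add: power_divide add_divide_distrib)
    also have "\<dots> = torus_dist n x y / s"
      using s unfolding torus_dist_def per_dist_def z1_def z2_def by (simp add: real_sqrt_divide)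
    finally show ?thesis using d s by (simp add: divide_right_mono)
  qed
  ultimately show "\<exists>p q. is_lift m ?p p \<and> is_lift m ?Y q \<and> norm (p - q) \<le> \<rho> / s" by blast
next
  have L: "0 < side n" using s m sd by simp
  assume "\<exists>p q. is_lift m (scaled_pos n s x) p \<and> is_lift m (scaled_pos n s y) q \<and> norm (p - q) \<le> \<rho> / s"
  then obtain a b c d p q where
    p: "p = (fst (scaled_pos n s x) + of_int (m * a), snd (scaled_pos n s x) + of_int (m * b))" and
    q: "q = (fst (scaled_pos n s y) + of_int (m * c), snd (scaled_pos n s y) + of_int (m * d))" and
    pq: "norm (p - q) \<le> \<rho> / s" unfolding is_lift_def by blast
  have e: "fst (p - q) * s = (fst x - fst y) + side n * of_int (a - c)"
    "snd (p - q) * s = (snd x - snd y) + side n * of_int (b - d)"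
    using s unfolding p q scaled_pos_def sd by (simp_all add: field_simps)
  have "torus_dist n x y \<le> sqrt ((fst (p - q) * s)\<^sup>2 + (snd (p - q) * s)\<^sup>2)"
    unfolding torus_dist_def
  proof (intro real_sqrt_le_mono add_mono)
    show "(per_dist (side n) (fst x - fst y))\<^sup>2 \<le> (fst (p - q) * s)\<^sup>2"
      unfolding e abs_le_square_iff[symmetric] by (rule order_trans[OF _ per_dist_le[OF L]]) (simp add: per_dist_def)
    show "(per_dist (side n) (snd x - snd y))\<^sup>2 \<le> (snd (p - q) * s)\<^sup>2"
      unfolding e abs_le_square_iff[symmetric] by (rule order_trans[OF _ per_dist_le[OF L]]) (simp add: per_dist_def)
  qed
  also have "\<dots> = sqrt (((fst (p - q))\<^sup>2 + (snd (p - q))\<^sup>2) * s\<^sup>2)"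
    by (simp add: power_mult_distrib distrib_right)
  also have "\<dots> = norm (p - q) * s"
    using s unfolding norm_prod_def by (simp add: real_sqrt_mult)
  also have "\<dots> \<le> \<rho>" using pq s by (simp add: pos_le_divide_eq)
  finally show "torus_dist n x y \<le> \<rho>" .
qed

context torus_points
begin

text \<open>The 441 is 9 * 49: the degree of nine blocks, when a block holds at most
  \<open>49 * K0 * ell\<^sup>2\<close>.\<close>

lemma edge_boundary_lower_bound:
  assumes adj: "\<And>i j. adj n r \<omega> i j = E i j" and N: "fst \<omega> = N"
    and L: "largest_component n r \<omega> L"
  shows "(real_of_int M)\<^sup>2 * (real ell)\<^sup>2 \<le> 900 * real (sdeg n r \<omega> L)"
    and "A \<subseteq> L \<Longrightarrow> induces_connected n r \<omega> A \<Longrightarrow> stat n r \<omega> L A \<le> 1 / 2 \<Longrightarrow>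
      441 * K0 * (real ell)\<^sup>2 < real (sdeg n r \<omega> A) \<Longrightarrow>
      sqrt (real (sdeg n r \<omega> A)) / (20000000 * (49 * K0)\<^sup>2) \<le> real (edges_between n r \<omega> A (L - A))"
proof -
  have adjE: "adj n r \<omega> = E" using adj by blast
  have sd: "real (sdeg n r \<omega> S) = (\<Sum>v\<in>S. dg v)" for S
    unfolding sdeg_def vdeg_def dg_def adjE by simp
  have V: "verts \<omega> = {..<N}" by (simp add: verts_def N)
  obtain v0 where v0: "v0 \<in> {..<N}" "L = {j. E\<^sup>*\<^sup>* v0 j}"
    using L unfolding largest_component_def components_def adjE V by blast
  have largest: "card {w. E\<^sup>*\<^sup>* v w} \<le> card L" if "v \<in> {..<N}" for v
    using L that unfolding largest_component_def components_def adjE V by blast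
  show deg: "(real_of_int M)\<^sup>2 * (real ell)\<^sup>2 \<le> 900 * real (sdeg n r \<omega> L)"
    unfolding sd by (rule largest_component_degree[OF v0 largest])
  assume A: "A \<subseteq> L" and con: "induces_connected n r \<omega> A" and half: "stat n r \<omega> L A \<le> 1 / 2"
    and large: "441 * K0 * (real ell)\<^sup>2 < real (sdeg n r \<omega> A)"
  have "0 < (real_of_int M)\<^sup>2 * (real ell)\<^sup>2" using M_ge l_pos by simp
  then have "0 < real (sdeg n r \<omega> L)" using deg by linarith
  then have half': "(\<Sum>v\<in>A. dg v) \<le> (\<Sum>v\<in>L. dg v) / 2"
    using half unfolding stat_def sd[symmetric] by (simp add: field_simps)
  have "sqrt (\<Sum>v\<in>A. dg v) / (20000000 * (49 * K0)\<^sup>2) \<le> real (card (bd A L))"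
  proof (rule isoperimetry[OF v0 largest A _ half'])
    show "conn_by E A x y" if "x \<in> A" "y \<in> A" for x y
      using con that unfolding induces_connected_def conn_by_def adjE by blast
    show "9 * (49 * K0) * (real ell)\<^sup>2 < (\<Sum>v\<in>A. dg v)" using large unfolding sd by simp
  qed
  then show "sqrt (real (sdeg n r \<omega> A)) / (20000000 * (49 * K0)\<^sup>2) \<le> real (edges_between n r \<omega> A (L - A))"
    unfolding sd edges_between_def bd_def adjE .
qed

end

section \<open>Probability estimates\<close>

abbreviation unif :: "nat \<Rightarrow> (real \<times> real) measure" where
  "unif n \<equiv> uniform_measure lborel (torus_box n)"

abbreviation unif_seq :: "nat \<Rightarrow> (nat \<Rightarrow> real \<times> real) measure" where
  "unif_seq n \<equiv> \<Pi>\<^sub>M i\<in>(UNIV :: nat set). unif n"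

abbreviation poisson :: "nat \<Rightarrow> nat measure" where
  "poisson n \<equiv> measure_pmf (poisson_pmf (real n))"

lemma emeasure_lborel_Times:
  fixes A B :: "real set"
  assumes "A \<in> sets borel" "B \<in> sets borel"
  shows "emeasure lborel (A \<times> B) = emeasure lborel A * emeasure lborel B"
  using assms by (subst lborel_prod[symmetric]) (simp add: lborel.emeasure_pair_measure_Times)

lemma sets_torus_box [measurable]: "torus_box n \<in> sets borel"
  unfolding torus_box_def by (intro borel_Times) auto

lemma emeasure_torus_box: "emeasure lborel (torus_box n) = ennreal (real n)"
proof -
  have "emeasure lborel (torus_box n) = ennreal (side n) * ennreal (side n)"
    unfolding torus_box_def by (subst emeasure_lborel_Times) (auto simp: side_def)
  also have "\<dots> = ennreal (side n * side n)" by (rule ennreal_mult[symmetric]) (auto simp: side_def)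
  finally show ?thesis by (simp add: side_def)
qed

lemma prob_space_unif: "0 < n \<Longrightarrow> prob_space (unif n)"
  by (intro prob_space_uniform_measure) (auto simp: emeasure_torus_box)

lemma sets_unif [simp, measurable_cong]: "sets (unif n) = sets borel"
  by simp

lemma space_unif [simp]: "space (unif n) = UNIV" by simp

lemma prob_space_ppp:
  assumes "0 < n"
  shows "prob_space (ppp n)"
proof -
  interpret U: prob_space "unif n" by (rule prob_space_unif[OF assms])
  interpret PM: prob_space "unif_seq n" by (rule prob_space_PiM) (rule U.prob_space_axioms)
  interpret Q: prob_space "poisson n" by (rule prob_space_measure_pmf)
  interpret pair_prob_space "poisson n" "unif_seq n" ..
  show ?thesis unfolding ppp_def by (rule P.prob_space_axioms)
qed

lemma fst_ppp_measurable [measurable]: "fst \<in> ppp n \<rightarrow>\<^sub>M count_space UNIV"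
  unfolding ppp_def by measurable

lemma point_ppp_measurable [measurable]: "(\<lambda>\<omega>. snd \<omega> i) \<in> ppp n \<rightarrow>\<^sub>M borel"
  unfolding ppp_def by measurable

section \<open>Exponential moments of the Poisson process\<close>

lemma nn_integral_prod_PiM_unif:
  assumes n: "0 < n" and h [measurable]: "h \<in> borel_measurable borel"
  shows "(\<integral>\<^sup>+X. (\<Prod>i<N. h (X i)) \<partial>unif_seq n) = (\<integral>\<^sup>+x. h x \<partial>unif n) ^ N"
proof -
  interpret U: prob_space "unif n" by (rule prob_space_unif[OF n])
  interpret product_sigma_finite "\<lambda>_::nat. unif n" ..
  let ?K = "unif_seq n" and ?I = "\<Pi>\<^sub>M i\<in>{..<N}. unif n"
  have d: "distr ?K ?I (\<lambda>X. \<lambda>i\<in>{..<N}. X i) = ?I"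
    using distr_PiM_reindex[of UNIV "\<lambda>_. unif n" "\<lambda>i. i" "{..<N}"] U.prob_space_axioms by simp
  have "(\<integral>\<^sup>+X. (\<Prod>i<N. h (X i)) \<partial>?K) = (\<integral>\<^sup>+X. (\<Prod>i<N. h ((\<lambda>i\<in>{..<N}. X i) i)) \<partial>?K)"
    by (intro nn_integral_cong prod.cong) auto
  also have "\<dots> = (\<integral>\<^sup>+X. (\<Prod>i<N. h (X i)) \<partial>distr ?K ?I (\<lambda>X. \<lambda>i\<in>{..<N}. X i))"
    by (subst nn_integral_distr) (auto intro!: measurable_restrict)
  also have "\<dots> = (\<integral>\<^sup>+X. (\<Prod>i<N. h (X i)) \<partial>?I)" unfolding d ..
  also have "\<dots> = (\<Prod>i<N. \<integral>\<^sup>+x. h x \<partial>unif n)" by (rule product_nn_integral_prod) auto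
  finally show ?thesis by simp
qed

lemma nn_integral_poisson_power:
  assumes "0 < n" "0 \<le> q"
  shows "(\<integral>\<^sup>+N. ennreal q ^ N \<partial>poisson n) = ennreal (exp (real n * (q - 1)))"
proof -
  have s: "(\<lambda>N. (real n * q) ^ N / fact N * exp (- real n)) sums (exp (real n * q) * exp (- real n))"
    using exp_converges[of "real n * q"] by (intro sums_mult2) (simp add: scaleR_conv_of_real divide_inverse mult.commute)
  have "(\<integral>\<^sup>+N. ennreal q ^ N \<partial>poisson n)
      = (\<integral>\<^sup>+N. ennreal ((real n * q) ^ N / fact N * exp (- real n)) \<partial>count_space UNIV)"
    unfolding nn_integral_measure_pmf
    using assms by (intro nn_integral_cong)
      (simp add: ennreal_power ennreal_mult'[symmetric] power_mult_distrib mult_ac)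
  also have "\<dots> = (\<Sum>N. ennreal ((real n * q) ^ N / fact N * exp (- real n)))"
    by (rule nn_integral_count_space_nat)
  also have "\<dots> = ennreal (exp (real n * q) * exp (- real n))"
    using assms s by (subst suminf_ennreal2) (auto simp: sums_iff)
  also have "exp (real n * q) * exp (- real n) = exp (real n * (q - 1))"
    by (simp add: exp_add[symmetric] algebra_simps)
  finally show ?thesis .
qed

text \<open>Generating functional of the process for a function with two values. Given the number of
  points, the integrand is a product of independent factors, and the Poisson sum exponentiates their
  mean. The values 0 and 1 yield void probabilities, \<open>exp 1\<close> and 1 the Chernoff
  bound.\<close>

lemma nn_integral_ppp_prod:
  assumes n: "0 < n" and U [measurable]: "U \<in> sets borel" and ab: "0 \<le> a" "0 \<le> b"
  shows "(\<integral>\<^sup>+\<omega>. (\<Prod>i<fst \<omega>. ennreal (if snd \<omega> i \<in> U then a else b)) \<partial>ppp n)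
    = ennreal (exp (real n * (a * measure (unif n) U + b * (1 - measure (unif n) U) - 1)))"
proof -
  interpret U: prob_space "unif n" by (rule prob_space_unif[OF n])
  interpret PM: prob_space "unif_seq n" by (rule prob_space_PiM) (rule U.prob_space_axioms)
  let ?h = "\<lambda>x. ennreal (if x \<in> U then a else b)"
  let ?p = "measure (unif n) U"
  have h [measurable]: "?h \<in> borel_measurable borel" by measurable
  have meas: "(\<lambda>\<omega>. \<Prod>i<fst \<omega>. ?h (snd \<omega> i)) \<in> borel_measurable (poisson n \<Otimes>\<^sub>M unif_seq n)"
    by (rule measurable_compose_countable[where g = fst]) measurable
  have int_h: "(\<integral>\<^sup>+x. ?h x \<partial>unif n) = ennreal (a * ?p + b * (1 - ?p))"
  proof -
    have "(\<integral>\<^sup>+x. ?h x \<partial>unif n) = (\<integral>\<^sup>+x. ennreal a * indicator U x + ennreal b * indicator (- U) x \<partial>unif n)"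
      by (intro nn_integral_cong) (auto simp: indicator_def)
    also have "\<dots> = ennreal a * emeasure (unif n) U + ennreal b * emeasure (unif n) (- U)"
      by (subst nn_integral_add) (auto simp: nn_integral_cmult_indicator)
    also have "emeasure (unif n) U = ennreal ?p" by (rule U.emeasure_eq_measure)
    also have "emeasure (unif n) (- U) = ennreal (1 - ?p)"
      unfolding U.emeasure_eq_measure using U.prob_compl[of U] by (simp add: Compl_eq_Diff_UNIV)
    finally show ?thesis using ab by (simp add: ennreal_mult ennreal_plus)
  qed
  have "(\<integral>\<^sup>+\<omega>. (\<Prod>i<fst \<omega>. ?h (snd \<omega> i)) \<partial>ppp n)
     = (\<integral>\<^sup>+N. \<integral>\<^sup>+X. (\<Prod>i<N. ?h (X i)) \<partial>unif_seq n \<partial>poisson n)"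
    unfolding ppp_def using PM.nn_integral_fst[OF meas] by simp
  also have "\<dots> = (\<integral>\<^sup>+N. ennreal (a * ?p + b * (1 - ?p)) ^ N \<partial>poisson n)"
    unfolding nn_integral_prod_PiM_unif[OF n h] int_h ..
  also have "\<dots> = ennreal (exp (real n * (a * ?p + b * (1 - ?p) - 1)))"
    by (rule nn_integral_poisson_power[OF n]) (use ab in simp)
  finally show ?thesis .
qed

lemma void_probability:
  assumes n: "0 < n" and U [measurable]: "U \<in> sets borel"
  shows "measure (ppp n) {\<omega> \<in> space (ppp n). \<forall>i<fst \<omega>. snd \<omega> i \<notin> U} = exp (- real n * measure (unif n) U)"
proof -
  interpret prob_space "ppp n" by (rule prob_space_ppp[OF n])
  let ?S = "{\<omega> \<in> space (ppp n). \<forall>i<fst \<omega>. snd \<omega> i \<notin> U}"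
  have m: "?S \<in> sets (ppp n)"
  proof -
    have "Measurable.pred (ppp n) (\<lambda>\<omega>. \<forall>i<fst \<omega>. snd \<omega> i \<notin> U)"
      by (rule measurable_compose_countable[where g = fst]) measurable
    then show ?thesis by simp
  qed
  have "emeasure (ppp n) ?S = (\<integral>\<^sup>+\<omega>. indicator ?S \<omega> \<partial>ppp n)" using m by simp
  also have "\<dots> = (\<integral>\<^sup>+\<omega>. (\<Prod>i<fst \<omega>. ennreal (if snd \<omega> i \<in> U then 0 else 1)) \<partial>ppp n)"
    by (intro nn_integral_cong) (auto simp: indicator_def prod_zero_iff intro!: prod.neutral)
  also have "\<dots> = ennreal (exp (- real n * measure (unif n) U))"
    by (subst nn_integral_ppp_prod[OF n U]) auto
  finally show ?thesis by (simp add: emeasure_eq_measure)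
qed

text \<open>Markov's inequality for the exponential of the count; the 2 bounds
  \<open>exp 1 - 1\<close>.\<close>

lemma poisson_upper_tail:
  assumes n: "0 < n" and U [measurable]: "U \<in> sets borel"
  shows "{\<omega> \<in> space (ppp n). k \<le> card {i. i < fst \<omega> \<and> snd \<omega> i \<in> U}} \<in> sets (ppp n)"
    and "measure (ppp n) {\<omega> \<in> space (ppp n). k \<le> card {i. i < fst \<omega> \<and> snd \<omega> i \<in> U}}
      \<le> exp (2 * (real n * measure (unif n) U) - real k)"
proof -
  interpret prob_space "ppp n" by (rule prob_space_ppp[OF n])
  let ?c = "\<lambda>\<omega> :: nat \<times> (nat \<Rightarrow> real \<times> real). card {i. i < fst \<omega> \<and> snd \<omega> i \<in> U}"
  let ?S = "{\<omega> \<in> space (ppp n). k \<le> ?c \<omega>}" and ?p = "measure (unif n) U"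
  have cs: "card {i. i < N \<and> X i \<in> U} = (\<Sum>i<N. if X i \<in> U then 1 else 0)" for N and X :: "nat \<Rightarrow> real \<times> real"
    by (simp add: sum.If_cases lessThan_def Collect_conj_eq)
  show m: "?S \<in> sets (ppp n)"
  proof -
    have "Measurable.pred (ppp n) (\<lambda>\<omega>. k \<le> (\<Sum>i<fst \<omega>. if snd \<omega> i \<in> U then 1 else 0))"
      by (rule measurable_compose_countable[where g = fst]) measurable
    then show ?thesis unfolding cs by simp
  qed
  have "ennreal (exp (real k)) * emeasure (ppp n) ?S = (\<integral>\<^sup>+\<omega>. ennreal (exp (real k)) * indicator ?S \<omega> \<partial>ppp n)"
    using m by (simp add: nn_integral_cmult_indicator)
  also have "\<dots> \<le> (\<integral>\<^sup>+\<omega>. (\<Prod>i<fst \<omega>. ennreal (if snd \<omega> i \<in> U then exp 1 else 1)) \<partial>ppp n)"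
  proof (rule nn_integral_mono)
    fix \<omega> :: "nat \<times> (nat \<Rightarrow> real \<times> real)"
    have "(\<Prod>i<fst \<omega>. ennreal (if snd \<omega> i \<in> U then exp 1 else 1)) = ennreal (\<Prod>i<fst \<omega>. if snd \<omega> i \<in> U then exp 1 else 1)"
      by (rule prod_ennreal) auto
    also have "(\<Prod>i<fst \<omega>. if snd \<omega> i \<in> U then exp 1 else 1) = exp (\<Sum>i<fst \<omega>. if snd \<omega> i \<in> U then 1 else 0 :: real)"
      unfolding exp_sum[OF finite_lessThan] by (intro prod.cong) auto
    also have "(\<Sum>i<fst \<omega>. if snd \<omega> i \<in> U then 1 else 0 :: real) = real (?c \<omega>)"
      by (simp add: sum.If_cases lessThan_def Collect_conj_eq)
    finally have e: "(\<Prod>i<fst \<omega>. ennreal (if snd \<omega> i \<in> U then exp 1 else 1)) = ennreal (exp (real (?c \<omega>)))" .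
    show "ennreal (exp (real k)) * indicator ?S \<omega> \<le> (\<Prod>i<fst \<omega>. ennreal (if snd \<omega> i \<in> U then exp 1 else 1))"
      unfolding e by (auto simp: indicator_def intro!: ennreal_leI)
  qed
  also have "\<dots> = ennreal (exp (real n * (exp 1 * ?p + 1 * (1 - ?p) - 1)))"
    by (rule nn_integral_ppp_prod[OF n U]) auto
  finally have "exp (real k) * measure (ppp n) ?S \<le> exp (real n * (exp 1 * ?p + 1 * (1 - ?p) - 1))"
    unfolding emeasure_eq_measure by (simp add: ennreal_mult[symmetric])
  also have "\<dots> \<le> exp (2 * (real n * ?p))"
  proof -
    have "(exp 1 - 1) * ?p \<le> 2 * ?p" using exp_le by (intro mult_right_mono) auto
    then have "real n * ((exp 1 - 1) * ?p) \<le> real n * (2 * ?p)" by (intro mult_left_mono) auto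
    then show ?thesis by (simp add: algebra_simps)
  qed
  finally show "measure (ppp n) ?S \<le> exp (2 * (real n * ?p) - real k)"
    by (simp add: exp_diff field_simps)
qed

section \<open>Poisson counts in sets of cells\<close>

definition cell_region :: "nat \<Rightarrow> real \<Rightarrow> int \<Rightarrow> (int \<times> int) set \<Rightarrow> (real \<times> real) set" where
  "cell_region n s m T =
    {x. (\<lfloor>fst (scaled_pos n s x)\<rfloor> mod m, \<lfloor>snd (scaled_pos n s x)\<rfloor> mod m) \<in> T}"

definition cell_mod :: "int \<Rightarrow> int \<times> int \<Rightarrow> int \<times> int" where
  "cell_mod m g = (fst g mod m, snd g mod m)"

lemma in_cell_region:
  "in_cell m (scaled_pos n s x) g \<longleftrightarrow> x \<in> cell_region n s m {cell_mod m g}"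
proof -
  have e: "(\<exists>z. c = a + m * z) \<longleftrightarrow> a mod m = c mod m" for a c :: int
    unfolding mod_eq_dvd_iff dvd_def by (metis add_diff_cancel_left' diff_add_cancel add.commute minus_diff_eq mult_minus_right)
  show ?thesis unfolding in_cell_iff cell_region_def cell_mod_def
    using e[of "fst g"] e[of "snd g"] by (cases g) auto
qed

lemma cell_region_measurable [measurable]: "cell_region n s m T \<in> sets borel"
proof -
  have m1: "(\<lambda>x. fst (scaled_pos n s x)) \<in> borel_measurable borel"
    "(\<lambda>x. snd (scaled_pos n s x)) \<in> borel_measurable borel"
    unfolding scaled_pos_def fst_conv snd_conv divide_inverse
    by (auto intro!: borel_measurable_continuous_onI continuous_intros)
  have "{x. \<lfloor>fst (scaled_pos n s x)\<rfloor> = a \<and> \<lfloor>snd (scaled_pos n s x)\<rfloor> = b} \<in> sets borel" for a b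
  proof -
    have "Measurable.pred borel (\<lambda>x. \<lfloor>fst (scaled_pos n s x)\<rfloor> = a \<and> \<lfloor>snd (scaled_pos n s x)\<rfloor> = b)"
      using m1 by measurable
    then show ?thesis by simp
  qed
  then have "(\<Union>g\<in>{g. cell_mod m g \<in> T}. {x. \<lfloor>fst (scaled_pos n s x)\<rfloor> = fst g \<and> \<lfloor>snd (scaled_pos n s x)\<rfloor> = snd g}) \<in> sets borel"
    by (intro sets.countable_UN') auto
  moreover have "cell_region n s m T = (\<Union>g\<in>{g. cell_mod m g \<in> T}. {x. \<lfloor>fst (scaled_pos n s x)\<rfloor> = fst g \<and> \<lfloor>snd (scaled_pos n s x)\<rfloor> = snd g})"
    unfolding cell_region_def cell_mod_def by auto
  ultimately show ?thesis by simp
qed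

lemma measure_strip:
  assumes s: "0 < s" and m: "0 < m" and S: "S = s * of_int m" and a: "a \<in> {0..<m}"
  defines "I \<equiv> {x \<in> {- S / 2..S / 2}. \<lfloor>(x + S / 2) / s\<rfloor> mod m = a}"
  shows "I \<in> sets borel" "emeasure lborel I = ennreal s"
proof -
  let ?J = "{s * of_int a - S / 2..<s * of_int a + s - S / 2}"
  \<comment> \<open>At the right end of the closed interval the floor is \<open>m\<close>, which
    reduces to 0. So this endpoint falls into strip 0, without changing its length.\<close>
  have eq: "I = ?J \<union> (if a = 0 then {S / 2} else {})"
  proof (rule set_eqI)
    fix x
    define y where "y = (x + S / 2) / s"
    have x: "x = s * y - S / 2" using s by (simp add: y_def)
    have "x \<in> {- S / 2..S / 2} \<longleftrightarrow> 0 \<le> y \<and> y \<le> of_int m"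
      using s unfolding x S by (auto simp: zero_le_mult_iff)
    then have "x \<in> I \<longleftrightarrow> 0 \<le> y \<and> y \<le> of_int m \<and> \<lfloor>y\<rfloor> mod m = a"
      unfolding I_def mem_Collect_eq y_def[symmetric] by blast
    also have "\<dots> \<longleftrightarrow> \<lfloor>y\<rfloor> = a \<or> (a = 0 \<and> y = of_int m)"
    proof (cases "0 \<le> y \<and> y < of_int m")
      case True
      then have "\<lfloor>y\<rfloor> mod m = \<lfloor>y\<rfloor>" by (intro mod_pos_pos_trivial) (auto simp: floor_less_iff)
      then show ?thesis using True a by auto
    next
      case False
      then have "\<lfloor>y\<rfloor> \<noteq> a" using a by (auto simp: floor_eq_iff)
      moreover have "y = of_int m" if "0 \<le> y" "y \<le> of_int m" using False that by auto
      ultimately show ?thesis using m by auto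
    qed
    also have "\<lfloor>y\<rfloor> = a \<longleftrightarrow> x \<in> ?J"
    proof -
      have "\<lfloor>y\<rfloor> = a \<longleftrightarrow> of_int a \<le> y \<and> y < of_int a + 1" by (simp add: floor_eq_iff)
      also have "\<dots> \<longleftrightarrow> s * of_int a \<le> s * y \<and> s * y < s * (of_int a + 1)" using s by simp
      also have "\<dots> \<longleftrightarrow> x \<in> ?J" unfolding x by (auto simp: distrib_left)
      finally show ?thesis .
    qed
    also have "y = of_int m \<longleftrightarrow> x = S / 2" using s unfolding x S by auto
    finally show "x \<in> I \<longleftrightarrow> x \<in> ?J \<union> (if a = 0 then {S / 2} else {})" by auto
  qed
  show "I \<in> sets borel" unfolding eq by simp
  have J: "emeasure lborel ?J = ennreal s" using s by simp
  have "emeasure lborel I \<le> emeasure lborel ?J + emeasure lborel (if a = 0 then {S / 2} else {})"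
    unfolding eq by (rule emeasure_subadditive) auto
  moreover have "emeasure lborel (if a = 0 then {S / 2} else {}) = 0" by simp
  ultimately have "emeasure lborel I \<le> ennreal s" unfolding J by simp
  moreover have "emeasure lborel ?J \<le> emeasure lborel I" unfolding eq by (rule emeasure_mono) auto
  ultimately show "emeasure lborel I = ennreal s" unfolding J by (rule antisym)
qed

lemma measure_cell_region:
  assumes s: "0 < s" and m: "0 < m" and S: "side n = s * of_int m" and T: "T \<subseteq> grid m"
  shows "real n * measure (unif n) (cell_region n s m T) = real (card T) * s\<^sup>2"
proof -
  have "0 < side n" using s m S by simp
  then have n: "0 < n" by (simp add: side_def)
  interpret U: prob_space "unif n" by (rule prob_space_unif[OF n])
  have one: "real n * measure (unif n) (cell_region n s m {g}) = s\<^sup>2" if g: "g \<in> grid m" for g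
  proof -
    let ?I = "\<lambda>a. {x \<in> {- side n / 2..side n / 2}. \<lfloor>(x + side n / 2) / s\<rfloor> mod m = a}"
    have g': "fst g \<in> {0..<m}" "snd g \<in> {0..<m}" using g by auto
    have "torus_box n \<inter> cell_region n s m {g} = ?I (fst g) \<times> ?I (snd g)"
      unfolding torus_box_def cell_region_def scaled_pos_def by auto
    then have "emeasure lborel (torus_box n \<inter> cell_region n s m {g}) = ennreal s * ennreal s"
      using emeasure_lborel_Times[OF measure_strip(1)[OF s m S g'(1)] measure_strip(1)[OF s m S g'(2)]]
        measure_strip(2)[OF s m S g'(1)] measure_strip(2)[OF s m S g'(2)] by simp
    also have "\<dots> = ennreal (s\<^sup>2)" using s by (simp add: ennreal_mult power2_eq_square)
    finally have "measure lborel (torus_box n \<inter> cell_region n s m {g}) = s\<^sup>2" by (simp add: measure_def)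
    moreover have "measure lborel (torus_box n) = real n" using emeasure_torus_box by (simp add: measure_def)
    ultimately show ?thesis using n
      by (subst measure_uniform_measure) (auto simp: emeasure_torus_box)
  qed
  have finT: "finite T" using T by (rule finite_subset) simp
  have "cell_region n s m T = (\<Union>g\<in>T. cell_region n s m {g})" unfolding cell_region_def by auto
  moreover have "measure (unif n) (\<Union>g\<in>T. cell_region n s m {g}) = (\<Sum>g\<in>T. measure (unif n) (cell_region n s m {g}))"
  proof (rule U.finite_measure_finite_Union[OF finT])
    show "(\<lambda>g. cell_region n s m {g}) ` T \<subseteq> sets (unif n)" by auto
    show "disjoint_family_on (\<lambda>g. cell_region n s m {g}) T"
      unfolding disjoint_family_on_def cell_region_def by auto
  qed
  ultimately have "real n * measure (unif n) (cell_region n s m T) = (\<Sum>g\<in>T. real n * measure (unif n) (cell_region n s m {g}))"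
    by (simp add: sum_distrib_left)
  also have "\<dots> = (\<Sum>g\<in>T. s\<^sup>2)" by (rule sum.cong) (use one T in auto)
  finally show ?thesis by simp
qed

definition pts :: "nat \<Rightarrow> real \<Rightarrow> nat \<times> (nat \<Rightarrow> real \<times> real) \<Rightarrow> nat \<Rightarrow> real \<times> real" where
  "pts n s \<omega> i = scaled_pos n s (snd \<omega> i)"

lemma cell_region_image:
  "x \<in> cell_region n s m (cell_mod m ` T) \<longleftrightarrow> (\<exists>g\<in>T. x \<in> cell_region n s m {cell_mod m g})"
  unfolding cell_region_def by auto

lemma cell_mod_range: "0 < m \<Longrightarrow> cell_mod m ` T \<subseteq> grid m"
  unfolding cell_mod_def by auto

text \<open>Cells that differ modulo \<open>m\<close> are disjoint regions of the torus, so their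
  areas \<open>s\<^sup>2\<close> add up in the void probability.\<close>

lemma empty_cells_prob:
  assumes s: "0 < s" and m: "0 < m" and S: "side n = s * of_int m" and T: "inj_on (cell_mod m) T"
  defines "Q \<equiv> {\<omega> \<in> space (ppp n). \<forall>g\<in>T. \<not> occupied (fst \<omega>) (pts n s \<omega>) m g}"
  shows "Q \<in> sets (ppp n)" "measure (ppp n) Q = exp (- real (card T) * s\<^sup>2)"
proof -
  have "0 < side n" using s m S by simp
  then have n: "0 < n" by (simp add: side_def)
  let ?U = "cell_region n s m (cell_mod m ` T)"
  have Q: "Q = {\<omega> \<in> space (ppp n). \<forall>i<fst \<omega>. snd \<omega> i \<notin> ?U}"
    unfolding Q_def occupied_def pts_def in_cell_region cell_region_image by blast
  have "Measurable.pred (ppp n) (\<lambda>\<omega>. \<forall>i<fst \<omega>. snd \<omega> i \<notin> ?U)"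
    by (rule measurable_compose_countable[where g = fst]) measurable
  then show "Q \<in> sets (ppp n)" unfolding Q by simp
  have "measure (ppp n) Q = exp (- real n * measure (unif n) ?U)"
    unfolding Q by (rule void_probability[OF n]) simp
  also have "real n * measure (unif n) ?U = real (card T) * s\<^sup>2"
    using measure_cell_region[OF s m S cell_mod_range[OF m]] card_image[OF T] by simp
  then have "- real n * measure (unif n) ?U = - real (card T) * s\<^sup>2" by simp
  finally show "measure (ppp n) Q = exp (- real (card T) * s\<^sup>2)" .
qed

lemma crowded_cells_prob:
  fixes k :: nat
  assumes s: "0 < s" and m: "0 < m" and S: "side n = s * of_int m" and T: "inj_on (cell_mod m) T" "finite T"
  defines "Q \<equiv> {\<omega> \<in> space (ppp n). k \<le> (\<Sum>g\<in>T. cell_count (fst \<omega>) (pts n s \<omega>) m g)}"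
  shows "Q \<in> sets (ppp n)" "measure (ppp n) Q \<le> exp (2 * (real (card T) * s\<^sup>2) - real k)"
proof -
  have "0 < side n" using s m S by simp
  then have n: "0 < n" by (simp add: side_def)
  let ?U = "cell_region n s m (cell_mod m ` T)"
  have count: "(\<Sum>g\<in>T. cell_count (fst \<omega>) (pts n s \<omega>) m g) = card {i. i < fst \<omega> \<and> snd \<omega> i \<in> ?U}" for \<omega>
  proof -
    have "{i. i < fst \<omega> \<and> snd \<omega> i \<in> ?U} = (\<Union>g\<in>T. {i. i < fst \<omega> \<and> snd \<omega> i \<in> cell_region n s m {cell_mod m g}})"
      unfolding cell_region_image by auto
    also have "card \<dots> = (\<Sum>g\<in>T. card {i. i < fst \<omega> \<and> snd \<omega> i \<in> cell_region n s m {cell_mod m g}})"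
    proof (rule card_UN_disjoint[OF T(2)])
      show "\<forall>g\<in>T. \<forall>h\<in>T. g \<noteq> h \<longrightarrow> {i. i < fst \<omega> \<and> snd \<omega> i \<in> cell_region n s m {cell_mod m g}} \<inter>
          {i. i < fst \<omega> \<and> snd \<omega> i \<in> cell_region n s m {cell_mod m h}} = {}"
      proof (intro ballI impI)
        fix g h assume "g \<in> T" "h \<in> T" "g \<noteq> h"
        then have "cell_mod m g \<noteq> cell_mod m h" using T(1) by (meson inj_onD)
        then show "{i. i < fst \<omega> \<and> snd \<omega> i \<in> cell_region n s m {cell_mod m g}} \<inter>
          {i. i < fst \<omega> \<and> snd \<omega> i \<in> cell_region n s m {cell_mod m h}} = {}"
          unfolding cell_region_def by auto
      qed
    qed auto
    finally show ?thesis unfolding cell_count_def pts_def in_cell_region by simp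
  qed
  show "Q \<in> sets (ppp n)" unfolding Q_def count by (rule poisson_upper_tail(1)[OF n]) simp
  have "measure (ppp n) Q \<le> exp (2 * (real n * measure (unif n) ?U) - real k)"
    unfolding Q_def count by (rule poisson_upper_tail(2)[OF n]) simp
  then show "measure (ppp n) Q \<le> exp (2 * (real (card T) * s\<^sup>2) - real k)"
    using measure_cell_region[OF s m S cell_mod_range[OF m]] card_image[OF T(1)] by simp
qed

section \<open>Peierls estimate for paths with few occupied cells\<close>

lemma sum_Pow_card:
  fixes x :: real
  assumes "finite A"
  shows "(\<Sum>J\<in>Pow A. x ^ card J) = (1 + x) ^ card A"
  using assms
proof (induction A rule: finite_induct)
  case (insert a A)
  have "(\<Sum>J\<in>Pow (insert a A). x ^ card J) = (\<Sum>J\<in>Pow A. x ^ card J) + (\<Sum>J\<in>insert a ` Pow A. x ^ card J)"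
    unfolding Pow_insert using insert.hyps by (intro sum.union_disjoint) auto
  also have "(\<Sum>J\<in>insert a ` Pow A. x ^ card J) = (\<Sum>J\<in>Pow A. x ^ card (insert a J))"
    using insert.hyps by (intro sum.reindex[THEN trans]) (auto simp: inj_on_def)
  also have "\<dots> = (\<Sum>J\<in>Pow A. x * x ^ card J)"
  proof (rule sum.cong[OF refl])
    fix J assume "J \<in> Pow A"
    then have "a \<notin> J" "finite J" using insert.hyps finite_subset by auto
    then show "x ^ card (insert a J) = x * x ^ card J" by simp
  qed
  finally show ?case using insert by (simp add: sum_distrib_left[symmetric] distrib_right)
qed simp

text \<open>Weight every subset by \<open>x\<close> to the power of its size: those counted have
  weight at least \<open>x ^ k\<close>, and all weights add up to
  \<open>(1 + x) ^ card A\<close>.\<close>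

lemma card_small_subsets:
  assumes A: "finite A" and x: "0 < x" "x \<le> (1::real)"
  shows "real (card {J \<in> Pow A. card J \<le> k}) * x ^ k \<le> (1 + x) ^ card A"
proof -
  have "real (card {J \<in> Pow A. card J \<le> k}) * x ^ k = (\<Sum>J\<in>{J \<in> Pow A. card J \<le> k}. x ^ k)" by simp
  also have "\<dots> \<le> (\<Sum>J\<in>{J \<in> Pow A. card J \<le> k}. x ^ card J)"
    by (rule sum_mono) (use x in \<open>auto intro!: power_decreasing\<close>)
  also have "\<dots> \<le> (\<Sum>J\<in>Pow A. x ^ card J)" by (rule sum_mono2) (use A x in auto)
  finally show ?thesis by (simp add: sum_Pow_card[OF A])
qed

definition nb4_paths :: "nat \<Rightarrow> int \<times> int \<Rightarrow> (int \<times> int) list set" where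
  "nb4_paths k c = {p. length p = Suc k \<and> hd p = c \<and> successively nb4 p}"

lemma nb4_paths_card: "finite (nb4_paths k c) \<and> card (nb4_paths k c) \<le> 4 ^ k"
proof (induction k arbitrary: c)
  case 0
  have "nb4_paths 0 c = {[c]}" unfolding nb4_paths_def by (auto simp: length_Suc_conv)
  then show ?case by simp
next
  case (Suc k)
  define D where "D = {(fst c + 1, snd c), (fst c - 1, snd c), (fst c, snd c + 1), (fst c, snd c - 1)}"
  have D: "d \<in> D" if "nb4 c d" for d
    using that by (cases rule: nb4_cases) (auto simp: D_def)
  have sub: "nb4_paths (Suc k) c \<subseteq> (\<Union>d\<in>D. (#) c ` nb4_paths k d)"
  proof
    fix p assume "p \<in> nb4_paths (Suc k) c"
    then obtain q where q: "p = c # q" "length q = Suc k" "successively nb4 p"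
      unfolding nb4_paths_def by (cases p) auto
    then have "q \<noteq> []" by auto
    then have "nb4 c (hd q)" "successively nb4 q" using q by (auto simp: successively_Cons)
    then have "q \<in> nb4_paths k (hd q)" "hd q \<in> D" using q D by (auto simp: nb4_paths_def)
    then show "p \<in> (\<Union>d\<in>D. (#) c ` nb4_paths k d)" using q(1) by blast
  qed
  have finD: "finite D" "card D \<le> 4" unfolding D_def by (simp, rule order_trans[OF card_insert_le_m1]) (auto intro: card_insert_le_m1)
  have fin: "finite (\<Union>d\<in>D. (#) c ` nb4_paths k d)" using finD Suc by blast
  have "card (nb4_paths (Suc k) c) \<le> card (\<Union>d\<in>D. (#) c ` nb4_paths k d)" by (rule card_mono[OF fin sub])
  also have "\<dots> \<le> (\<Sum>d\<in>D. card ((#) c ` nb4_paths k d))" by (rule card_UN_le[OF finD(1)])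
  also have "\<dots> \<le> (\<Sum>d\<in>D. 4 ^ k)" by (rule sum_mono) (meson Suc card_image_le order_trans)
  also have "\<dots> \<le> 4 ^ Suc k" using finD(2) by simp
  finally show ?case using finite_subset[OF sub fin] by blast
qed

lemma cell_mod_inj:
  assumes "\<And>g h. g \<in> T \<Longrightarrow> h \<in> T \<Longrightarrow> \<bar>fst g - fst h\<bar> < m \<and> \<bar>snd g - snd h\<bar> < m"
  shows "inj_on (cell_mod m) T"
proof (rule inj_onI)
  fix g h assume gh: "g \<in> T" "h \<in> T" "cell_mod m g = cell_mod m h"
  then have "m dvd fst g - fst h" "m dvd snd g - snd h"
    by (simp_all add: cell_mod_def mod_eq_dvd_iff)
  then have "fst g = fst h" "snd g = snd h" using assms[OF gh(1,2)] dvd_diff_small by blast+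
  then show "g = h" by (simp add: prod_eq_iff)
qed

lemma occupied_cell_mod:
  "cell_mod m g = cell_mod m h \<Longrightarrow> occupied N (pts n s \<omega>) m g \<longleftrightarrow> occupied N (pts n s \<omega>) m h"
  unfolding occupied_def pts_def in_cell_region by simp

lemma cell_count_cell_mod:
  "cell_mod m g = cell_mod m h \<Longrightarrow> cell_count N (pts n s \<omega>) m g = cell_count N (pts n s \<omega>) m h"
  unfolding cell_count_def pts_def in_cell_region by simp

text \<open>The union bound for 100 cells of a path: 4 per step, and \<open>11 / 10\<close> per cell
  with one factor 10 for choosing at most one per cent of the positions. It has to stay below
  \<open>exp 176\<close>, where 176 is 99 times the least cell area 16/9.\<close>

lemma exp_numeric: "(4::real) ^ 100 * (11 / 10) ^ 100 * 10 \<le> exp 172"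
proof -
  have "(5 / 2 :: real) \<le> exp 1" using exp_lower_Taylor_quadratic[of 1] by simp
  then have "(5 / 2 :: real) ^ 172 \<le> exp 1 ^ 172" by (intro power_mono) auto
  also have "\<dots> = exp 172" by (simp add: exp_of_nat_mult[symmetric])
  finally show ?thesis by (rule order_trans[rotated]) (simp add: power_divide field_simps)
qed

text \<open>The bound \<open>4 / 3\<close> is a third of the smallest admissible radius.\<close>

locale cell_scale =
  fixes n kap ell :: nat and s :: real and M :: int
  assumes s_lower: "4 / 3 \<le> s" and kap_pos: "0 < kap" and ell_kap: "ell = 100 * kap"
    and ell_M: "int ell \<le> M" and side_eq: "side n = s * of_int (int ell * M)"
begin

abbreviation m :: int where "m \<equiv> int ell * M"

lemma s_pos: "0 < s" using s_lower by simp

lemma ell_m: "int ell < m" "0 < m"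
proof -
  have "int ell * 2 \<le> int ell * M" using kap_pos ell_kap ell_M by (intro mult_left_mono) auto
  then show "int ell < m" using kap_pos ell_kap by simp
  then show "0 < m" by linarith
qed

lemma n_pos: "0 < n"
proof -
  have "0 < side n" unfolding side_eq using s_pos ell_m by (metis mult_pos_pos of_int_0_less_iff)
  then show ?thesis by (simp add: side_def)
qed

lemma prob_space_n: "prob_space (ppp n)" by (rule prob_space_ppp[OF n_pos])

text \<open>A path is recorded together with a set of positions that may be occupied, all others
  being empty. Only starts within one period are listed, which keeps the union finite.\<close>

definition sparse_path_index :: "((int \<times> int) list \<times> nat set) set" where
  "sparse_path_index = {p \<in> (\<Union>c\<in>grid m. nb4_paths (ell - 1) c). distinct p} \<times>
    {J \<in> Pow {..<ell}. card J \<le> kap}"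

definition void_along :: "(int \<times> int) list \<times> nat set \<Rightarrow> (nat \<times> (nat \<Rightarrow> real \<times> real)) set" where
  "void_along q = {\<omega> \<in> space (ppp n). \<forall>g\<in>(!) (fst q) ` ({..<ell} - snd q). \<not> occupied (fst \<omega>) (pts n s \<omega>) m g}"

definition sparse_path_event :: "(nat \<times> (nat \<Rightarrow> real \<times> real)) set" where
  "sparse_path_event = (\<Union>q\<in>sparse_path_index. void_along q)"

text \<open>Occupation is periodic, so the path can be translated by multiples of \<open>m\<close>
  until it starts in \<open>grid m\<close>; \<open>J\<close> is then its set of occupied
  positions.\<close>

lemma many_occupied_off_event:
  assumes \<omega>: "\<omega> \<in> space (ppp n)" "\<omega> \<notin> sparse_path_event"
    and p: "distinct p" "successively nb4 p" "length p = ell"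
  shows "kap < card {g \<in> set p. occupied (fst \<omega>) (pts n s \<omega>) m g}"
proof (rule ccontr)
  assume few: "\<not> ?thesis"
  let ?occ = "occupied (fst \<omega>) (pts n s \<omega>) m"
  define c where "c = hd p"
  define f where "f g = (fst g - m * (fst c div m), snd g - m * (snd c div m))" for g :: "int \<times> int"
  have fm: "cell_mod m (f g) = cell_mod m g" for g
    unfolding f_def cell_mod_def by (simp add: mod_diff_right_eq[symmetric])
  have finj: "inj f" unfolding f_def inj_def by auto
  define q where "q = map f p"
  define J where "J = {i. i < ell \<and> ?occ (p ! i)}"
  have "p \<noteq> []" using p(3) kap_pos ell_kap by auto
  then have hq: "hd q = f c" by (simp add: q_def c_def hd_map)
  have "f c = cell_mod m c" unfolding f_def cell_mod_def by (simp add: minus_mult_div_eq_mod)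
  then have hc: "hd q \<in> grid m" unfolding hq using ell_m by (auto simp: cell_mod_def)
  have "successively nb4 q" unfolding q_def successively_map
    by (rule successively_mono[OF p(2)]) (auto simp: nb4_def f_def)
  then have "q \<in> nb4_paths (ell - 1) (hd q)"
    unfolding nb4_paths_def using p(3) kap_pos ell_kap by (simp add: q_def)
  with hc have "q \<in> (\<Union>c\<in>grid m. nb4_paths (ell - 1) c)" by (rule UN_I)
  moreover have "distinct q" unfolding q_def using p(1) inj_on_subset[OF finj subset_UNIV] by (simp add: distinct_map)
  ultimately have qm: "q \<in> {p \<in> (\<Union>c\<in>grid m. nb4_paths (ell - 1) c). distinct p}" by simp
  have "card J = card ((!) p ` J)"
    by (rule card_image[symmetric], rule inj_on_nth[OF p(1)]) (simp add: J_def p(3))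
  also have "(!) p ` J = {g \<in> set p. ?occ g}"
    unfolding J_def set_conv_nth p(3) by blast
  finally have "card J \<le> kap" using few by simp
  then have "(q, J) \<in> sparse_path_index"
    unfolding sparse_path_index_def using qm by (auto simp: J_def)
  moreover have "\<omega> \<in> void_along (q, J)"
  proof -
    have "\<not> ?occ (q ! i)" if "i < ell" "i \<notin> J" for i
    proof -
      have "q ! i = f (p ! i)" using that p(3) by (simp add: q_def)
      then have "?occ (q ! i) \<longleftrightarrow> ?occ (p ! i)" using occupied_cell_mod[OF fm] by metis
      then show ?thesis using that by (auto simp: J_def)
    qed
    then show ?thesis unfolding void_along_def using \<omega>(1) by auto
  qed
  ultimately show False using \<omega>(2) unfolding sparse_path_event_def by blast
qed

text \<open>A path of \<open>ell < m\<close> cells stays injective modulo \<open>m\<close>, so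
  leaving at least \<open>99 * kap\<close> of them empty has probability at most
  \<open>exp (- 176 * kap)\<close>. For each start there are at most \<open>exp (172 * kap)\<close>
  pairs of a path and a set of positions.\<close>

lemma sparse_path_prob:
  "sparse_path_event \<in> sets (ppp n)"
  "measure (ppp n) sparse_path_event \<le> (real_of_int m)\<^sup>2 * exp (- 4 * real kap)"
proof -
  let ?P = "{p \<in> (\<Union>c\<in>grid m. nb4_paths (ell - 1) c). distinct p}"
  let ?U = "\<Union>c\<in>grid m. nb4_paths (ell - 1) c"
  let ?J = "{J \<in> Pow {..<ell}. card J \<le> kap}"
  have finU: "finite ?U" using nb4_paths_card by blast
  have finI: "finite sparse_path_index" unfolding sparse_path_index_def using finU by simp
  have Q: "void_along q \<in> sets (ppp n) \<and> measure (ppp n) (void_along q) \<le> exp (- 176 * real kap)"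
    if q: "q \<in> sparse_path_index" for q
  proof -
    obtain p J where pJ: "q = (p, J)" "distinct p" "J \<subseteq> {..<ell}" "card J \<le> kap" "successively nb4 p" "length p = ell"
      using q kap_pos ell_kap unfolding sparse_path_index_def nb4_paths_def by auto
    let ?T = "(!) p ` ({..<ell} - J)"
    have "inj_on (cell_mod m) ?T"
    proof (rule cell_mod_inj)
      fix g h assume "g \<in> ?T" "h \<in> ?T"
      then obtain i j where ij: "i < ell" "j < ell" "g = p ! i" "h = p ! j" by auto
      have "\<bar>int i - int j\<bar> < m" using ij(1,2) ell_m(1) by linarith
      then show "\<bar>fst g - fst h\<bar> < m \<and> \<bar>snd g - snd h\<bar> < m"
        using path_displacement[OF pJ(5), of i j] ij pJ(6) by (auto intro: order_le_less_trans)
    qed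
    note V = empty_cells_prob[OF s_pos ell_m(2) side_eq this]
    have "inj_on ((!) p) ({..<ell} - J)" using pJ by (auto simp: inj_on_def nth_eq_iff_index_eq)
    then have "card ?T = ell - card J"
      using pJ(3) finite_subset[OF pJ(3)] by (simp add: card_image card_Diff_subset)
    then have "99 * real kap \<le> real (card ?T)" using pJ(4) ell_kap by simp
    then have "99 * real kap * (16 / 9) \<le> real (card ?T) * s\<^sup>2"
      using power_mono[OF s_lower, of 2] by (intro mult_mono) (auto simp: power2_eq_square)
    then have "exp (- real (card ?T) * s\<^sup>2) \<le> exp (- 176 * real kap)" by simp
    then show ?thesis using V unfolding void_along_def pJ(1) by simp
  qed
  show "sparse_path_event \<in> sets (ppp n)"
    unfolding sparse_path_event_def using Q finI by (intro sets.finite_UN) auto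
  have "measure (ppp n) sparse_path_event \<le> (\<Sum>q\<in>sparse_path_index. measure (ppp n) (void_along q))"
    unfolding sparse_path_event_def using Q finI by (intro measure_UNION_le) auto
  also have "\<dots> \<le> (\<Sum>q\<in>sparse_path_index. exp (- 176 * real kap))" by (rule sum_mono) (use Q in blast)
  also have "\<dots> = real (card sparse_path_index) * exp (- 176 * real kap)" by simp
  also have "\<dots> \<le> ((real_of_int m)\<^sup>2 * 4 ^ ell * ((11 / 10) ^ ell * 10 ^ kap)) * exp (- 176 * real kap)"
  proof (rule mult_right_mono)
    have "card ?P \<le> card ?U" using finU by (intro card_mono) auto
    also have "\<dots> \<le> (\<Sum>c\<in>grid m. card (nb4_paths (ell - 1) c))" by (rule card_UN_le) simp
    also have "\<dots> \<le> (\<Sum>c\<in>grid m. 4 ^ ell)"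
    proof (rule sum_mono)
      fix c
      have "card (nb4_paths (ell - 1) c) \<le> 4 ^ (ell - 1)" using nb4_paths_card by blast
      also have "\<dots> \<le> 4 ^ ell" by (intro power_increasing) auto
      finally show "card (nb4_paths (ell - 1) c) \<le> 4 ^ ell" .
    qed
    also have "\<dots> = nat m * nat m * 4 ^ ell" by (simp add: card_cartesian_product)
    finally have "real (card ?P) \<le> real (nat m * nat m * 4 ^ ell)" by (rule of_nat_mono)
    then have P: "real (card ?P) \<le> (real_of_int m)\<^sup>2 * 4 ^ ell" using ell_m(2) by (simp add: power2_eq_square)
    have "real (card ?J) * (1 / 10) ^ kap \<le> (1 + 1 / 10) ^ card {..<ell}"
      by (rule card_small_subsets) auto
    then have J: "real (card ?J) \<le> (11 / 10) ^ ell * 10 ^ kap" by (simp add: power_divide field_simps)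
    have "real (card sparse_path_index) = real (card ?P) * real (card ?J)"
      unfolding sparse_path_index_def by (simp add: card_cartesian_product)
    also have "\<dots> \<le> ((real_of_int m)\<^sup>2 * 4 ^ ell) * ((11 / 10) ^ ell * 10 ^ kap)"
      using P J by (intro mult_mono) auto
    finally show "real (card sparse_path_index) \<le> (real_of_int m)\<^sup>2 * 4 ^ ell * ((11 / 10) ^ ell * 10 ^ kap)" .
  qed simp
  also have "\<dots> = (real_of_int m)\<^sup>2 * ((4 ^ 100 * (11 / 10) ^ 100 * 10) ^ kap * exp (- 176 * real kap))"
    unfolding ell_kap power_mult power_mult_distrib by (simp only: mult_ac)
  also have "\<dots> \<le> (real_of_int m)\<^sup>2 * (exp 172 ^ kap * exp (- 176 * real kap))"
    using exp_numeric by (intro mult_left_mono mult_right_mono power_mono) auto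
  also have "exp 172 ^ kap * exp (- 176 * real kap) = exp (- 4 * real kap)"
    by (simp add: exp_of_nat_mult[symmetric] exp_add[symmetric])
  finally show "measure (ppp n) sparse_path_event \<le> (real_of_int m)\<^sup>2 * exp (- 4 * real kap)" .
qed

text \<open>Chosen so that the union bound over the sets of \<open>level_bound k\<close> cells of a window that hold at
  least \<open>k\<close> points each, with weight \<open>exp (- k / 2)\<close> per cell, is at most \<open>exp (- 4 * kap)\<close>.\<close>

definition level_bound :: "nat \<Rightarrow> nat" where
  "level_bound k = nat \<lceil>4 / real k * ((real ell)\<^sup>2 * exp (- real k / 2) + 4 * real kap)\<rceil>"

section \<open>Crowded cells and second moments over windows\<close>

text \<open>Only the total count in \<open>T\<close> is tested, because it is a Poisson variable
  with a direct tail bound. Levels stop at \<open>ell\<close> since off this event no cell of a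
  window reaches that level, provided that \<open>0 < k0 \<le> ell\<close>.\<close>

definition crowded_event :: "nat \<Rightarrow> (nat \<times> (nat \<Rightarrow> real \<times> real)) set" where
  "crowded_event k0 = (\<Union>wk\<in>grid m \<times> {k0..ell}.
     \<Union>T\<in>{T \<in> Pow (window (int ell) (fst wk)). card T = level_bound (snd wk)}.
       {\<omega> \<in> space (ppp n). snd wk * level_bound (snd wk) \<le> (\<Sum>g\<in>T. cell_count (fst \<omega>) (pts n s \<omega>) m g)})"

lemma finite_window: "finite (window l w)" "card (window l w) = nat l * nat l"
  by (simp_all add: window_def card_cartesian_product)

lemma crowded_prob:
  assumes k0: "0 < k0" "8 * s\<^sup>2 \<le> real k0"
  shows "crowded_event k0 \<in> sets (ppp n)"
    and "measure (ppp n) (crowded_event k0) \<le> (real_of_int m)\<^sup>2 * real ell * exp (- 4 * real kap)"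
proof -
  let ?I = "grid m \<times> {k0..ell}"
  let ?TT = "\<lambda>wk. {T \<in> Pow (window (int ell) (fst wk)). card T = level_bound (snd wk)}"
  let ?Q = "\<lambda>wk T. {\<omega> \<in> space (ppp n). snd wk * level_bound (snd wk) \<le> (\<Sum>g\<in>T. cell_count (fst \<omega>) (pts n s \<omega>) m g)}"
  have finTT: "finite (?TT wk)" for wk using finite_window by simp
  have inj: "inj_on (cell_mod m) T \<and> finite T" if "T \<subseteq> window (int ell) w" for T w
  proof
    show "inj_on (cell_mod m) T"
    proof (rule cell_mod_inj)
      fix g h assume "g \<in> T" "h \<in> T"
      then have "g \<in> window (int ell) w" "h \<in> window (int ell) w" using that by auto
      then have "\<bar>fst g - fst h\<bar> < int ell" "\<bar>snd g - snd h\<bar> < int ell" unfolding window_def by auto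
      then show "\<bar>fst g - fst h\<bar> < m \<and> \<bar>snd g - snd h\<bar> < m" using ell_m(1) by linarith
    qed
    show "finite T" using that finite_window finite_subset by blast
  qed
  have Qm: "?Q wk T \<in> sets (ppp n)" if "T \<in> ?TT wk" for T wk
    using crowded_cells_prob(1)[OF s_pos ell_m(2) side_eq] inj[of T "fst wk"] that by blast
  have R: "(\<Union>T\<in>?TT wk. ?Q wk T) \<in> sets (ppp n)" for wk using Qm finTT by (intro sets.finite_UN) auto
  show "crowded_event k0 \<in> sets (ppp n)"
    unfolding crowded_event_def by (rule sets.finite_UN[OF _ R]) simp
  have B: "measure (ppp n) (\<Union>T\<in>?TT wk. ?Q wk T) \<le> exp (- 4 * real kap)" if wk: "wk \<in> ?I" for wk
  proof -
    define k where "k = snd wk"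
    define a where "a = level_bound k"
    define x where "x = exp (- real k / 2)"
    have k: "k0 \<le> k" "0 < k" using wk k0 by (auto simp: k_def)
    have x: "0 < x" "x \<le> 1" by (auto simp: x_def)
    have "measure (ppp n) (\<Union>T\<in>?TT wk. ?Q wk T) \<le> (\<Sum>T\<in>?TT wk. measure (ppp n) (?Q wk T))"
      using Qm finTT by (intro measure_UNION_le) auto
    also have "\<dots> \<le> (\<Sum>T\<in>?TT wk. exp (2 * (real a * s\<^sup>2) - real (k * a)))"
    proof (rule sum_mono)
      fix T assume T: "T \<in> ?TT wk"
      then have "inj_on (cell_mod m) T" "finite T" "card T = a" using inj[of T "fst wk"] by (auto simp: a_def k_def)
      then show "measure (ppp n) (?Q wk T) \<le> exp (2 * (real a * s\<^sup>2) - real (k * a))"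
        using crowded_cells_prob(2)[OF s_pos ell_m(2) side_eq, of T "k * a"] unfolding k_def a_def by simp
    qed
    also have "\<dots> = real (card (?TT wk)) * exp (2 * (real a * s\<^sup>2) - real (k * a))" by simp
    also have "\<dots> \<le> (exp (x * (real ell)\<^sup>2) / x ^ a) * exp (2 * (real a * s\<^sup>2) - real (k * a))"
    proof (rule mult_right_mono)
      have "card (?TT wk) \<le> card {J \<in> Pow (window (int ell) (fst wk)). card J \<le> a}"
        using finite_window by (intro card_mono) (auto simp: a_def k_def)
      then have "real (card (?TT wk)) * x ^ a \<le> real (card {J \<in> Pow (window (int ell) (fst wk)). card J \<le> a}) * x ^ a"
        using x by (intro mult_right_mono) auto
      also have "\<dots> \<le> (1 + x) ^ card (window (int ell) (fst wk))"
        by (rule card_small_subsets) (use x finite_window in auto)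
      also have "\<dots> \<le> exp x ^ card (window (int ell) (fst wk))"
        using x by (intro power_mono exp_ge_add_one_self) auto
      also have "\<dots> = exp (x * (real ell)\<^sup>2)"
        by (simp add: finite_window exp_of_nat_mult[symmetric] power2_eq_square mult_ac)
      finally show "real (card (?TT wk)) \<le> exp (x * (real ell)\<^sup>2) / x ^ a" using x by (simp add: field_simps)
    qed simp
    also have "\<dots> = exp (x * (real ell)\<^sup>2 + real a * (real k / 2) + (2 * (real a * s\<^sup>2) - real (k * a)))"
    proof -
      have "x ^ a = exp (- (real a * (real k / 2)))" unfolding x_def by (simp add: exp_of_nat_mult[symmetric])
      then have "exp (x * (real ell)\<^sup>2) / x ^ a = exp (x * (real ell)\<^sup>2 + real a * (real k / 2))"
        by (simp only: exp_add exp_minus divide_inverse inverse_inverse_eq)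
      then show ?thesis by (simp only: exp_add)
    qed
    \<comment> \<open>Of the gain \<open>k * a\<close>, the choice of the set consumes one half, and
      the mean one quarter because \<open>8 * s\<^sup>2 \<le> k\<close>. By the definition of
      \<open>level_bound\<close>, the last quarter is at least
      \<open>x * ell\<^sup>2 + 4 * kap\<close>.\<close>
    also have "\<dots> \<le> exp (- 4 * real kap)"
    proof -
      have "4 / real k * ((real ell)\<^sup>2 * x + 4 * real kap) \<le> real a"
        unfolding a_def level_bound_def x_def by (rule real_nat_ceiling_ge)
      then have 1: "4 * (x * (real ell)\<^sup>2 + 4 * real kap) \<le> real a * real k" using k(2)
        by (simp add: pos_divide_le_eq mult.commute[of x])
      have "8 * s\<^sup>2 \<le> real k" using k0(2) k(1) by linarith
      then have "real a * (8 * s\<^sup>2) \<le> real a * real k" by (intro mult_left_mono) auto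
      then have "8 * (real a * s\<^sup>2) \<le> real a * real k" by (simp add: mult_ac)
      with 1 have "x * (real ell)\<^sup>2 + real a * (real k / 2) + (2 * (real a * s\<^sup>2) - real (k * a)) \<le> - 4 * real kap"
        by (simp add: mult.commute[of "real k"] del: mult_le_cancel_left)
      then show ?thesis by simp
    qed
    finally show ?thesis .
  qed
  have "measure (ppp n) (crowded_event k0) \<le> (\<Sum>wk\<in>?I. measure (ppp n) (\<Union>T\<in>?TT wk. ?Q wk T))"
    unfolding crowded_event_def by (rule measure_UNION_le[OF _ R]) simp
  also have "\<dots> \<le> (\<Sum>wk\<in>?I. exp (- 4 * real kap))" by (rule sum_mono) (use B in blast)
  also have "\<dots> = real (card ?I) * exp (- 4 * real kap)" by simp
  also have "\<dots> \<le> ((real_of_int m)\<^sup>2 * real ell) * exp (- 4 * real kap)"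
  proof (rule mult_right_mono)
    have "card {k0..ell} \<le> ell" using k0 by simp
    then have "real (card {k0..ell}) \<le> real ell" by simp
    then have "real (nat m) * real (nat m) * real (card {k0..ell}) \<le> real (nat m) * real (nat m) * real ell"
      by (intro mult_left_mono) auto
    then show "real (card ?I) \<le> (real_of_int m)\<^sup>2 * real ell"
      using ell_m(2) by (simp add: card_cartesian_product power2_eq_square)
  qed simp
  finally show "measure (ppp n) (crowded_event k0) \<le> (real_of_int m)\<^sup>2 * real ell * exp (- 4 * real kap)" .
qed

end

text \<open>Layer-cake summation: a square is at most the sum of \<open>2 * k\<close> over the
  levels \<open>k\<close> up to its root.\<close>

lemma sum_squares_le_levels:
  fixes c :: "'a \<Rightarrow> nat"
  assumes W: "finite W" and c: "\<And>g. g \<in> W \<Longrightarrow> c g \<le> N"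
  shows "(\<Sum>g\<in>W. (real (c g))\<^sup>2) \<le> (\<Sum>k=1..N. 2 * real k * real (card {g \<in> W. k \<le> c g}))"
proof -
  have sq: "(real x)\<^sup>2 \<le> (\<Sum>k=1..x. 2 * real k)" for x
    by (induction x) (auto simp: power2_eq_square algebra_simps)
  have "(\<Sum>g\<in>W. (real (c g))\<^sup>2) \<le> (\<Sum>g\<in>W. \<Sum>k=1..N. if k \<le> c g then 2 * real k else 0)"
  proof (rule sum_mono)
    fix g assume "g \<in> W"
    have "(\<Sum>k=1..N. if k \<le> c g then 2 * real k else 0) = (\<Sum>k\<in>{1..N} \<inter> {k. k \<le> c g}. 2 * real k)"
      by (simp add: sum.If_cases)
    also have "{1..N} \<inter> {k. k \<le> c g} = {1..c g}" using c[OF \<open>g \<in> W\<close>] by auto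
    finally show "(real (c g))\<^sup>2 \<le> (\<Sum>k=1..N. if k \<le> c g then 2 * real k else 0)" using sq by simp
  qed
  also have "\<dots> = (\<Sum>k=1..N. \<Sum>g\<in>W. if k \<le> c g then 2 * real k else 0)" by (rule sum.swap)
  also have "\<dots> = (\<Sum>k=1..N. 2 * real k * real (card {g \<in> W. k \<le> c g}))"
    using W by (intro sum.cong) (auto simp: sum.If_cases Int_def)
  finally show ?thesis .
qed

lemma exp_half_sum: "(\<Sum>k=1..N. exp (- real k / 2)) \<le> 3"
proof -
  define x :: real where "x = exp (- 1 / 2)"
  have "3 / 2 \<le> exp (1 / 2 :: real)" using exp_ge_add_one_self[of "1 / 2 :: real"] by simp
  moreover have "x * exp (1 / 2) = 1" unfolding x_def by (simp add: exp_add[symmetric])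
  ultimately have "x * (3 / 2) \<le> 1" by (metis mult_left_mono exp_ge_zero x_def)
  then have x: "0 \<le> x" "x \<le> 3 / 4" by (auto simp: x_def)
  have e: "exp (- real k / 2) = x ^ k" for k unfolding x_def by (simp add: exp_of_nat_mult[symmetric])
  have "(\<Sum>k=1..N. x ^ k) \<le> 3 - 3 * x ^ N"
  proof (induction N)
    case (Suc N)
    have "4 * (x * x ^ N) \<le> 3 * x ^ N" using x mult_right_mono[of x "3 / 4" "x ^ N"] by simp
    then show ?case using Suc by simp
  qed simp
  moreover have "0 \<le> x ^ N" using x by simp
  ultimately show ?thesis unfolding e by linarith
qed

context cell_scale
begin

text \<open>Sum over levels. Below \<open>k0\<close> all \<open>ell\<^sup>2\<close> cells are
  counted; from \<open>k0\<close> on fewer than \<open>y k\<close> cells reach level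
  \<open>k\<close>. Here \<open>2 * k * y k\<close> is a summable term plus \<open>32 * kap\<close>,
  and \<open>ell\<close> levels of the latter give less than \<open>ell\<^sup>2\<close> because
  \<open>ell = 100 * kap\<close>.\<close>

lemma window_bound_base:
  assumes \<omega>: "\<omega> \<in> space (ppp n)" "\<omega> \<notin> crowded_event k0" and k0: "0 < k0" "k0 \<le> ell"
    and w: "w \<in> grid m"
  shows "(\<Sum>g\<in>window (int ell) w. (real (cell_count (fst \<omega>) (pts n s \<omega>) m g))\<^sup>2)
    \<le> (2 * (real k0)\<^sup>2 + 25) * (real ell)\<^sup>2"
proof -
  let ?W = "window (int ell) w" and ?c = "cell_count (fst \<omega>) (pts n s \<omega>) m"
  define t where "t k = card {g \<in> ?W. k \<le> ?c g}" for k
  define y where "y k = 4 / real k * ((real ell)\<^sup>2 * exp (- real k / 2) + 4 * real kap)" for k :: nat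
  have finW: "finite ?W" and cW: "card ?W = ell * ell" using finite_window by simp_all
  have t_le: "real (t k) \<le> (real ell)\<^sup>2" for k
  proof -
    have "t k \<le> card ?W" unfolding t_def using finW by (intro card_mono) auto
    then have "real (t k) \<le> real (ell * ell)" unfolding cW by (rule of_nat_mono)
    then show ?thesis by (simp add: power2_eq_square)
  qed
  have ell_ge: "100 \<le> real ell" using kap_pos ell_kap by simp
  have lt: "real (t k) < y k" if k: "k \<in> {k0..ell}" for k
  proof (rule ccontr)
    assume "\<not> real (t k) < y k"
    then have "level_bound k \<le> t k"
      unfolding level_bound_def y_def by (simp add: ceiling_le_iff nat_le_iff)
    then obtain T where T: "T \<subseteq> {g \<in> ?W. k \<le> ?c g}" "card T = level_bound k" "finite T"
      unfolding t_def by (rule obtain_subset_with_card_n)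
    have "(\<Sum>g\<in>T. k) \<le> (\<Sum>g\<in>T. ?c g)" by (rule sum_mono) (use T in auto)
    then have le: "k * level_bound k \<le> (\<Sum>g\<in>T. ?c g)" using T(2) by (simp add: mult.commute)
    have idx: "(w, k) \<in> grid m \<times> {k0..ell}" using w k by simp
    have Tin: "T \<in> {T \<in> Pow (window (int ell) (fst (w, k))). card T = level_bound (snd (w, k))}"
      using T by auto
    have "\<omega> \<in> crowded_event k0"
      unfolding crowded_event_def by (rule UN_I[OF idx], rule UN_I[OF Tin]) (use \<omega>(1) le in simp)
    then show False using \<omega>(2) by simp
  qed
  \<comment> \<open>Fewer than one cell reaches level \<open>ell\<close>, so none does; this cuts
    the level sum off at \<open>ell\<close>.\<close>
  have "y ell < 1"
  proof -
    have "1 + real ell / 2 + (real ell / 2)\<^sup>2 / 2 \<le> exp (real ell / 2)"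
      by (rule exp_lower_Taylor_quadratic) simp
    moreover have "(real ell / 2)\<^sup>2 / 2 = (real ell)\<^sup>2 / 8" by (simp add: power2_eq_square)
    ultimately have "(real ell)\<^sup>2 \<le> 8 * exp (real ell / 2)" using ell_ge by linarith
    then have "(real ell)\<^sup>2 * exp (- real ell / 2) \<le> 8 * exp (real ell / 2) * exp (- real ell / 2)"
      by (intro mult_right_mono) auto
    also have "\<dots> = 8" by (simp add: exp_add[symmetric])
    finally have "(real ell)\<^sup>2 * exp (- real ell / 2) \<le> 8" .
    then have "(real ell)\<^sup>2 * exp (- real ell / 2) + 4 * real kap \<le> 8 + real ell / 25" using ell_kap by simp
    also have "\<dots> < real ell / 4" using ell_ge by simp
    finally show ?thesis unfolding y_def using ell_ge by (simp add: pos_divide_less_eq)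
  qed
  then have "t ell = 0" using lt[of ell] k0 by auto
  then have none: "{g \<in> ?W. ell \<le> ?c g} = {}" unfolding t_def
    using card_0_eq[OF finite_subset[OF _ finW], of "{g \<in> ?W. ell \<le> ?c g}"] by blast
  have c_le: "?c g \<le> ell" if g: "g \<in> ?W" for g
  proof (rule ccontr)
    assume "\<not> ?c g \<le> ell"
    then have "g \<in> {g \<in> ?W. ell \<le> ?c g}" using g by simp
    then show False using none by simp
  qed
  have "(\<Sum>g\<in>?W. (real (?c g))\<^sup>2) \<le> (\<Sum>k=1..ell. 2 * real k * real (t k))"
    unfolding t_def by (rule sum_squares_le_levels[OF finW c_le])
  also have "\<dots> \<le> (\<Sum>k=1..ell. (if k < k0 then 2 * real k0 * (real ell)\<^sup>2 else 0) +
      (8 * (real ell)\<^sup>2 * exp (- real k / 2) + 32 * real kap))"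
  proof (rule sum_mono)
    fix k assume k: "k \<in> {1..ell}"
    show "2 * real k * real (t k) \<le> (if k < k0 then 2 * real k0 * (real ell)\<^sup>2 else 0) +
      (8 * (real ell)\<^sup>2 * exp (- real k / 2) + 32 * real kap)"
    proof (cases "k < k0")
      case True
      then have "2 * real k * real (t k) \<le> 2 * real k0 * (real ell)\<^sup>2"
        using t_le by (intro mult_mono) auto
      moreover have "0 \<le> 8 * (real ell)\<^sup>2 * exp (- real k / 2) + 32 * real kap" by simp
      ultimately show ?thesis unfolding if_P[OF True] by linarith
    next
      case False
      then have "real (t k) < y k" using lt k by simp
      then have "2 * real k * real (t k) \<le> 2 * real k * y k" by (intro mult_left_mono) auto
      also have "\<dots> = 8 * (real ell)\<^sup>2 * exp (- real k / 2) + 32 * real kap"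
        using k unfolding y_def by (simp add: distrib_left)
      finally show ?thesis unfolding if_not_P[OF False] by linarith
    qed
  qed
  also have "\<dots> = (\<Sum>k=1..ell. if k < k0 then 2 * real k0 * (real ell)\<^sup>2 else 0)
      + 8 * (real ell)\<^sup>2 * (\<Sum>k=1..ell. exp (- real k / 2)) + 32 * real kap * real ell"
    by (simp add: sum.distrib sum_distrib_left)
  also have "\<dots> \<le> 2 * (real k0)\<^sup>2 * (real ell)\<^sup>2 + 24 * (real ell)\<^sup>2 + (real ell)\<^sup>2"
  proof (intro add_mono)
    have "(\<Sum>k=1..ell. if k < k0 then 2 * real k0 * (real ell)\<^sup>2 else 0)
        = real (card ({1..ell} \<inter> {k. k < k0})) * (2 * real k0 * (real ell)\<^sup>2)"
      by (simp add: sum.If_cases)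
    also have "\<dots> \<le> real k0 * (2 * real k0 * (real ell)\<^sup>2)"
    proof (intro mult_right_mono)
      have "card ({1..ell} \<inter> {k. k < k0}) \<le> card {..<k0}" by (intro card_mono) auto
      then show "real (card ({1..ell} \<inter> {k. k < k0})) \<le> real k0" by simp
    qed simp
    finally show "(\<Sum>k=1..ell. if k < k0 then 2 * real k0 * (real ell)\<^sup>2 else 0) \<le> 2 * (real k0)\<^sup>2 * (real ell)\<^sup>2"
      by (simp add: power2_eq_square mult_ac)
    have "8 * (real ell)\<^sup>2 * (\<Sum>k=1..ell. exp (- real k / 2)) \<le> 8 * (real ell)\<^sup>2 * 3"
      using exp_half_sum by (intro mult_left_mono) auto
    then show "8 * (real ell)\<^sup>2 * (\<Sum>k=1..ell. exp (- real k / 2)) \<le> 24 * (real ell)\<^sup>2" by simp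
    show "32 * real kap * real ell \<le> (real ell)\<^sup>2" unfolding ell_kap by (simp add: power2_eq_square)
  qed
  finally show ?thesis by (simp add: algebra_simps)
qed

lemma window_bound_off_event:
  assumes \<omega>: "\<omega> \<in> space (ppp n)" "\<omega> \<notin> crowded_event k0" and k0: "0 < k0" "k0 \<le> ell"
  shows "(\<Sum>g\<in>window (int ell) w. (real (cell_count (fst \<omega>) (pts n s \<omega>) m g))\<^sup>2)
    \<le> (2 * (real k0)\<^sup>2 + 25) * (real ell)\<^sup>2"
proof -
  let ?c = "cell_count (fst \<omega>) (pts n s \<omega>) m"
  define a where "a = m * (fst w div m)"
  define b where "b = m * (snd w div m)"
  have "(\<Sum>g\<in>window (int ell) w. (real (?c g))\<^sup>2) = (\<Sum>g\<in>window (int ell) (cell_mod m w). (real (?c g))\<^sup>2)"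
  proof (rule sum.reindex_bij_witness[where j = "\<lambda>g. (fst g - a, snd g - b)" and i = "\<lambda>g. (fst g + a, snd g + b)"])
    fix g
    have cw: "cell_mod m w = (fst w - a, snd w - b)"
      unfolding cell_mod_def a_def b_def by (simp add: minus_mult_div_eq_mod)
    show "(fst g - a, snd g - b) \<in> window (int ell) (cell_mod m w)" if "g \<in> window (int ell) w"
      using that unfolding window_def cw by auto
    show "(fst g + a, snd g + b) \<in> window (int ell) w" if "g \<in> window (int ell) (cell_mod m w)"
      using that unfolding window_def cw by auto
    have "cell_mod m (fst g - a, snd g - b) = cell_mod m g"
      unfolding cell_mod_def a_def b_def by (simp add: mod_diff_right_eq[symmetric])
    then show "(real (?c (fst g - a, snd g - b)))\<^sup>2 = (real (?c g))\<^sup>2" using cell_count_cell_mod by metis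
  qed auto
  also have "\<dots> \<le> (2 * (real k0)\<^sup>2 + 25) * (real ell)\<^sup>2"
    by (rule window_bound_base[OF \<omega> k0]) (use ell_m in \<open>auto simp: cell_mod_def\<close>)
  finally show ?thesis .
qed

lemma edge_boundary_off_events:
  assumes r: "s \<le> 35 / 100 * r" "r \<le> 3 * s" and k0: "0 < k0" "k0 \<le> ell"
    and \<omega>: "\<omega> \<in> space (ppp n)" "\<omega> \<notin> sparse_path_event" "\<omega> \<notin> crowded_event k0"
    and L: "largest_component n r \<omega> L"
  defines "K0 \<equiv> 2 * (real k0)\<^sup>2 + 25"
  shows "(real_of_int m)\<^sup>2 \<le> 900 * real (sdeg n r \<omega> L)"
    and "A \<subseteq> L \<Longrightarrow> induces_connected n r \<omega> A \<Longrightarrow> stat n r \<omega> L A \<le> 1 / 2 \<Longrightarrow>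
      441 * K0 * (real ell)\<^sup>2 < real (sdeg n r \<omega> A) \<Longrightarrow>
      sqrt (real (sdeg n r \<omega> A)) / (20000000 * (49 * K0)\<^sup>2) \<le> real (edges_between n r \<omega> A (L - A))"
proof -
  \<comment> \<open>The inverse of 0.35 is \<open>20 / 7\<close>, just above
    \<open>2 * sqrt 2\<close>; this is the origin of 0.35.\<close>
  have "sqrt 2 \<le> 10 / 7" by (rule real_le_lsqrt) (auto simp: power2_eq_square)
  moreover have "20 / 7 \<le> r / s" using r(1) s_pos by (simp add: field_simps)
  ultimately have R1: "2 * sqrt 2 \<le> r / s" by linarith
  have R2: "r / s \<le> 3" using r(2) s_pos by (simp add: field_simps)
  interpret T: torus_points "fst \<omega>" "pts n s \<omega>" "r / s" kap ell M K0
  proof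
    show "1 \<le> K0" unfolding K0_def by simp
    show "kap < card {g \<in> set p. occupied (fst \<omega>) (pts n s \<omega>) m g}"
      if "distinct p" "successively nb4 p" "length p = ell" for p
      using many_occupied_off_event[OF \<omega>(1,2) that] .
    show "(\<Sum>g\<in>window (int ell) w. (real (cell_count (fst \<omega>) (pts n s \<omega>) m g))\<^sup>2) \<le> K0 * (real ell)\<^sup>2" for w
      unfolding K0_def by (rule window_bound_off_event[OF \<omega>(1,3) k0])
  qed (fact R1 R2 kap_pos ell_kap ell_M)+
  have adj: "adj n r \<omega> i j = T.E i j" for i j
    unfolding adj_def T.E_def verts_def torus_dist_le_iff[OF s_pos ell_m(2) side_eq] pts_def by auto
  have "(real_of_int M)\<^sup>2 * (real ell)\<^sup>2 \<le> 900 * real (sdeg n r \<omega> L)"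
    by (rule T.edge_boundary_lower_bound(1)[OF adj refl L])
  then show "(real_of_int m)\<^sup>2 \<le> 900 * real (sdeg n r \<omega> L)"
    by (simp add: power_mult_distrib mult.commute)
  show "A \<subseteq> L \<Longrightarrow> induces_connected n r \<omega> A \<Longrightarrow> stat n r \<omega> L A \<le> 1 / 2 \<Longrightarrow>
      441 * K0 * (real ell)\<^sup>2 < real (sdeg n r \<omega> A) \<Longrightarrow>
      sqrt (real (sdeg n r \<omega> A)) / (20000000 * (49 * K0)\<^sup>2) \<le> real (edges_between n r \<omega> A (L - A))"
    by (rule T.edge_boundary_lower_bound(2)[OF adj refl L])
qed

end

section \<open>Measurability of graph events\<close>

text \<open>The number of vertices together with the adjacency relation takes countably many values,
  each on a measurable set, so an event determined by them is a countable union. This disposes of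
  the quantifiers over \<open>L\<close> and \<open>A\<close> in the theorem.\<close>

lemma graph_event_measurable:
  assumes inv: "\<And>\<omega> \<omega>'. fst \<omega> = fst \<omega>' \<Longrightarrow> adj n r \<omega> = adj n r \<omega>' \<Longrightarrow> \<Phi> \<omega> = \<Phi> \<omega>'"
  shows "{\<omega> \<in> space (ppp n). \<Phi> \<omega>} \<in> sets (ppp n)"
proof -
  have adj_meas [measurable]: "Measurable.pred (ppp n) (\<lambda>\<omega>. adj n r \<omega> i j)" for i j
  proof -
    have "fst \<in> borel_measurable (borel :: (real \<times> real) measure)"
      "snd \<in> borel_measurable (borel :: (real \<times> real) measure)"
      by (auto intro!: borel_measurable_continuous_onI continuous_intros)
    then have c [measurable]: "(\<lambda>\<omega>. fst (snd \<omega> k)) \<in> borel_measurable (ppp n)"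
      "(\<lambda>\<omega>. snd (snd \<omega> k)) \<in> borel_measurable (ppp n)" for k
      using measurable_compose[OF point_ppp_measurable] by blast+
    show ?thesis
      unfolding adj_def verts_def torus_dist_def per_dist_def round_def lessThan_iff by measurable
  qed
  define H where "H N F = {\<omega> \<in> space (ppp n). fst \<omega> = N \<and> (\<forall>i<N. \<forall>j<N. adj n r \<omega> i j = ((i, j) \<in> F))}" for N F
  have H: "H N F \<in> sets (ppp n)" for N F
  proof -
    have "Measurable.pred (ppp n) (\<lambda>\<omega>. fst \<omega> = N \<and> (\<forall>i<N. \<forall>j<N. adj n r \<omega> i j = ((i, j) \<in> F)))"
      by measurable
    then show ?thesis unfolding H_def by simp
  qed
  define I where "I = {(N, F). F \<subseteq> {..<N} \<times> {..<N} \<and> (\<exists>\<omega>\<in>H N F. \<Phi> \<omega>)}"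
  have "countable (SIGMA N : (UNIV :: nat set). Pow ({..<N} \<times> {..<N}))"
    by (rule countable_SIGMA) (auto intro!: countable_finite)
  moreover have "I \<subseteq> (SIGMA N : UNIV. Pow ({..<N} \<times> {..<N}))" unfolding I_def by auto
  ultimately have "countable I" using countable_subset by blast
  then have "(\<Union>p\<in>I. H (fst p) (snd p)) \<in> sets (ppp n)" using H by (intro sets.countable_UN') auto
  moreover have "{\<omega> \<in> space (ppp n). \<Phi> \<omega>} = (\<Union>p\<in>I. H (fst p) (snd p))"
  proof (intro set_eqI iffI)
    fix \<omega> assume a: "\<omega> \<in> {\<omega> \<in> space (ppp n). \<Phi> \<omega>}"
    let ?F = "{(i, j). adj n r \<omega> i j}"
    have "?F \<subseteq> {..<fst \<omega>} \<times> {..<fst \<omega>}" by (auto simp: adj_def verts_def)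
    moreover have "\<omega> \<in> H (fst \<omega>) ?F" using a by (simp add: H_def)
    ultimately have "(fst \<omega>, ?F) \<in> I" unfolding I_def using a by blast
    then show "\<omega> \<in> (\<Union>p\<in>I. H (fst p) (snd p))" using \<open>\<omega> \<in> H (fst \<omega>) ?F\<close> by force
  next
    fix \<omega> assume "\<omega> \<in> (\<Union>p\<in>I. H (fst p) (snd p))"
    then obtain N F where NF: "(N, F) \<in> I" "\<omega> \<in> H N F" by force
    then obtain \<omega>' where \<omega>': "\<omega>' \<in> H N F" "\<Phi> \<omega>'" unfolding I_def by blast
    have eq: "fst \<omega> = fst \<omega>'" using NF \<omega>' by (simp add: H_def)
    have "adj n r \<omega> i j = adj n r \<omega>' i j" for i j
    proof (cases "i < N \<and> j < N")
      case True
      then show ?thesis using NF(2) \<omega>'(1) by (simp add: H_def)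
    next
      case False
      moreover have "fst \<omega> = N" "fst \<omega>' = N" using NF \<omega>' by (simp_all add: H_def)
      ultimately show ?thesis by (auto simp: adj_def verts_def)
    qed
    then have "adj n r \<omega> = adj n r \<omega>'" by blast
    then show "\<omega> \<in> {\<omega> \<in> space (ppp n). \<Phi> \<omega>}" using inv[OF eq] \<omega>'(2) NF(2) by (simp add: H_def)
  qed
  ultimately show ?thesis by simp
qed

section \<open>Choice of the scales and conclusion\<close>

theorem proposition5p2:
  fixes r_min r_max :: real and r :: "nat \<Rightarrow> real"
  assumes "4 \<le> r_min" and "r_min \<le> r_max"
    and "\<And>n. r_min \<le> r n \<and> r n \<le> r_max"
  shows "\<exists>C c. C > 0 \<and> c > 0 \<and>
    ((\<lambda>n. measure (ppp n) {\<omega> \<in> space (ppp n).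
        \<forall>L. largest_component n (r n) \<omega> L \<longrightarrow>
          (\<forall>A. A \<subseteq> L \<and> induces_connected n (r n) \<omega> A \<and>
               stat n (r n) \<omega> L A \<le> 1/2 \<and>
               C * (ln (real n))\<^sup>2 / real n \<le> stat n (r n) \<omega> L A \<longrightarrow>
               c * sqrt (real (sdeg n (r n) \<omega> A)) \<le> real (edges_between n (r n) \<omega> A (L - A)))})
     \<longlonglongrightarrow> 1)"
proof -
  \<comment> \<open>The cell side \<open>s\<close> will be at most \<open>r_max\<close>, so
    \<open>8 * s\<^sup>2 \<le> k0\<close> as \<open>crowded_prob\<close> demands.\<close>
  define k0 where "k0 = nat \<lceil>8 * r_max\<^sup>2\<rceil> + 1"
  define K0 where "K0 = 2 * (real k0)\<^sup>2 + 25"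
  \<comment> \<open>The degree of \<open>L\<close> is at least
    \<open>n / (900 * r_max\<^sup>2)\<close>, and that of \<open>A\<close> has to exceed
    \<open>441 * K0 * ell\<^sup>2\<close> with \<open>ell \<le> 200 * ln n\<close>. The factor 2
    makes the inequality strict.\<close>
  define C where "C = 900 * 441 * 40000 * 2 * K0 * r_max\<^sup>2"
  define c where "c = 1 / (20000000 * (49 * K0)\<^sup>2)"
  define ok where "ok n \<omega> \<longleftrightarrow> (\<forall>L. largest_component n (r n) \<omega> L \<longrightarrow>
          (\<forall>A. A \<subseteq> L \<and> induces_connected n (r n) \<omega> A \<and>
               stat n (r n) \<omega> L A \<le> 1/2 \<and>
               C * (ln (real n))\<^sup>2 / real n \<le> stat n (r n) \<omega> L A \<longrightarrow>
               c * sqrt (real (sdeg n (r n) \<omega> A)) \<le> real (edges_between n (r n) \<omega> A (L - A))))" for n \<omega>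
  define ev where "ev n = {\<omega> \<in> space (ppp n). ok n \<omega>}" for n
  \<comment> \<open>There are at most \<open>n\<close> cells, the two union bounds give
    \<open>(1 + ell) * exp (- 4 * kap)\<close> per cell, and \<open>ell \<le> 200 * ln n\<close>,
    \<open>ln n \<le> kap\<close>.\<close>
  define err where "err n = real n * (1 + 200 * ln (real n)) * exp (- 4 * ln (real n))" for n
  have rmax: "4 \<le> r_max" using assms by simp
  have rr: "4 \<le> r n" "r n \<le> r_max" for n using assms(1) assms(3)[of n] by linarith+
  have K0: "25 \<le> K0" by (simp add: K0_def)
  have C_pos: "0 < C" using K0 rmax by (simp add: C_def)
  have c_pos: "0 < c" using K0 by (simp add: c_def)
  have ev_meas: "ev n \<in> sets (ppp n)" for n
    unfolding ev_def
  proof (rule graph_event_measurable[where r = "r n"])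
    fix \<omega> \<omega>' :: "nat \<times> (nat \<Rightarrow> real \<times> real)"
    assume eq: "fst \<omega> = fst \<omega>'" "adj n (r n) \<omega> = adj n (r n) \<omega>'"
    have "verts \<omega> = verts \<omega>'" using eq(1) by (simp add: verts_def)
    then have "largest_component n (r n) \<omega> = largest_component n (r n) \<omega>'"
      "induces_connected n (r n) \<omega> = induces_connected n (r n) \<omega>'"
      "sdeg n (r n) \<omega> = sdeg n (r n) \<omega>'" "stat n (r n) \<omega> = stat n (r n) \<omega>'"
      "edges_between n (r n) \<omega> = edges_between n (r n) \<omega>'"
      unfolding largest_component_def components_def induces_connected_def sdeg_def vdeg_def
        edges_between_def stat_def fun_eq_iff using eq(2) by simp_all
    then show "ok n \<omega> = ok n \<omega>'" unfolding ok_def by (simp only:)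
  qed
  have good: "1 - err n \<le> measure (ppp n) (ev n) \<and> measure (ppp n) (ev n) \<le> 1"
    if ln1: "1 \<le> ln (real n)" and ln2: "real k0 \<le> ln (real n)"
      and ln3: "1400 * r_max * ln (real n) \<le> sqrt (real n)"
      and ln4: "40000 * r_max * (ln (real n))\<^sup>2 \<le> sqrt (real n)" for n
  proof -
    define \<rho> where "\<rho> = r n"
    define kap where "kap = nat \<lceil>ln (real n)\<rceil>"
    define ell where "ell = 100 * kap"
    \<comment> \<open>Rounding up keeps \<open>s\<close> at most \<open>0.35 * \<rho>\<close>. As
      the side is at least \<open>7 * \<rho> * ell\<close>, the quotient is at least 20, so rounding
      shrinks \<open>s\<close> by a factor no smaller than 20/21, and 0.35 * 20/21 = 1/3.\<close>
    define M where "M = \<lceil>side n / (35 / 100 * \<rho> * real ell)\<rceil>"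
    define s where "s = side n / of_int (int ell * M)"
    have \<rho>: "4 \<le> \<rho>" "\<rho> \<le> r_max" using rr by (auto simp: \<rho>_def)
    have n: "0 < n" using ln1 by (cases n) auto
    have kap: "ln (real n) \<le> real kap" "real kap \<le> 2 * ln (real n)" "0 < kap"
      using ln1 unfolding kap_def by linarith+
    have ell: "real ell \<le> 200 * ln (real n)" "100 \<le> real ell" "0 < ell" using kap by (auto simp: ell_def)
    have side: "0 < side n" "side n = sqrt (real n)" using n by (auto simp: side_def)
    have "7 * r_max * real ell \<le> 7 * r_max * (200 * ln (real n))" using ell rmax by (intro mult_left_mono) auto
    then have e1: "7 * r_max * real ell \<le> side n" using ln3 side by simp
    have e1': "7 * \<rho> * real ell \<le> side n"
      using e1 mult_right_mono[of "7 * \<rho>" "7 * r_max" "real ell"] \<rho> by simp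
    have "(real ell)\<^sup>2 \<le> (200 * ln (real n))\<^sup>2" using ell by (intro power_mono) auto
    then have ell2: "(real ell)\<^sup>2 \<le> 40000 * (ln (real n))\<^sup>2" by (simp add: power2_eq_square)
    have "\<rho> * (real ell)\<^sup>2 \<le> r_max * (40000 * (ln (real n))\<^sup>2)" using ell2 \<rho> by (intro mult_mono) auto
    then have e2: "\<rho> * (real ell)\<^sup>2 \<le> side n" using ln4 side by simp
    have den: "0 < 35 / 100 * \<rho> * real ell" using \<rho> ell by simp
    define q where "q = side n / (35 / 100 * \<rho> * real ell)"
    have q: "q * (35 / 100 * \<rho> * real ell) = side n"
      unfolding q_def using \<rho> ell by simp
    have Mq: "q \<le> of_int M" "of_int M \<le> q + 1" unfolding M_def q_def by linarith+
    have "real ell \<le> q"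
    proof -
      have "real ell * (35 / 100 * \<rho> * real ell) = 35 / 100 * (\<rho> * (real ell)\<^sup>2)" by (simp add: power2_eq_square)
      also have "\<dots> \<le> \<rho> * (real ell)\<^sup>2" using \<rho> by simp
      also have "\<dots> \<le> q * (35 / 100 * \<rho> * real ell)" using e2 q by simp
      finally show ?thesis using den by (simp only: mult_le_cancel_right_pos)
    qed
    then have ellM: "int ell \<le> M" using Mq(1) by linarith
    have M_pos: "0 < real_of_int M" using ellM ell(3) by linarith
    have m_pos: "0 < real_of_int (int ell * M)" using M_pos ell by simp
    have s_eq: "side n = s * of_int (int ell * M)" using M_pos ell by (simp add: s_def)
    have s1: "s \<le> 35 / 100 * \<rho>"
    proof -
      have "side n \<le> of_int M * (35 / 100 * \<rho> * real ell)" using q Mq(1) den by (metis mult_right_mono less_imp_le)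
      then show ?thesis unfolding s_def using m_pos by (simp add: pos_divide_le_eq mult_ac)
    qed
    have s2: "\<rho> \<le> 3 * s"
    proof -
      have "\<rho> * (real ell * of_int M) \<le> \<rho> * (real ell * (q + 1))" using Mq(2) \<rho> by (intro mult_left_mono) auto
      also have "\<dots> = 20 / 7 * (q * (35 / 100 * \<rho> * real ell)) + \<rho> * real ell" by (simp add: algebra_simps)
      also have "\<dots> \<le> 3 * side n" unfolding q using e1' by simp
      finally have "\<rho> * real_of_int (int ell * M) \<le> 3 * side n" by simp
      then show ?thesis unfolding s_def using m_pos by (simp add: pos_le_divide_eq)
    qed
    have s_low: "4 / 3 \<le> s" using s2 \<rho> by linarith
    have s_up: "s \<le> r_max" using s1 \<rho> by linarith
    interpret cell_scale n kap ell s M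
      by unfold_locales (fact s_low kap(3) ell_def ellM s_eq)+
    interpret prob_space "ppp n" by (rule prob_space_n)
    have k0: "0 < k0" "k0 \<le> ell" using ln2 kap by (auto simp: k0_def ell_def)
    have "s\<^sup>2 \<le> r_max\<^sup>2" using s_up s_low by (intro power_mono) auto
    then have k0s: "8 * s\<^sup>2 \<le> real k0" unfolding k0_def by linarith
    have mn: "(real_of_int (int ell * M))\<^sup>2 * s\<^sup>2 = real n"
      using s_eq side(2) by (metis mult.commute of_nat_0_le_iff power_mult_distrib real_sqrt_pow2)
    have mn1: "(real_of_int (int ell * M))\<^sup>2 \<le> real n"
    proof -
      have "1 \<le> s\<^sup>2" using s_low power_mono[of 1 s 2] by simp
      then have "(real_of_int (int ell * M))\<^sup>2 * 1 \<le> (real_of_int (int ell * M))\<^sup>2 * s\<^sup>2" by (intro mult_left_mono) auto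
      then show ?thesis using mn by simp
    qed
    have mn2: "real n \<le> (real_of_int (int ell * M))\<^sup>2 * r_max\<^sup>2"
      using mn mult_left_mono[OF \<open>s\<^sup>2 \<le> r_max\<^sup>2\<close>, of "(real_of_int (int ell * M))\<^sup>2"] by simp
    let ?bad = "sparse_path_event \<union> crowded_event k0"
    have bad_meas: "?bad \<in> sets (ppp n)" using sparse_path_prob(1) crowded_prob(1)[OF k0(1) k0s] by simp
    have "measure (ppp n) ?bad \<le> measure (ppp n) sparse_path_event + measure (ppp n) (crowded_event k0)"
      by (rule measure_Un_le[OF sparse_path_prob(1) crowded_prob(1)[OF k0(1) k0s]])
    also have "\<dots> \<le> (real_of_int (int ell * M))\<^sup>2 * ((1 + real ell) * exp (- 4 * real kap))"
      using sparse_path_prob(2) crowded_prob(2)[OF k0(1) k0s] by (simp add: algebra_simps)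
    also have "\<dots> \<le> real n * ((1 + 200 * ln (real n)) * exp (- 4 * ln (real n)))"
      using mn1 ell kap ln1 by (intro mult_mono) auto
    finally have bad: "measure (ppp n) ?bad \<le> err n" by (simp add: err_def mult.assoc)
    have "space (ppp n) - ?bad \<subseteq> ev n"
    proof
      fix \<omega> assume w: "\<omega> \<in> space (ppp n) - ?bad"
      have "c * sqrt (real (sdeg n (r n) \<omega> A)) \<le> real (edges_between n (r n) \<omega> A (L - A))"
        if L: "largest_component n (r n) \<omega> L" and A: "A \<subseteq> L" "induces_connected n (r n) \<omega> A"
          "stat n (r n) \<omega> L A \<le> 1/2" "C * (ln (real n))\<^sup>2 / real n \<le> stat n (r n) \<omega> L A" for L A
      proof -
        note off = edge_boundary_off_events[OF s1[unfolded \<rho>_def] s2[unfolded \<rho>_def] k0 _ _ _ L, folded K0_def]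
        have dL: "(real_of_int (int ell * M))\<^sup>2 \<le> 900 * real (sdeg n (r n) \<omega> L)" using off(1) w by simp
        have "0 < (real_of_int (int ell * M))\<^sup>2" using m_pos by (rule zero_less_power)
        then have dL0: "0 < real (sdeg n (r n) \<omega> L)" using dL by linarith
        have "real n \<le> 900 * r_max\<^sup>2 * real (sdeg n (r n) \<omega> L)"
          using mn2 mult_right_mono[OF dL, of "r_max\<^sup>2"] by (simp add: mult_ac)
        then have "441 * 40000 * 2 * K0 * (ln (real n))\<^sup>2 * real n
            \<le> 441 * 40000 * 2 * K0 * (ln (real n))\<^sup>2 * (900 * r_max\<^sup>2 * real (sdeg n (r n) \<omega> L))"
          using K0 by (intro mult_left_mono) auto
        also have "\<dots> = C * (ln (real n))\<^sup>2 * real (sdeg n (r n) \<omega> L)" by (simp add: C_def mult_ac)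
        also have "\<dots> \<le> real (sdeg n (r n) \<omega> A) * real n"
          using A(4) dL0 n unfolding stat_def by (simp add: field_simps)
        finally have "441 * 40000 * 2 * K0 * (ln (real n))\<^sup>2 \<le> real (sdeg n (r n) \<omega> A)"
          using n by (simp only: mult_le_cancel_right_pos of_nat_0_less_iff)
        moreover have "441 * K0 * (real ell)\<^sup>2 < 441 * 40000 * 2 * K0 * (ln (real n))\<^sup>2"
        proof -
          have "0 < (ln (real n))\<^sup>2" using ln1 by simp
          then have "(real ell)\<^sup>2 < 40000 * 2 * (ln (real n))\<^sup>2" using ell2 by linarith
          then have "441 * K0 * (real ell)\<^sup>2 < 441 * K0 * (40000 * 2 * (ln (real n))\<^sup>2)"
            using K0 by (intro mult_strict_left_mono) auto
          then show ?thesis by (simp add: mult_ac)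
        qed
        ultimately have "441 * K0 * (real ell)\<^sup>2 < real (sdeg n (r n) \<omega> A)" by linarith
        then have "sqrt (real (sdeg n (r n) \<omega> A)) / (20000000 * (49 * K0)\<^sup>2) \<le> real (edges_between n (r n) \<omega> A (L - A))"
          using off(2)[OF _ _ _ A(1-3)] w by simp
        then show ?thesis by (simp add: c_def)
      qed
      then show "\<omega> \<in> ev n" using w unfolding ev_def ok_def by blast
    qed
    then have "measure (ppp n) (space (ppp n) - ?bad) \<le> measure (ppp n) (ev n)"
      using ev_meas by (rule finite_measure_mono)
    moreover have "measure (ppp n) (space (ppp n) - ?bad) = 1 - measure (ppp n) ?bad" by (rule prob_compl[OF bad_meas])
    ultimately show ?thesis using bad prob_le_1[of "ev n"] by linarith
  qed
  have l1: "eventually (\<lambda>n. 1 \<le> ln (real n)) sequentially" by real_asymp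
  have "filterlim (\<lambda>n. ln (real n)) at_top sequentially" by real_asymp
  then have l2: "eventually (\<lambda>n. real k0 \<le> ln (real n)) sequentially" by (simp add: filterlim_at_top)
  have "(\<lambda>n. ln (real n) / sqrt (real n)) \<longlonglongrightarrow> 0" by real_asymp
  then have "eventually (\<lambda>n. ln (real n) / sqrt (real n) < 1 / (1400 * r_max)) sequentially"
    by (rule order_tendstoD) (use rmax in simp)
  then have l3: "eventually (\<lambda>n. 1400 * r_max * ln (real n) \<le> sqrt (real n)) sequentially"
    using eventually_gt_at_top[of 0]
  proof eventually_elim
    case (elim n)
    then show ?case using rmax by (simp add: field_simps)
  qed
  have "(\<lambda>n. (ln (real n))\<^sup>2 / sqrt (real n)) \<longlonglongrightarrow> 0" by real_asymp
  then have "eventually (\<lambda>n. (ln (real n))\<^sup>2 / sqrt (real n) < 1 / (40000 * r_max)) sequentially"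
    by (rule order_tendstoD) (use rmax in simp)
  then have l4: "eventually (\<lambda>n. 40000 * r_max * (ln (real n))\<^sup>2 \<le> sqrt (real n)) sequentially"
    using eventually_gt_at_top[of 0]
  proof eventually_elim
    case (elim n)
    then show ?case using rmax by (simp add: field_simps)
  qed
  have both: "eventually (\<lambda>n. 1 - err n \<le> measure (ppp n) (ev n) \<and> measure (ppp n) (ev n) \<le> 1) sequentially"
    using l1 l2 l3 l4 by eventually_elim (rule good)
  have "err \<longlonglongrightarrow> 0" unfolding err_def by real_asymp
  then have "(\<lambda>n. 1 - err n) \<longlonglongrightarrow> 1" using tendsto_diff[OF tendsto_const, of err 0 sequentially 1] by simp
  then have "(\<lambda>n. measure (ppp n) (ev n)) \<longlonglongrightarrow> 1"
  proof (rule tendsto_sandwich[rotated 2])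
    show "(\<lambda>n. 1 :: real) \<longlonglongrightarrow> 1" by simp
    show "eventually (\<lambda>n. 1 - err n \<le> measure (ppp n) (ev n)) sequentially"
      using both by eventually_elim simp
    show "eventually (\<lambda>n. measure (ppp n) (ev n) \<le> 1) sequentially" using both by eventually_elim simp
  qed
  then show ?thesis unfolding ev_def ok_def using C_pos c_pos by blast
qed

end
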